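(* Let $\beta,\lambda,c>0$, $b>0$, $a>0$, $f,h\in\mathcal S(\mathbb R)$ and $t>0$. Write $\eta_0(f,h)=\beta^{-1}\int_{\mathbb R}f(u)h(u)\,du$. A) Case $b\le 1$. (i) If $a<b$, then $\partial_t\eta^n_t(f,h)\to0$ and $\lim_{n\to\infty}\eta^n_t(f,h)=\eta_0(f,h)$. (ii) If $a=b$, then $\lim_{n\to\infty}\eta^n_t(f,h)=\beta^{-1}\iint_{\mathbb R^2}f(u)h(v)P_t(u-v)\,du\,dv$, where $\{P_t\}_{t\ge0}$ is the semigroup generated by $\mathbf 1_{b=1}\times2\nabla-2c\,\mathrm{Id}$. (iii) If $a>b$, then $\lim_{n\to\infty}\eta^n_t(f,h)=0$. B) Case $1<b<2$. (i) If $a<b$ and $a\in(0,1)$, then $\partial_t\eta^n_t(f,h)\to0$ and $\lim_{n\to\infty}\eta^n_t(f,h)=\eta_0(f,h)$. (ii) If $a<b$ and $a\in(1,2)$, then $\partial_t\widetilde\eta^n_t(f,h)\to0$ and $\lim_{n\to\infty}\widetilde\eta^n_t(f,h)=\eta_0(f,h)$. (iii) If $a=1$, then $\lim_{n\to\infty}\eta^n_t(f,h)=\beta^{-1}\iint_{\mathbb R^2}f(u)h(v)P_t(u-v)\,du\,dv$, where $\{P_t\}_{t\ge0}$ is the semigroup generated by $2\nabla$. (iv) If $a=b$, then $\widetilde\eta^n_t(f,h)$ converges to $\eta_t(f,h)$, the solution of $\partial_t\eta_t(f,h)=-2c\,\eta_t(f,h)$ with initial condition $\eta_0(f,h)=\beta^{-1}\int_{\mathbb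 R}f(u)h(u)\,du$. (v) If $a>b$, then $\lim_{n\to\infty}\eta^n_t(f,h)=0$. C) Case $b\ge2$. (i) If $a\in(0,1)$, then $\partial_t\eta^n_t(f,h)\to0$ and $\lim_{n\to\infty}\eta^n_t(f,h)=\eta_0(f,h)$. (ii) If $a\in(1,2)$, then $\partial_t\widetilde\eta^n_t(f,h)\to0$ and $\lim_{n\to\infty}\widetilde\eta^n_t(f,h)=\eta_0(f,h)$. (iii) If $a=1$, then $\lim_{n\to\infty}\eta^n_t(f,h)=\beta^{-1}\iint_{\mathbb R^2}f(u)h(v)P_t(u-v)\,du\,dv$, where $\{P_t\}_{t\ge0}$ is the semigroup generated by $2\nabla$. (iv) If $a=2$, then $\lim_{n\to\infty}\widetilde\eta^n_t(f,h)=\beta^{-1}\iint_{\mathbb R^2}f(u)h(v)P_t(u-v)\,du\,dv$, where $\{P_t\}_{t\ge0}$ is the semigroup generated by $\lambda\Delta-\mathbf 1_{b=2}\times2c\,\mathrm{Id}$. (v) If $a>2$, then $\lim_{n\to\infty}\eta^n_t(f,h)=0$.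
   Context: $\mathcal S(\mathbb R)$ is the Schwartz space; $\nabla=d/dx$, $\Delta=d^2/dx^2$ on $\mathbb R$. For a generator $\mathcal G$ among those listed, $P_t$ denotes the tempered distribution solving $\partial_tP_t=\mathcal GP_t$, $P_0=\delta_0$ (fundamental solution), and $\iint f(u)h(v)P_t(u-v)\,du\,dv$ means the pairing of $P_t$ with the function $x\mapsto\int_{\mathbb R}f(v+x)h(v)\,dv$. All limits are as $n\to\infty$. For an integer $n\ge 1$ put $\gamma_n=c\,n^{-b}$. The configuration space is $\Omega=\mathbb R^{\mathbb Z}$, with elements $\omega=(\omega_x)_{x\in\mathbb Z}$. The Markov process $\{\omega(t)\}_{t\ge0}$ (which depends on $n$) has generator $\mathcal L_n=\mathcal A+\gamma_n\mathcal S^{\rm flip}+\lambda\,\mathcal S^{\rm exch}$, acting on smooth local bounded functions $f:\Omega\to\mathbb R$ by $$\mathcal A f=\sum_{x\in\mathbb Z}(\omega_{x+1}-\omega_{x-1})\,\partial_{\omega_x}f,\quad \mathcal S^{\rm flip}f(\omega)=\sum_{x\in\mathbb Z}\big(f(\omega^x)-f(\omega)\big),\quad \mathcal S^{\rm exch}f(\omega)=\sum_{x\in\mathbb Z}\big(f(\omega^{x,x+1})-f(\omega)\big),$$ where $\omega^x$ is $\omega$ with $\omega_x$ replaced by $-\omega_x$, and $\omega^{x,x+1}$ is $\omega$ with $\omega_x$ and $\omega_{x+1}$ exchanged. The Gaussian product measure $\mu_\beta(d\omega)=\prod_{x\in\mathbb Z}\sqrt{\beta/(2\pi)}\,e^{-\beta\omega_x^2/2}\,d\omega_x$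 is invariant, and the process is started from $\mu_\beta$; $\langle\cdot\rangle_\beta$ denotes expectation for this stationary process. The space-time correlation functions of the volume fluctuation field in the time scale $tn^a$ are $$\eta^n_t(f,h)=\frac1n\sum_{x,y\in\mathbb Z}f\big(\tfrac xn\big)h\big(\tfrac yn\big)\langle\omega_x(tn^a)\,\omega_y(0)\rangle_\beta,\qquad \widetilde\eta^n_t(f,h)=\frac1n\sum_{x,y\in\mathbb Z}f\big(\tfrac{x+2tn^a}{n}\big)h\big(\tfrac yn\big)\langle\omega_x(tn^a)\,\omega_y(0)\rangle_\beta ,$$ the second one being used for $a>1$. *)

theory Defs
  imports "HOL-Probability.Probability"
begin

section \<open>Schwartz functions, tempered distributions, fundamental solutions\<close>

definition schwartz :: "(real \<Rightarrow> real) \<Rightarrow> bool" where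
  "schwartz \<phi> \<longleftrightarrow>
     (\<forall>k x. (deriv ^^ k) \<phi> differentiable at x) \<and>
     (\<forall>j k. bounded (range (\<lambda>x. x ^ j * (deriv ^^ k) \<phi> x)))"

definition schwartz_seminorm :: "nat \<Rightarrow> nat \<Rightarrow> (real \<Rightarrow> real) \<Rightarrow> real" where
  "schwartz_seminorm j k \<phi> = (SUP x. \<bar>x ^ j * (deriv ^^ k) \<phi> x\<bar>)"

text \<open>Distributions are functionals on all functions \<open>real \<Rightarrow> real\<close>, of which only the values at
  Schwartz functions matter.\<close>

type_synonym distribution = "(real \<Rightarrow> real) \<Rightarrow> real"

definition tempered :: "distribution \<Rightarrow> bool" where
  "tempered T \<longleftrightarrow>
     (\<forall>\<phi> \<psi> r s. schwartz \<phi> \<longrightarrow> schwartz \<psi> \<longrightarrow> T (\<lambda>x. r * \<phi> x + s * \<psi> x) = r * T \<phi> + s * T \<psi>) \<and>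
     (\<exists>C N. \<forall>\<phi>. schwartz \<phi> \<longrightarrow> \<bar>T \<phi>\<bar> \<le> C * (\<Sum>j\<le>N. \<Sum>k\<le>N. schwartz_seminorm j k \<phi>))"

definition dist_nabla :: "distribution \<Rightarrow> distribution" where
  "dist_nabla T = (\<lambda>\<phi>. - T (deriv \<phi>))"

definition dist_laplace :: "distribution \<Rightarrow> distribution" where
  "dist_laplace T = dist_nabla (dist_nabla T)"

text \<open>\<open>is_fundamental_solution G P\<close>: the curve \<open>t \<mapsto> P t\<close> of tempered distributions solves
  \<open>\<partial>\<^sub>t P = G P\<close> on \<open>[0, \<infinity>)\<close> with \<open>P 0\<close> the Dirac mass at the origin; the time derivative is taken
  in the weak sense, i.e. after testing against a fixed Schwartz function (one-sided at time 0).\<close>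

definition is_fundamental_solution ::
    "(distribution \<Rightarrow> distribution) \<Rightarrow> (real \<Rightarrow> distribution) \<Rightarrow> bool" where
  "is_fundamental_solution G P \<longleftrightarrow>
     (\<forall>t\<ge>0. tempered (P t)) \<and>
     (\<forall>\<phi>. schwartz \<phi> \<longrightarrow> P 0 \<phi> = \<phi> 0) \<and>
     (\<forall>\<phi> t. schwartz \<phi> \<longrightarrow> t \<ge> 0 \<longrightarrow>
        ((\<lambda>s. P s \<phi>) has_real_derivative G (P t) \<phi>) (at t within {0..}))"

text \<open>The description is on values, since a solution is unique only up to its values at functions
  outside the Schwartz space and at negative times.\<close>

definition fundamental_solution :: "(distribution \<Rightarrow> distribution) \<Rightarrow> real \<Rightarrow> distribution" where
  "fundamental_solution G t \<phi> = (THE r. \<exists>P. is_fundamental_solution G P \<and> P t \<phi> = r)"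

text \<open>This is \<open>\<integral>\<integral> f(u) h(v) T(u - v) du dv\<close>.\<close>

definition dist_pairing :: "distribution \<Rightarrow> (real \<Rightarrow> real) \<Rightarrow> (real \<Rightarrow> real) \<Rightarrow> real" where
  "dist_pairing T f h = T (\<lambda>x. LINT v|lborel. f (v + x) * h v)"

section \<open>Configurations and the formal generator\<close>

type_synonym config = "int \<Rightarrow> real"

abbreviation config_space :: "config measure" where
  "config_space \<equiv> PiM UNIV (\<lambda>_. borel)"

definition gibbs :: "real \<Rightarrow> config measure" where
  "gibbs \<beta> = PiM UNIV (\<lambda>_. density lborel (\<lambda>r. ennreal (sqrt (\<beta> / (2 * pi)) * exp (- \<beta> * r\<^sup>2 / 2))))"

definition local_fun :: "(config \<Rightarrow> real) \<Rightarrow> bool" where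
  "local_fun f \<longleftrightarrow> (\<exists>S. finite S \<and> (\<forall>\<sigma> \<sigma>'. (\<forall>x\<in>S. \<sigma> x = \<sigma>' x) \<longrightarrow> f \<sigma> = f \<sigma>'))"

definition pderiv_at :: "int \<Rightarrow> (config \<Rightarrow> real) \<Rightarrow> config \<Rightarrow> real" where
  "pderiv_at x f \<sigma> = deriv (\<lambda>r. f (\<sigma>(x := r))) (\<sigma> x)"

text \<open>All iterated partial derivatives exist and are continuous for the product topology; for a
  function of finitely many coordinates this is \<open>C\<^sup>\<infinity>\<close> smoothness in these coordinates.\<close>

definition smooth_fun :: "(config \<Rightarrow> real) \<Rightarrow> bool" where
  "smooth_fun f \<longleftrightarrow>
     (\<forall>xs. continuous_on UNIV (fold pderiv_at xs f) \<and>
       (\<forall>x \<sigma>. (\<lambda>r. fold pderiv_at xs f (\<sigma>(x := r))) differentiable at (\<sigma> x)))"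

text \<open>For local functions the sums over the lattice below have finitely many nonzero terms.\<close>

definition gen_A :: "(config \<Rightarrow> real) \<Rightarrow> config \<Rightarrow> real" where
  "gen_A f \<sigma> = (\<Sum>\<^sub>\<infinity>x\<in>UNIV. (\<sigma> (x + 1) - \<sigma> (x - 1)) * pderiv_at x f \<sigma>)"

definition gen_flip :: "(config \<Rightarrow> real) \<Rightarrow> config \<Rightarrow> real" where
  "gen_flip f \<sigma> = (\<Sum>\<^sub>\<infinity>x\<in>UNIV. (f (\<sigma>(x := - \<sigma> x)) - f \<sigma>))"

definition gen_exch :: "(config \<Rightarrow> real) \<Rightarrow> config \<Rightarrow> real" where
  "gen_exch f \<sigma> = (\<Sum>\<^sub>\<infinity>x\<in>UNIV. (f (\<sigma>(x := \<sigma> (x + 1), x + 1 := \<sigma> x)) - f \<sigma>))"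

definition gen_L :: "real \<Rightarrow> real \<Rightarrow> (config \<Rightarrow> real) \<Rightarrow> config \<Rightarrow> real" where
  "gen_L \<gamma> lam f \<sigma> = gen_A f \<sigma> + \<gamma> * gen_flip f \<sigma> + lam * gen_exch f \<sigma>"

section \<open>The stationary Markov process\<close>

definition markov_semigroup :: "(real \<Rightarrow> config \<Rightarrow> config measure) \<Rightarrow> bool" where
  "markov_semigroup K \<longleftrightarrow>
     (\<forall>t\<ge>0. K t \<in> config_space \<rightarrow>\<^sub>M prob_algebra config_space) \<and>
     (\<forall>\<sigma>. K 0 \<sigma> = return config_space \<sigma>) \<and>
     (\<forall>s\<ge>0. \<forall>t\<ge>0. \<forall>\<sigma>. K (s + t) \<sigma> = K s \<sigma> \<bind> K t)"

definition natural_filtration :: "'w measure \<Rightarrow> (real \<Rightarrow> 'w \<Rightarrow> config) \<Rightarrow> real \<Rightarrow> 'w measure" where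
  "natural_filtration M X s =
     sigma (space M) (\<Union>r\<in>{0..s}. {X r -` B \<inter> space M | B. B \<in> sets config_space})"

definition markov_process ::
    "'w measure \<Rightarrow> (real \<Rightarrow> 'w \<Rightarrow> config) \<Rightarrow> (real \<Rightarrow> config \<Rightarrow> config measure) \<Rightarrow> bool" where
  "markov_process M X K \<longleftrightarrow>
     prob_space M \<and> (\<forall>t\<ge>0. X t \<in> M \<rightarrow>\<^sub>M config_space) \<and> markov_semigroup K \<and>
     (\<forall>s\<ge>0. \<forall>t\<ge>0. \<forall>B\<in>sets config_space. AE w in M.
        real_cond_exp M (natural_filtration M X s) (\<lambda>w. indicat_real B (X (s + t) w)) w
          = measure (K t (X s w)) B)"

text \<open>\<open>g\<close> is the value at the bounded function \<open>f\<close> of the infinitesimal generator, in \<open>L\<^sup>2(\<mu>)\<close>, of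
  the semigroup with transition kernels \<open>K\<close>. The \<open>ennreal\<close>-valued integral rules out the default
  value of the Bochner integral.\<close>

definition L2_generator ::
    "config measure \<Rightarrow> (real \<Rightarrow> config \<Rightarrow> config measure) \<Rightarrow> (config \<Rightarrow> real) \<Rightarrow> (config \<Rightarrow> real) \<Rightarrow> bool" where
  "L2_generator \<mu> K f g \<longleftrightarrow>
     ((\<lambda>t. \<integral>\<^sup>+\<sigma>. ennreal ((((LINT \<sigma>'|K t \<sigma>. f \<sigma>') - f \<sigma>) / t - g \<sigma>)\<^sup>2) \<partial>\<mu>) \<longlongrightarrow> 0) (at_right 0)"

text \<open>A smooth bounded local function may have unbounded partial derivatives, so that the image
  under the formal generator need not be square integrable; such functions cannot belong to the
  domain of the \<open>L\<^sup>2\<close> generator and are left out.\<close>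

definition stationary_process ::
    "real \<Rightarrow> real \<Rightarrow> real \<Rightarrow> 'w measure \<Rightarrow> (real \<Rightarrow> 'w \<Rightarrow> config) \<Rightarrow>
     (real \<Rightarrow> config \<Rightarrow> config measure) \<Rightarrow> bool" where
  "stationary_process \<beta> \<gamma> lam M X K \<longleftrightarrow>
     markov_process M X K \<and>
     (\<forall>f. smooth_fun f \<longrightarrow> local_fun f \<longrightarrow> bounded (range f) \<longrightarrow>
        integrable (gibbs \<beta>) (\<lambda>\<sigma>. (gen_L \<gamma> lam f \<sigma>)\<^sup>2) \<longrightarrow>
        L2_generator (gibbs \<beta>) K f (gen_L \<gamma> lam f)) \<and>
     (\<forall>t\<ge>0. gibbs \<beta> \<bind> K t = gibbs \<beta>) \<and>
     distr M config_space (X 0) = gibbs \<beta>"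

section \<open>Correlation functions of the fluctuation field\<close>

text \<open>\<open>M n\<close> and \<open>X n\<close> are the probability space and the process with parameter \<open>n\<close>.\<close>

definition eta ::
    "(nat \<Rightarrow> 'w measure) \<Rightarrow> (nat \<Rightarrow> real \<Rightarrow> 'w \<Rightarrow> config) \<Rightarrow> real \<Rightarrow>
     (real \<Rightarrow> real) \<Rightarrow> (real \<Rightarrow> real) \<Rightarrow> nat \<Rightarrow> real \<Rightarrow> real" where
  "eta M X a f h n t = 1 / real n *
     (\<Sum>\<^sub>\<infinity>(x, y)\<in>UNIV. f (of_int x / real n) * h (of_int y / real n) *
        (LINT w|M n. X n (t * real n powr a) w x * X n 0 w y))"

definition eta_tilde ::
    "(nat \<Rightarrow> 'w measure) \<Rightarrow> (nat \<Rightarrow> real \<Rightarrow> 'w \<Rightarrow> config) \<Rightarrow> real \<Rightarrow>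
     (real \<Rightarrow> real) \<Rightarrow> (real \<Rightarrow> real) \<Rightarrow> nat \<Rightarrow> real \<Rightarrow> real" where
  "eta_tilde M X a f h n t = 1 / real n *
     (\<Sum>\<^sub>\<infinity>(x, y)\<in>UNIV. f ((of_int x + 2 * t * real n powr a) / real n) * h (of_int y / real n) *
        (LINT w|M n. X n (t * real n powr a) w x * X n 0 w y))"

definition eta0 :: "real \<Rightarrow> (real \<Rightarrow> real) \<Rightarrow> (real \<Rightarrow> real) \<Rightarrow> real" where
  "eta0 \<beta> f h = 1 / \<beta> * (LINT u|lborel. f u * h u)"

definition time_deriv_vanishes :: "(nat \<Rightarrow> real \<Rightarrow> real) \<Rightarrow> real \<Rightarrow> bool" where
  "time_deriv_vanishes e t \<longleftrightarrow>
     (\<forall>n\<ge>1. e n differentiable at t) \<and> (\<lambda>n. deriv (e n) t) \<longlonglongrightarrow> 0"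

end

theory Submission
  imports Defs
begin

text \<open>
  Write \<open>u t x y\<close> for the expectation of \<open>\<omega>\<^sub>x(t) \<omega>\<^sub>y(0)\<close>. The truncations \<open>R sin (\<omega>\<^sub>x / R)\<close> lie in
  the domain of the generator, and letting \<open>R \<rightarrow> \<infinity>\<close> shows that \<open>u\<close> solves a closed linear equation on
  the lattice; since the \<open>\<omega>\<^sub>x\<close> are orthogonal in \<open>L\<^sup>2\<close>, the bilinear form of \<open>u\<close> is bounded in
  \<open>\<ell>\<^sup>2\<close>. The correlation field is then computed by duality: a Schwartz function is transported back in
  time by the drift-diffusion semigroup with drift \<open>2 / n\<close>, diffusivity \<open>lam / n\<^sup>2\<close> and
  damping \<open>2\<gamma>\<close> in lattice time, which solves the backward lattice equation up to an error of third order in the mesh. The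
  error is negligible for time scales \<open>n\<^sup>a\<close> with \<open>a < 3\<close>, so that what remains is a Riemann sum at
  time \<open>0\<close>. When the limit is \<open>0\<close> it suffices to go back by a shorter time \<open>n\<^bsup>a'\<^esup>\<close> with
  \<open>a' < 3\<close>, because the form is bounded at all times and the transported function is already small in
  \<open>\<ell>\<^sup>2\<close>. Uniqueness of the fundamental solution follows from the duality with the same semigroup.
\<close>

section \<open>Schwartz functions and Gaussian averages\<close>

text \<open>The generator is given only on bounded local functions and only as an \<open>L2\<close>
  limit of difference quotients at time 0, while a coordinate is unbounded. A sine is chosen as
  truncation because its partial derivatives are again sines and because its slope, a cosine, is
  bounded by 1 and tends to 1, so that the drift term stays dominated by coordinates. The Markov
  property carries the quotient to any time and stationarity makes its error uniform in time; an
  integral equation then replaces differentiability of the truncated correlations. The drift error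
  is of third order because the even Taylor terms cancel in a central difference. Accumulated over a
  lattice time of order n^a on the mesh 1/n, it is of order n^(a-3). Transport and diffusion are
  both averages over an affine image of one standard normal variable; zero variance gives a
  translation, so all regimes share one formula. Uniqueness of the fundamental solution meets the
  obstacle that the constants in \<open>tempered\<close> may depend on time without control; a
  uniform boundedness principle supplies common ones.\<close>

lemma has_real_derivative_integral:
  fixes F F' :: "real \<Rightarrow> 'a \<Rightarrow> real"
  assumes S: "convex S" "s0 \<in> S"
    and int: "\<And>s. s \<in> S \<Longrightarrow> integrable M (F s)"
    and der: "\<And>s x. s \<in> S \<Longrightarrow> ((\<lambda>s. F s x) has_real_derivative F' s x) (at s within S)"
    and dom: "\<And>s x. s \<in> S \<Longrightarrow> \<bar>F' s x\<bar> \<le> w x" "integrable M w"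
    and meas: "F' s0 \<in> borel_measurable M"
  shows "((\<lambda>s. LINT x|M. F s x) has_real_derivative (LINT x|M. F' s0 x)) (at s0 within S)"
  unfolding has_field_derivative_iff tendsto_at_iff_sequentially comp_def
proof (intro allI impI)
  fix X assume X: "\<forall>i. X i \<in> S - {s0}" "X \<longlonglongrightarrow> s0"
  have XS: "X i \<in> S" "X i \<noteq> s0" for i using X by auto
  have "(\<lambda>i. LINT x|M. (F (X i) x - F s0 x) / (X i - s0)) \<longlonglongrightarrow> (LINT x|M. F' s0 x)"
  proof (rule integral_dominated_convergence[where w = w])
    show "AE x in M. (\<lambda>i. (F (X i) x - F s0 x) / (X i - s0)) \<longlonglongrightarrow> F' s0 x"
    proof (rule AE_I2)
      fix x
      have "((\<lambda>y. (F y x - F s0 x) / (y - s0)) \<longlongrightarrow> F' s0 x) (at s0 within S)"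
        using der[OF S(2), of x] by (simp add: has_field_derivative_iff)
      then show "(\<lambda>i. (F (X i) x - F s0 x) / (X i - s0)) \<longlonglongrightarrow> F' s0 x"
        unfolding tendsto_at_iff_sequentially comp_def using X by blast
    qed
    show "AE x in M. norm ((F (X i) x - F s0 x) / (X i - s0)) \<le> w x" for i
    proof (rule AE_I2)
      fix x
      \<comment> \<open>Convexity of \<open>S\<close> turns the bound on the derivative into one on
        the difference quotient. Later \<open>S\<close> often contains its endpoints, where
        derivatives are one-sided.\<close>
      have "norm (F (X i) x - F s0 x) \<le> w x * norm (X i - s0)"
        by (rule field_differentiable_bound[OF S(1) der[of _ x]]) (use dom XS S in auto)
      then show "norm ((F (X i) x - F s0 x) / (X i - s0)) \<le> w x"
        using XS[of i] by (simp add: abs_divide divide_le_eq)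
    qed
    show "(\<lambda>x. (F (X i) x - F s0 x) / (X i - s0)) \<in> borel_measurable M" for i
      using int[OF XS(1)[of i]] int[OF S(2)] by measurable
  qed (use dom meas in auto)
  then show "(\<lambda>i. ((LINT x|M. F (X i) x) - (LINT x|M. F s0 x)) / (X i - s0)) \<longlonglongrightarrow> (LINT x|M. F' s0 x)"
    using int[OF XS(1)] int[OF S(2)] by simp
qed

section \<open>Derivatives and decay of Schwartz functions\<close>

lemma schwartz_has_derivative:
  assumes "schwartz \<phi>"
  shows "((deriv ^^ k) \<phi> has_real_derivative (deriv ^^ Suc k) \<phi> x) (at x)"
  using assms by (auto simp: schwartz_def intro!: DERIV_deriv_iff_real_differentiable[THEN iffD2])

lemma schwartz_has_deriv:
  "schwartz \<phi> \<Longrightarrow> (\<phi> has_real_derivative deriv \<phi> x) (at x)"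
  using schwartz_has_derivative[of \<phi> 0] by simp

lemma schwartz_funpow_deriv:
  assumes "schwartz \<phi>" shows "schwartz ((deriv ^^ k) \<phi>)"
proof -
  have "(deriv ^^ j) ((deriv ^^ k) \<phi>) = (deriv ^^ (j + k)) \<phi>" for j by (simp add: funpow_add)
  then show ?thesis using assms by (simp add: schwartz_def)
qed

lemma schwartz_deriv: "schwartz \<phi> \<Longrightarrow> schwartz (deriv \<phi>)"
  using schwartz_funpow_deriv[of \<phi> 1] by simp

lemma one_plus_power_le:
  fixes a :: real assumes "0 \<le> a" shows "(1 + a) ^ m \<le> 2 ^ m * (1 + a ^ m)"
proof (cases "a \<le> 1")
  case True
  then have "(1 + a) ^ m \<le> 2 ^ m" using assms by (intro power_mono) auto
  also have "\<dots> \<le> 2 ^ m * (1 + a ^ m)" using assms by simp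
  finally show ?thesis .
next
  case False
  then have "(1 + a) ^ m \<le> (2 * a) ^ m" by (intro power_mono) auto
  also have "\<dots> \<le> 2 ^ m * (1 + a ^ m)" by (simp add: power_mult_distrib)
  finally show ?thesis .
qed

text \<open>The monomial weights of degree 0 and \<open>m\<close> combine into one weight that never
  vanishes and is submultiplicative under translation; this is the form in which decay is used for
  averages over translates.\<close>

lemma schwartz_decay:
  assumes "schwartz \<phi>"
  obtains C where "0 \<le> C" "\<And>x. (1 + \<bar>x\<bar>) ^ m * \<bar>(deriv ^^ k) \<phi> x\<bar> \<le> C"
proof -
  have "\<exists>C. \<forall>x. \<bar>x ^ j * (deriv ^^ k) \<phi> x\<bar> \<le> C" for j
    using assms unfolding schwartz_def bounded_iff by auto
  then obtain C where C: "\<And>j x. \<bar>x ^ j * (deriv ^^ k) \<phi> x\<bar> \<le> C j" by metis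
  have "(1 + \<bar>x\<bar>) ^ m * \<bar>(deriv ^^ k) \<phi> x\<bar> \<le> 2 ^ m * (C 0 + C m)" for x
  proof -
    have "(1 + \<bar>x\<bar>) ^ m \<le> 2 ^ m * (1 + \<bar>x\<bar> ^ m)" by (rule one_plus_power_le) simp
    then have "(1 + \<bar>x\<bar>) ^ m * \<bar>(deriv ^^ k) \<phi> x\<bar> \<le> 2 ^ m * (1 + \<bar>x\<bar> ^ m) * \<bar>(deriv ^^ k) \<phi> x\<bar>"
      by (rule mult_right_mono) simp
    also have "\<dots> = 2 ^ m * (\<bar>x ^ 0 * (deriv ^^ k) \<phi> x\<bar> + \<bar>x ^ m * (deriv ^^ k) \<phi> x\<bar>)"
      by (simp add: abs_mult power_abs algebra_simps)
    also have "\<dots> \<le> 2 ^ m * (C 0 + C m)" by (intro mult_left_mono add_mono C) simp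
    finally show ?thesis .
  qed
  moreover have "0 \<le> C j" for j using C[of 0 j] abs_ge_zero order_trans by blast
  ultimately show thesis by (intro that[of "2 ^ m * (C 0 + C m)"]) (auto simp: add_nonneg_nonneg)
qed

lemma schwartz_bounded:
  assumes "schwartz \<phi>" obtains C where "0 \<le> C" "\<And>x. \<bar>\<phi> x\<bar> \<le> C"
  using schwartz_decay[OF assms, of 0 0] by auto

lemma derivative_sequence:
  assumes "\<And>k x. (\<psi> k has_real_derivative \<psi> (Suc k) x) (at x)"
  shows "(deriv ^^ k) (\<psi> 0) = \<psi> k"
proof (induction k)
  case (Suc k)
  have "deriv (\<psi> k) = \<psi> (Suc k)" using DERIV_imp_deriv[OF assms] by auto
  with Suc show ?case by simp
qed simp

text \<open>An explicit sequence of candidate derivatives spares any computation with the iterated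
  \<open>deriv\<close>: by uniqueness of derivatives the sequence coincides with it.\<close>

lemma schwartzI:
  assumes "\<And>k x. (\<psi> k has_real_derivative \<psi> (Suc k) x) (at x)"
    and "\<And>m k. \<exists>C. \<forall>x. (1 + \<bar>x\<bar>) ^ m * \<bar>\<psi> k x\<bar> \<le> C"
  shows "schwartz (\<psi> 0)"
  unfolding schwartz_def derivative_sequence[of \<psi>, OF assms(1)]
proof (intro conjI allI)
  show "\<psi> k differentiable at x" for k x using assms(1) real_differentiable_def by blast
  show "bounded (range (\<lambda>x. x ^ j * \<psi> k x))" for j k
  proof -
    obtain C where C: "\<And>x. (1 + \<bar>x\<bar>) ^ j * \<bar>\<psi> k x\<bar> \<le> C" using assms(2) by blast
    have "norm (x ^ j * \<psi> k x) \<le> C" for x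
    proof -
      have "norm (x ^ j * \<psi> k x) \<le> (1 + \<bar>x\<bar>) ^ j * \<bar>\<psi> k x\<bar>"
        unfolding real_norm_def abs_mult power_abs by (intro mult_right_mono power_mono) auto
      with C[of x] show ?thesis by linarith
    qed
    then show ?thesis by (auto simp: bounded_iff)
  qed
qed

lemma schwartz_lincomb:
  assumes "schwartz \<phi>" "schwartz \<psi>"
  shows "schwartz (\<lambda>x. r * \<phi> x + s * \<psi> x)"
    and "(deriv ^^ k) (\<lambda>x. r * \<phi> x + s * \<psi> x) = (\<lambda>x. r * (deriv ^^ k) \<phi> x + s * (deriv ^^ k) \<psi> x)"
proof -
  define \<eta> where "\<eta> k = (\<lambda>x. r * (deriv ^^ k) \<phi> x + s * (deriv ^^ k) \<psi> x)" for k
  have \<eta>0: "\<eta> 0 = (\<lambda>x. r * \<phi> x + s * \<psi> x)" by (simp add: \<eta>_def)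
  have d: "(\<eta> k has_real_derivative \<eta> (Suc k) x) (at x)" for k x
    unfolding \<eta>_def
    by (intro DERIV_add DERIV_cmult schwartz_has_derivative assms)
  have "schwartz (\<eta> 0)"
  proof (rule schwartzI[where \<psi> = \<eta>, OF d])
    fix m k
    obtain C where C: "\<And>x. (1 + \<bar>x\<bar>) ^ m * \<bar>(deriv ^^ k) \<phi> x\<bar> \<le> C" using schwartz_decay[OF assms(1)] by blast
    obtain D where D: "\<And>x. (1 + \<bar>x\<bar>) ^ m * \<bar>(deriv ^^ k) \<psi> x\<bar> \<le> D" using schwartz_decay[OF assms(2)] by blast
    have "(1 + \<bar>x\<bar>) ^ m * \<bar>\<eta> k x\<bar> \<le> \<bar>r\<bar> * C + \<bar>s\<bar> * D" for x
    proof -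
      have "(1 + \<bar>x\<bar>) ^ m * \<bar>\<eta> k x\<bar> \<le> (1 + \<bar>x\<bar>) ^ m * (\<bar>r\<bar> * \<bar>(deriv ^^ k) \<phi> x\<bar> + \<bar>s\<bar> * \<bar>(deriv ^^ k) \<psi> x\<bar>)"
        unfolding \<eta>_def abs_mult[symmetric] by (intro mult_left_mono abs_triangle_ineq) auto
      also have "\<dots> = \<bar>r\<bar> * ((1 + \<bar>x\<bar>) ^ m * \<bar>(deriv ^^ k) \<phi> x\<bar>) + \<bar>s\<bar> * ((1 + \<bar>x\<bar>) ^ m * \<bar>(deriv ^^ k) \<psi> x\<bar>)"
        by (simp add: algebra_simps)
      also have "\<dots> \<le> \<bar>r\<bar> * C + \<bar>s\<bar> * D" by (intro add_mono mult_left_mono C D) auto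
      finally show ?thesis .
    qed
    then show "\<exists>C. \<forall>x. (1 + \<bar>x\<bar>) ^ m * \<bar>\<eta> k x\<bar> \<le> C" by blast
  qed
  then show "schwartz (\<lambda>x. r * \<phi> x + s * \<psi> x)" by (simp add: \<eta>0)
  show "(deriv ^^ k) (\<lambda>x. r * \<phi> x + s * \<psi> x) = (\<lambda>x. r * (deriv ^^ k) \<phi> x + s * (deriv ^^ k) \<psi> x)"
    using derivative_sequence[of \<eta>, OF d] unfolding \<eta>0 by (simp add: \<eta>_def)
qed

lemma schwartz_continuous: "schwartz \<phi> \<Longrightarrow> continuous_on S \<phi>"
  using DERIV_isCont[OF schwartz_has_deriv] by (auto intro!: continuous_at_imp_continuous_on)

lemma schwartz_measurable: "schwartz \<phi> \<Longrightarrow> \<phi> \<in> borel_measurable borel"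
  by (rule borel_measurable_continuous_onI[OF schwartz_continuous])

lemma integrable_inverse_square_lborel: "integrable lborel (\<lambda>x::real. 1 / (1 + x\<^sup>2))"
  using integrable_inverse_1_plus_square
  by (simp add: set_integrable_def divide_inverse)

lemma square_decay_le: "1 + x\<^sup>2 \<le> (1 + \<bar>x\<bar>)\<^sup>2" for x :: real
  by (simp add: power2_sum)

lemma schwartz_integrable_weighted:
  assumes "schwartz \<phi>"
  shows "integrable lborel (\<lambda>x. \<bar>\<phi> x\<bar> * (1 + \<bar>x\<bar>) ^ j)"
proof -
  \<comment> \<open>Two powers beyond \<open>j\<close> pay for the integrable factor 1 / (1 +
    x^2).\<close>
  obtain C where C: "0 \<le> C" "\<And>x. (1 + \<bar>x\<bar>) ^ (j + 2) * \<bar>\<phi> x\<bar> \<le> C"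
    using schwartz_decay[OF assms, of "j + 2" 0] by auto
  note [measurable] = schwartz_measurable[OF assms]
  show ?thesis
  proof (rule Bochner_Integration.integrable_bound[OF integrable_mult_right[of C, OF integrable_inverse_square_lborel]])
    show "AE x in lborel. norm (\<bar>\<phi> x\<bar> * (1 + \<bar>x\<bar>) ^ j) \<le> norm (C * (1 / (1 + x\<^sup>2)))"
    proof (rule AE_I2)
      fix x :: real
      have "(1 + x\<^sup>2) * (\<bar>\<phi> x\<bar> * (1 + \<bar>x\<bar>) ^ j) \<le> (1 + \<bar>x\<bar>)\<^sup>2 * (\<bar>\<phi> x\<bar> * (1 + \<bar>x\<bar>) ^ j)"
        by (intro mult_right_mono square_decay_le) auto
      also have "\<dots> \<le> C" using C(2)[of x] by (simp add: power_add power2_eq_square mult_ac)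
      finally have "\<bar>\<phi> x\<bar> * (1 + \<bar>x\<bar>) ^ j \<le> C / (1 + x\<^sup>2)"
        by (subst pos_le_divide_eq) (auto simp: mult_ac add_pos_nonneg)
      then show "norm (\<bar>\<phi> x\<bar> * (1 + \<bar>x\<bar>) ^ j) \<le> norm (C * (1 / (1 + x\<^sup>2)))"
        using C(1) by (simp add: abs_mult)
    qed
  qed measurable
qed

lemma schwartz_integrable: "schwartz \<phi> \<Longrightarrow> integrable lborel \<phi>"
  using schwartz_integrable_weighted[of \<phi> 0] schwartz_measurable
  by (auto intro: integrable_abs_cancel)

text \<open>Two averages over translates are instances: the correlation of two Schwartz functions
  (weight \<open>h\<close>, shift the integration variable) and the Gaussian average (weight 1,
  affine shift of a normal variable). Moments of all orders are what lets every polynomial weight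
  pass under the integral.\<close>

locale averaging =
  fixes M :: "'a measure" and w T :: "'a \<Rightarrow> real"
  assumes w_measurable [measurable]: "w \<in> borel_measurable M"
    and T_measurable [measurable]: "T \<in> borel_measurable M"
    and moments: "\<And>j. integrable M (\<lambda>v. \<bar>w v\<bar> * (1 + \<bar>T v\<bar>) ^ j)"
begin

definition avg :: "(real \<Rightarrow> real) \<Rightarrow> real \<Rightarrow> real" where
  "avg \<phi> x = (LINT v|M. w v * \<phi> (x + T v))"

lemma avg_integrable:
  assumes "\<phi> \<in> borel_measurable borel" "\<And>x. \<bar>\<phi> x\<bar> \<le> C"
  shows "integrable M (\<lambda>v. w v * \<phi> (x + T v))"
proof (rule Bochner_Integration.integrable_bound[OF integrable_mult_right[of C, OF moments[of 0]]])
  note [measurable] = assms(1)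
  show "(\<lambda>v. w v * \<phi> (x + T v)) \<in> borel_measurable M" by measurable
  show "AE v in M. norm (w v * \<phi> (x + T v)) \<le> norm (C * (\<bar>w v\<bar> * (1 + \<bar>T v\<bar>) ^ 0))"
  proof (rule AE_I2)
    fix v
    have "\<bar>w v\<bar> * \<bar>\<phi> (x + T v)\<bar> \<le> \<bar>w v\<bar> * \<bar>C\<bar>"
      using assms(2)[of "x + T v"] by (intro mult_left_mono) auto
    then show "norm (w v * \<phi> (x + T v)) \<le> norm (C * (\<bar>w v\<bar> * (1 + \<bar>T v\<bar>) ^ 0))"
      by (simp add: abs_mult mult.commute)
  qed
qed

lemma avg_decay:
  assumes \<phi>: "\<phi> \<in> borel_measurable borel" and C: "0 \<le> C" "\<And>x. (1 + \<bar>x\<bar>) ^ j * \<bar>\<phi> x\<bar> \<le> C"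
  shows "(1 + \<bar>x\<bar>) ^ j * \<bar>avg \<phi> x\<bar> \<le> C * (LINT v|M. \<bar>w v\<bar> * (1 + \<bar>T v\<bar>) ^ j)"
proof -
  have b: "\<bar>\<phi> x\<bar> \<le> C" for x
  proof -
    have "1 * \<bar>\<phi> x\<bar> \<le> (1 + \<bar>x\<bar>) ^ j * \<bar>\<phi> x\<bar>" by (intro mult_right_mono) auto
    with C(2)[of x] show ?thesis by linarith
  qed
  have "(1 + \<bar>x\<bar>) ^ j * \<bar>avg \<phi> x\<bar> \<le> (1 + \<bar>x\<bar>) ^ j * (LINT v|M. \<bar>w v * \<phi> (x + T v)\<bar>)"
    unfolding avg_def by (intro mult_left_mono integral_abs_bound) auto
  also have "\<dots> = (LINT v|M. (1 + \<bar>x\<bar>) ^ j * \<bar>w v * \<phi> (x + T v)\<bar>)" by simp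
  also have "\<dots> \<le> (LINT v|M. C * (\<bar>w v\<bar> * (1 + \<bar>T v\<bar>) ^ j))"
  proof (rule integral_mono)
    show "integrable M (\<lambda>v. (1 + \<bar>x\<bar>) ^ j * \<bar>w v * \<phi> (x + T v)\<bar>)"
      using avg_integrable[OF \<phi> b, of x] by (intro integrable_mult_right integrable_abs)
    show "integrable M (\<lambda>v. C * (\<bar>w v\<bar> * (1 + \<bar>T v\<bar>) ^ j))" by (intro integrable_mult_right moments)
    fix v
    \<comment> \<open>Peetre-type inequality: the weight at \<open>x\<close> is split between the
      translated point, where \<open>\<phi>\<close> decays, and the shift, where moments are
      available.\<close>
    have "1 + \<bar>x\<bar> \<le> (1 + \<bar>x + T v\<bar>) * (1 + \<bar>T v\<bar>)"
    proof -
      have "(1 + \<bar>x + T v\<bar>) * (1 + \<bar>T v\<bar>) = 1 + \<bar>x + T v\<bar> + \<bar>T v\<bar> + \<bar>x + T v\<bar> * \<bar>T v\<bar>"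
        by (simp add: algebra_simps)
      moreover have "0 \<le> \<bar>x + T v\<bar> * \<bar>T v\<bar>" by simp
      ultimately show ?thesis by linarith
    qed
    then have "(1 + \<bar>x\<bar>) ^ j \<le> (1 + \<bar>x + T v\<bar>) ^ j * (1 + \<bar>T v\<bar>) ^ j"
      unfolding power_mult_distrib[symmetric] by (intro power_mono) auto
    then have "(1 + \<bar>x\<bar>) ^ j * \<bar>w v * \<phi> (x + T v)\<bar>
        \<le> (1 + \<bar>x + T v\<bar>) ^ j * (1 + \<bar>T v\<bar>) ^ j * \<bar>w v * \<phi> (x + T v)\<bar>"
      by (intro mult_right_mono) auto
    also have "\<dots> = ((1 + \<bar>x + T v\<bar>) ^ j * \<bar>\<phi> (x + T v)\<bar>) * (\<bar>w v\<bar> * (1 + \<bar>T v\<bar>) ^ j)"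
      by (simp add: abs_mult mult_ac)
    also have "\<dots> \<le> C * (\<bar>w v\<bar> * (1 + \<bar>T v\<bar>) ^ j)" by (intro mult_right_mono C) auto
    finally show "(1 + \<bar>x\<bar>) ^ j * \<bar>w v * \<phi> (x + T v)\<bar> \<le> C * (\<bar>w v\<bar> * (1 + \<bar>T v\<bar>) ^ j)" .
  qed
  finally show ?thesis by simp
qed

lemma avg_has_derivative:
  assumes "schwartz \<phi>"
  shows "(avg \<phi> has_real_derivative avg (deriv \<phi>) x) (at x)"
proof -
  obtain C where C: "0 \<le> C" "\<And>x. \<bar>\<phi> x\<bar> \<le> C" using schwartz_bounded[OF assms] by blast
  obtain C' where C': "0 \<le> C'" "\<And>x. \<bar>deriv \<phi> x\<bar> \<le> C'" using schwartz_bounded[OF schwartz_deriv[OF assms]] by blast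
  note [measurable] = schwartz_measurable[OF assms] schwartz_measurable[OF schwartz_deriv[OF assms]]
  show ?thesis
    unfolding avg_def[abs_def]
  proof (rule has_real_derivative_integral[where w = "\<lambda>v. C' * \<bar>w v\<bar>"])
    show "integrable M (\<lambda>v. w v * \<phi> (s + T v))" for s by (rule avg_integrable[OF _ C(2)]) measurable
    show "((\<lambda>s. w v * \<phi> (s + T v)) has_real_derivative w v * deriv \<phi> (s + T v)) (at s)" for s v
    proof -
      have "((\<lambda>s. \<phi> (s + T v)) has_real_derivative deriv \<phi> (s + T v) * 1) (at s)"
        by (rule DERIV_chain2[OF schwartz_has_deriv[OF assms]]) (auto intro!: derivative_eq_intros)
      from DERIV_cmult[OF this, of "w v"] show ?thesis by simp
    qed
    show "\<bar>w v * deriv \<phi> (s + T v)\<bar> \<le> C' * \<bar>w v\<bar>" for s v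
      unfolding abs_mult by (subst mult.commute, intro mult_right_mono C') auto
    show "integrable M (\<lambda>v. C' * \<bar>w v\<bar>)" using moments[of 0] by simp
  qed (auto)
qed

lemma avg_schwartz:
  assumes "schwartz \<phi>"
  shows "schwartz (avg \<phi>)" and "(deriv ^^ k) (avg \<phi>) = avg ((deriv ^^ k) \<phi>)"
proof -
  define \<eta> where "\<eta> k = avg ((deriv ^^ k) \<phi>)" for k
  have d: "(\<eta> k has_real_derivative \<eta> (Suc k) x) (at x)" for k x
    unfolding \<eta>_def using avg_has_derivative[OF schwartz_funpow_deriv[OF assms, of k]] by simp
  have "schwartz (\<eta> 0)"
  proof (rule schwartzI[where \<psi> = \<eta>, OF d])
    fix m k
    obtain C where C: "0 \<le> C" "\<And>x. (1 + \<bar>x\<bar>) ^ m * \<bar>(deriv ^^ k) \<phi> x\<bar> \<le> C" using schwartz_decay[OF assms] by blast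
    show "\<exists>C. \<forall>x. (1 + \<bar>x\<bar>) ^ m * \<bar>\<eta> k x\<bar> \<le> C"
      unfolding \<eta>_def using avg_decay[OF schwartz_measurable[OF schwartz_funpow_deriv[OF assms]] C] by blast
  qed
  then show "schwartz (avg \<phi>)" by (simp add: \<eta>_def)
  show "(deriv ^^ k) (avg \<phi>) = avg ((deriv ^^ k) \<phi>)"
    using derivative_sequence[of \<eta>, OF d] by (simp add: \<eta>_def)
qed

end

text \<open>Guarantees that \<open>dist_pairing\<close> tests its distribution at a Schwartz
  function, where the fundamental solution is determined.\<close>

lemma schwartz_correlation:
  assumes "schwartz f" "schwartz h"
  shows "schwartz (\<lambda>x. LINT v|lborel. f (v + x) * h v)"
proof -
  interpret averaging lborel h "\<lambda>v. v"
    using schwartz_integrable_weighted[OF assms(2)] schwartz_measurable[OF assms(2)] by unfold_locales auto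
  show ?thesis using avg_schwartz(1)[OF assms(1)] by (simp add: avg_def[abs_def] mult.commute add.commute)
qed

section \<open>Averages over a standard normal variable\<close>

abbreviation std_normal :: "real measure" where
  "std_normal \<equiv> density lborel (\<lambda>y. ennreal (std_normal_density y))"

lemma prob_space_std_normal: "prob_space std_normal"
  by (rule prob_space_normal_density) simp

lemma std_normal_moment: "integrable std_normal (\<lambda>y. (1 + \<bar>y\<bar>) ^ j)"
proof (rule Bochner_Integration.integrable_bound)
  have "integrable std_normal (\<lambda>y. \<bar>y\<bar> ^ j)" "integrable std_normal (\<lambda>y. 1)"
    using integrable_std_normal_moment_abs[of j] prob_space_std_normal
    by (simp_all add: integrable_density prob_space_def finite_measure.integrable_const)
  then show "integrable std_normal (\<lambda>y. 2 ^ j * (1 + \<bar>y\<bar> ^ j))"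
    by (intro integrable_mult_right Bochner_Integration.integrable_add)
  show "AE y in std_normal. norm ((1 + \<bar>y\<bar>) ^ j) \<le> norm (2 ^ j * (1 + \<bar>y\<bar> ^ j))"
    using one_plus_power_le[of "\<bar>_\<bar>" j] by (intro AE_I2) simp
qed simp

text \<open>Expectation of \<open>\<phi>\<close> at \<open>x\<close> plus a normal variable of mean
  \<open>\<theta>\<close> and variance \<open>v\<close>. Scaling a fixed variable by
  \<open>sqrt v\<close>, instead of convolving with a heat kernel, keeps \<open>v = 0\<close> inside
  the formula.\<close>

definition gauss :: "real \<Rightarrow> real \<Rightarrow> (real \<Rightarrow> real) \<Rightarrow> real \<Rightarrow> real" where
  "gauss \<theta> v \<phi> x = (LINT y|std_normal. \<phi> (x + (\<theta> + sqrt v * y)))"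

lemma affine_weight_le:
  assumes "\<bar>\<theta>\<bar> \<le> A" "\<bar>s\<bar> \<le> B"
  shows "(1 + \<bar>\<theta> + s * y\<bar>) ^ j \<le> (1 + A + B) ^ j * (1 + \<bar>y :: real\<bar>) ^ j"
proof -
  have "\<bar>\<theta> + s * y\<bar> \<le> A + B * \<bar>y\<bar>"
    using assms abs_triangle_ineq[of \<theta> "s * y"] mult_right_mono[OF assms(2), of "\<bar>y\<bar>"] by (simp add: abs_mult)
  moreover have "A + B * \<bar>y\<bar> + 1 \<le> (1 + A + B) * (1 + \<bar>y\<bar>)"
    using assms by (auto simp: algebra_simps)
  ultimately show ?thesis
    unfolding power_mult_distrib[symmetric] by (intro power_mono) auto
qed

lemma affine_moments: "integrable std_normal (\<lambda>y. (1 + \<bar>\<theta> + s * y\<bar>) ^ j)"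
proof (rule Bochner_Integration.integrable_bound)
  show "integrable std_normal (\<lambda>y. (1 + \<bar>\<theta>\<bar> + \<bar>s\<bar>) ^ j * (1 + \<bar>y\<bar>) ^ j)"
    by (intro integrable_mult_right std_normal_moment)
  show "AE y in std_normal. norm ((1 + \<bar>\<theta> + s * y\<bar>) ^ j) \<le> norm ((1 + \<bar>\<theta>\<bar> + \<bar>s\<bar>) ^ j * (1 + \<bar>y\<bar>) ^ j)"
    using affine_weight_le[OF order_refl order_refl] by (intro AE_I2) simp
qed simp

interpretation gauss: averaging std_normal "\<lambda>_. 1" "\<lambda>y. \<theta> + sqrt v * y"
  rewrites "averaging.avg std_normal (\<lambda>_. 1) (\<lambda>y. \<theta> + sqrt v * y) = gauss \<theta> v"
  for \<theta> v
proof -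
  show a: "averaging std_normal (\<lambda>_. 1) (\<lambda>y. \<theta> + sqrt v * y)"
    using affine_moments by unfold_locales auto
  show "averaging.avg std_normal (\<lambda>_. 1) (\<lambda>y. \<theta> + sqrt v * y) = gauss \<theta> v"
    by (simp add: fun_eq_iff averaging.avg_def[OF a] gauss_def)
qed


lemmas schwartz_gauss = gauss.avg_schwartz(1)
lemmas funpow_deriv_gauss = gauss.avg_schwartz(2)

lemma gauss_integrable:
  assumes "schwartz \<phi>" shows "integrable std_normal (\<lambda>y. \<phi> (x + (\<theta> + s * y)))"
proof -
  interpret p: prob_space std_normal by (rule prob_space_std_normal)
  obtain C where "0 \<le> C" "\<And>x. \<bar>\<phi> x\<bar> \<le> C" using schwartz_bounded[OF assms] by blast
  then show ?thesis
    using schwartz_measurable[OF assms] by (intro p.integrable_const_bound[where B = C]) auto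
qed

text \<open>The affine shift is controlled by the bounds on drift and variance alone, so one
  constant serves a whole time interval; it provides the time-independent majorants for
  differentiation in time.\<close>

lemma gauss_decay_uniform:
  assumes "schwartz \<phi>"
  obtains C where "0 \<le> C"
    "\<And>\<theta> v x. \<bar>\<theta>\<bar> \<le> A \<Longrightarrow> 0 \<le> v \<Longrightarrow> v \<le> B \<Longrightarrow> (1 + \<bar>x\<bar>) ^ m * \<bar>(deriv ^^ k) (gauss \<theta> v \<phi>) x\<bar> \<le> C"
proof -
  obtain C where C: "0 \<le> C" "\<And>x. (1 + \<bar>x\<bar>) ^ m * \<bar>(deriv ^^ k) \<phi> x\<bar> \<le> C" using schwartz_decay[OF assms] by blast
  let ?K = "(1 + A + sqrt B) ^ m * (LINT y|std_normal. (1 + \<bar>y\<bar>) ^ m)"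
  have "(1 + \<bar>x\<bar>) ^ m * \<bar>(deriv ^^ k) (gauss \<theta> v \<phi>) x\<bar> \<le> \<bar>C * ?K\<bar>"
    if "\<bar>\<theta>\<bar> \<le> A" "0 \<le> v" "v \<le> B" for \<theta> v x
  proof -
    have "(1 + \<bar>x\<bar>) ^ m * \<bar>(deriv ^^ k) (gauss \<theta> v \<phi>) x\<bar>
        \<le> C * (LINT y|std_normal. \<bar>1::real\<bar> * (1 + \<bar>\<theta> + sqrt v * y\<bar>) ^ m)"
      unfolding funpow_deriv_gauss[OF assms]
      by (rule gauss.avg_decay[OF schwartz_measurable[OF schwartz_funpow_deriv[OF assms]] C])
    also have "\<dots> \<le> C * (LINT y|std_normal. (1 + A + sqrt B) ^ m * (1 + \<bar>y\<bar>) ^ m)"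
    proof (intro mult_left_mono integral_mono)
      show "integrable std_normal (\<lambda>y. \<bar>1::real\<bar> * (1 + \<bar>\<theta> + sqrt v * y\<bar>) ^ m)"
        using affine_moments by simp
      show "integrable std_normal (\<lambda>y. (1 + A + sqrt B) ^ m * (1 + \<bar>y\<bar>) ^ m)"
        by (intro integrable_mult_right std_normal_moment)
      show "\<bar>1::real\<bar> * (1 + \<bar>\<theta> + sqrt v * y\<bar>) ^ m \<le> (1 + A + sqrt B) ^ m * (1 + \<bar>y\<bar>) ^ m" for y
        using affine_weight_le[of \<theta> A "sqrt v" "sqrt B" y m] that by simp
    qed (rule C)
    finally show ?thesis by simp
  qed
  \<comment> \<open>The absolute value keeps the witness nonnegative even for negative
    \<open>A\<close> or \<open>B\<close>, when the bound itself is vacuous.\<close>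
  then show thesis using that[of "\<bar>C * ?K\<bar>"] by simp
qed

lemma gauss_lincomb:
  assumes "schwartz \<phi>" "schwartz \<psi>"
  shows "gauss \<theta> v (\<lambda>x. r * \<phi> x + s * \<psi> x) x = r * gauss \<theta> v \<phi> x + s * gauss \<theta> v \<psi> x"
  unfolding gauss_def using gauss_integrable[OF assms(1)] gauss_integrable[OF assms(2)] by simp

lemma gauss_bound:
  assumes "\<And>x. \<bar>\<phi> x\<bar> \<le> C"
  shows "\<bar>gauss \<theta> v \<phi> x\<bar> \<le> C"
proof -
  interpret p: prob_space std_normal by (rule prob_space_std_normal)
  have C: "0 \<le> C" using assms[of 0] by linarith
  have "\<bar>gauss \<theta> v \<phi> x\<bar> \<le> (LINT y|std_normal. \<bar>\<phi> (x + (\<theta> + sqrt v * y))\<bar>)"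
    unfolding gauss_def by (rule integral_abs_bound)
  also have "\<dots> \<le> (LINT y|std_normal. C)"
    by (rule integral_mono') (use assms C in auto)
  finally show ?thesis using p.prob_space by simp
qed

lemma gauss_no_variance: "gauss \<theta> 0 \<phi> x = \<phi> (x + \<theta>)"
proof -
  interpret p: prob_space std_normal by (rule prob_space_std_normal)
  show ?thesis using p.prob_space by (simp add: gauss_def)
qed

lemma gauss_tendsto:
  assumes \<phi>: "\<And>x. isCont \<phi> x" "\<And>x. \<bar>\<phi> x\<bar> \<le> C"
    and lim: "\<theta> \<longlonglongrightarrow> \<theta>'" "v \<longlonglongrightarrow> v'"
  shows "(\<lambda>n. gauss (\<theta> n) (v n) \<phi> x) \<longlonglongrightarrow> gauss \<theta>' v' \<phi> x"
  unfolding gauss_def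
proof (rule integral_dominated_convergence[where w = "\<lambda>_. C"])
  interpret p: prob_space std_normal by (rule prob_space_std_normal)
  have [measurable]: "\<phi> \<in> borel_measurable borel"
    using \<phi>(1) by (intro borel_measurable_continuous_onI continuous_at_imp_continuous_on) auto
  show "(\<lambda>y. \<phi> (x + (\<theta>' + sqrt v' * y))) \<in> borel_measurable std_normal"
    "(\<lambda>y. \<phi> (x + (\<theta> n + sqrt (v n) * y))) \<in> borel_measurable std_normal" for n
    by measurable
  show "integrable std_normal (\<lambda>_. C)" by simp
  show "AE y in std_normal. (\<lambda>n. \<phi> (x + (\<theta> n + sqrt (v n) * y))) \<longlonglongrightarrow> \<phi> (x + (\<theta>' + sqrt v' * y))"
    by (intro AE_I2 isCont_tendsto_compose[OF \<phi>(1)] tendsto_intros lim)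
  show "AE y in std_normal. norm (\<phi> (x + (\<theta> n + sqrt (v n) * y))) \<le> C" for n
    using \<phi>(2) by (intro AE_I2) simp
qed

section \<open>Gaussian integration by parts\<close>

lemma std_normal_density_has_derivative:
  "(std_normal_density has_real_derivative - y * std_normal_density y) (at y)"
proof -
  have "((\<lambda>y. exp (- y\<^sup>2 / 2)) has_real_derivative - y * exp (- y\<^sup>2 / 2)) (at y)"
    by (auto intro!: derivative_eq_intros)
  from DERIV_cmult[OF this, of "1 / sqrt (2 * pi)"] show ?thesis
    unfolding std_normal_density_def by (simp add: mult_ac)
qed

text \<open>Completing the square in the exponent, twice; exponential bounds are enough to make the
  boundary terms vanish at both infinities.\<close>

lemma std_normal_density_le: "std_normal_density y \<le> exp (1 - y) \<and> std_normal_density y \<le> exp (1 + y)"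
proof -
  have q: "- y\<^sup>2 / 2 \<le> 1 - y" "- y\<^sup>2 / 2 \<le> 1 + y"
    using zero_le_power2[of "y - 1"] zero_le_power2[of "y + 1"] by (auto simp: power2_eq_square algebra_simps)
  have "1 \<le> sqrt (2 * pi)" using pi_ge_two by (intro real_le_rsqrt) auto
  then have "std_normal_density y \<le> exp (- y\<^sup>2 / 2)"
    unfolding std_normal_density_def using mult_right_mono[of "1 / sqrt (2 * pi)" 1 "exp (- y\<^sup>2 / 2)"]
    by (simp add: divide_le_eq)
  with q show ?thesis by (meson exp_le_cancel_iff order_trans)
qed

lemma std_normal_density_tendsto:
  "(std_normal_density \<longlongrightarrow> 0) at_top" "(std_normal_density \<longlongrightarrow> 0) at_bot"
proof -
  have top: "filterlim (\<lambda>y::real. 1 - y) at_bot at_top"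
    unfolding filterlim_at_bot
  proof
    show "\<forall>\<^sub>F y in at_top. 1 - y \<le> Z" for Z :: real
      using eventually_ge_at_top[of "1 - Z"] by eventually_elim simp
  qed
  have bot: "filterlim (\<lambda>y::real. 1 + y) at_bot at_bot"
    unfolding filterlim_at_bot
  proof
    show "\<forall>\<^sub>F y in at_bot. 1 + y \<le> Z" for Z :: real
      using eventually_le_at_bot[of "Z - 1"] by eventually_elim simp
  qed
  show "(std_normal_density \<longlongrightarrow> 0) at_top"
    by (rule tendsto_sandwich[OF _ _ tendsto_const filterlim_compose[OF exp_at_bot top]])
       (use std_normal_density_le in auto)
  show "(std_normal_density \<longlongrightarrow> 0) at_bot"
    by (rule tendsto_sandwich[OF _ _ tendsto_const filterlim_compose[OF exp_at_bot bot]])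
       (use std_normal_density_le in auto)
qed

text \<open>The density \<open>n\<close> satisfies n' = - y n, so the difference of the two
  integrands is an exact derivative, of a bounded function times \<open>n\<close>, and integrates to
  zero over the line.\<close>

lemma stein:
  assumes "schwartz \<psi>"
  shows "(LINT y|std_normal. y * \<psi> (z + s * y)) = s * (LINT y|std_normal. deriv \<psi> (z + s * y))"
proof -
  let ?n = std_normal_density
  let ?F = "\<lambda>y. \<psi> (z + s * y) * ?n y"
  let ?f = "\<lambda>y. s * deriv \<psi> (z + s * y) * ?n y - y * \<psi> (z + s * y) * ?n y"
  have d\<psi>: "schwartz (deriv \<psi>)" by (rule schwartz_deriv[OF assms])
  obtain C where C: "0 \<le> C" "\<And>x. \<bar>\<psi> x\<bar> \<le> C" using schwartz_bounded[OF assms] by blast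
  note [measurable] = schwartz_measurable[OF assms] schwartz_measurable[OF d\<psi>]
  have i1: "integrable std_normal (\<lambda>y. deriv \<psi> (z + s * y))"
    using gauss_integrable[OF d\<psi>, of z 0 s] by simp
  have i2: "integrable std_normal (\<lambda>y. y * \<psi> (z + s * y))"
  proof (rule Bochner_Integration.integrable_bound[OF integrable_mult_right[of C, OF std_normal_moment[of 1]]])
    show "AE y in std_normal. norm (y * \<psi> (z + s * y)) \<le> norm (C * (1 + \<bar>y\<bar>) ^ 1)"
    proof (rule AE_I2)
      fix y
      have "\<bar>y\<bar> * \<bar>\<psi> (z + s * y)\<bar> \<le> (1 + \<bar>y\<bar>) * C" by (intro mult_mono C) auto
      then show "norm (y * \<psi> (z + s * y)) \<le> norm (C * (1 + \<bar>y\<bar>) ^ 1)" using C(1) by (simp add: abs_mult mult_ac)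
    qed
  qed measurable
  have j1: "integrable lborel (\<lambda>y. s * deriv \<psi> (z + s * y) * ?n y)"
    using integrable_mult_right[OF i1, of s] by (simp add: integrable_density mult_ac)
  have j2: "integrable lborel (\<lambda>y. y * \<psi> (z + s * y) * ?n y)"
    using i2 by (simp add: integrable_density mult_ac)
  have cont: "isCont \<psi> x" "isCont (deriv \<psi>) x" for x
    using DERIV_isCont[OF schwartz_has_deriv[OF assms]] DERIV_isCont[OF schwartz_has_deriv[OF d\<psi>]] by auto
  have contn: "isCont ?n y" for y by (rule DERIV_isCont[OF std_normal_density_has_derivative])
  have "(LBINT y=-\<infinity>..\<infinity>. ?f y) = 0 - 0"
  proof (rule interval_integral_FTC_integrable[where F = ?F])
    fix y
    have "((\<lambda>y. \<psi> (z + s * y)) has_real_derivative deriv \<psi> (z + s * y) * s) (at y)"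
      by (rule DERIV_chain2[OF schwartz_has_deriv[OF assms]]) (auto intro!: derivative_eq_intros)
    from DERIV_mult[OF this std_normal_density_has_derivative]
    show "(?F has_vector_derivative ?f y) (at y)"
      by (simp add: has_real_derivative_iff_has_vector_derivative[symmetric] algebra_simps)
    show "isCont ?f y"
      by (intro isCont_diff isCont_mult continuous_const continuous_ident contn
          isCont_o2[where g = \<psi> and f = "\<lambda>y. z + s * y"] isCont_o2[where g = "deriv \<psi>" and f = "\<lambda>y. z + s * y"]
          cont isCont_add)
  next
    show "set_integrable lborel (einterval (-\<infinity>) \<infinity>) ?f"
      using Bochner_Integration.integrable_diff[OF j1 j2] by (simp add: set_integrable_def)
    have lim: "(?F \<longlongrightarrow> 0) F" if "(?n \<longlongrightarrow> 0) F" for F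
    proof (rule Lim_null_comparison)
      show "\<forall>\<^sub>F y in F. norm (?F y) \<le> C * ?n y"
        using C by (intro always_eventually allI) (simp add: abs_mult mult_right_mono)
      show "((\<lambda>y. C * ?n y) \<longlongrightarrow> 0) F" using tendsto_mult[OF tendsto_const that, of C] by simp
    qed
    show "((?F \<circ> real_of_ereal) \<longlongrightarrow> 0) (at_right (-\<infinity>))"
      unfolding ereal_tendsto_simps by (rule lim[OF std_normal_density_tendsto(2)])
    show "((?F \<circ> real_of_ereal) \<longlongrightarrow> 0) (at_left \<infinity>)"
      unfolding ereal_tendsto_simps by (rule lim[OF std_normal_density_tendsto(1)])
  qed simp
  then have "(LINT y|lborel. ?f y) = 0"
    by (simp add: interval_lebesgue_integral_def set_lebesgue_integral_def)
  then have "(LINT y|lborel. y * \<psi> (z + s * y) * ?n y) = (LINT y|lborel. s * deriv \<psi> (z + s * y) * ?n y)"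
    using j1 j2 by simp
  moreover have "(LINT y|std_normal. y * \<psi> (z + s * y)) = (LINT y|lborel. y * \<psi> (z + s * y) * ?n y)"
    by (subst integral_density) (auto simp: mult_ac)
  moreover have "s * (LINT y|std_normal. deriv \<psi> (z + s * y)) = s * (LINT y|lborel. deriv \<psi> (z + s * y) * ?n y)"
    by (subst integral_density) (auto simp: mult_ac)
  moreover have "\<dots> = (LINT y|lborel. s * deriv \<psi> (z + s * y) * ?n y)"
    by (simp add: mult.assoc)
  ultimately show ?thesis by simp
qed

section \<open>The drift-diffusion flow\<close>

text \<open>Differentiating the square root of the variance leaves a factor proportional to y / sqrt
  s. Integration by parts trades y for one more derivative of \<open>\<phi>\<close> and a factor
  sqrt s, and the singular factors cancel into \<open>\<mu> / 2\<close>.\<close>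

lemma gauss_heat_derivative_pos:
  assumes \<phi>: "schwartz \<phi>" and \<mu>: "0 \<le> \<mu>" and s: "0 < s"
  shows "((\<lambda>s. gauss (\<alpha> * s) (\<mu> * s) \<phi> x) has_real_derivative
     gauss (\<alpha> * s) (\<mu> * s) (\<lambda>x. \<alpha> * deriv \<phi> x + \<mu> / 2 * deriv (deriv \<phi>) x) x) (at s)"
proof -
  have \<phi>1: "schwartz (deriv \<phi>)" and \<phi>2: "schwartz (deriv (deriv \<phi>))"
    by (intro schwartz_deriv \<phi>)+
  note [measurable] = schwartz_measurable[OF \<phi>] schwartz_measurable[OF \<phi>1] schwartz_measurable[OF \<phi>2]
  obtain C where C: "0 \<le> C" "\<And>x. \<bar>deriv \<phi> x\<bar> \<le> C" using schwartz_bounded[OF \<phi>1] by blast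
  define F where "F s y = \<phi> (x + (\<alpha> * s + sqrt (\<mu> * s) * y))" for s y
  define F' where "F' s y = deriv \<phi> (x + (\<alpha> * s + sqrt (\<mu> * s) * y)) * (\<alpha> + sqrt \<mu> * (inverse (sqrt s) / 2) * y)" for s y
  \<comment> \<open>Restricting to times at least \<open>s / 2\<close> keeps the derivative of the
    square root bounded, hence the majorant integrable.\<close>
  define B where "B = \<bar>\<alpha>\<bar> + sqrt \<mu> * inverse (sqrt (s / 2)) / 2"
  have B: "\<bar>\<alpha>\<bar> \<le> B" "sqrt \<mu> * (inverse (sqrt r) / 2) \<le> B" if "s / 2 \<le> r" for r
  proof -
    have "inverse (sqrt r) \<le> inverse (sqrt (s / 2))" using s that by (intro le_imp_inverse_le) auto
    then have "sqrt \<mu> * (inverse (sqrt r) / 2) \<le> sqrt \<mu> * (inverse (sqrt (s / 2)) / 2)"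
      using \<mu> by (intro mult_left_mono divide_right_mono) auto
    then show "sqrt \<mu> * (inverse (sqrt r) / 2) \<le> B" by (simp add: B_def)
    show "\<bar>\<alpha>\<bar> \<le> B" using \<mu> s by (simp add: B_def)
  qed
  have "((\<lambda>s. LINT y|std_normal. F s y) has_real_derivative (LINT y|std_normal. F' s y)) (at s within {s/2..})"
  proof (rule has_real_derivative_integral[where w = "\<lambda>y. C * B * (1 + \<bar>y\<bar>) ^ 1"])
    show "integrable std_normal (F s)" for s
      unfolding F_def by (rule gauss_integrable[OF \<phi>])
    show "((\<lambda>s. F s y) has_real_derivative F' r y) (at r within {s/2..})" if r: "r \<in> {s/2..}" for r y
    proof -
      have "r > 0" using r s by auto
      then have "((\<lambda>s. x + (\<alpha> * s + sqrt \<mu> * sqrt s * y)) has_real_derivative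
          \<alpha> + sqrt \<mu> * (inverse (sqrt r) / 2) * y) (at r within {s/2..})"
        by (auto intro!: derivative_eq_intros simp: field_simps)
      then have "((\<lambda>s. x + (\<alpha> * s + sqrt (\<mu> * s) * y)) has_real_derivative
          \<alpha> + sqrt \<mu> * (inverse (sqrt r) / 2) * y) (at r within {s/2..})"
        by (simp add: real_sqrt_mult)
      from DERIV_chain2[OF schwartz_has_deriv[OF \<phi>] this] show ?thesis by (simp add: F_def F'_def)
    qed
    show "\<bar>F' r y\<bar> \<le> C * B * (1 + \<bar>y\<bar>) ^ 1" if "r \<in> {s/2..}" for r y
    proof -
      have r: "s / 2 \<le> r" using that by simp
      have "\<bar>\<alpha> + sqrt \<mu> * (inverse (sqrt r) / 2) * y\<bar> \<le> \<bar>\<alpha>\<bar> + sqrt \<mu> * (inverse (sqrt r) / 2) * \<bar>y\<bar>"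
        using abs_triangle_ineq[of \<alpha> "sqrt \<mu> * (inverse (sqrt r) / 2) * y"] \<mu> s r by (simp add: abs_mult)
      also have "\<dots> \<le> B + B * \<bar>y\<bar>" using B[OF r] by (intro add_mono mult_right_mono) auto
      finally have "\<bar>\<alpha> + sqrt \<mu> * (inverse (sqrt r) / 2) * y\<bar> \<le> B * (1 + \<bar>y\<bar>)" by (simp add: algebra_simps)
      then have "\<bar>F' r y\<bar> \<le> C * (B * (1 + \<bar>y\<bar>))"
        unfolding F'_def abs_mult by (intro mult_mono C) auto
      then show ?thesis by (simp add: mult.assoc)
    qed
    show "integrable std_normal (\<lambda>y. C * B * (1 + \<bar>y\<bar>) ^ 1)"
      by (intro integrable_mult_right std_normal_moment)
    show "F' s \<in> borel_measurable std_normal" unfolding F'_def by measurable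
  qed (use s in auto)
  moreover have "at s within {s/2..} = at s"
    by (rule at_within_open_subset[of _ "{s/2<..}"]) (use s in auto)
  ultimately have d: "((\<lambda>s. LINT y|std_normal. F s y) has_real_derivative (LINT y|std_normal. F' s y)) (at s)"
    by simp
  have yint: "integrable std_normal (\<lambda>y. y * deriv \<phi> (z + r * y))" for z r
  proof (rule Bochner_Integration.integrable_bound[OF integrable_mult_right[of C, OF std_normal_moment[of 1]]])
    show "AE y in std_normal. norm (y * deriv \<phi> (z + r * y)) \<le> norm (C * (1 + \<bar>y\<bar>) ^ 1)"
    proof (rule AE_I2)
      fix y
      have "\<bar>y\<bar> * \<bar>deriv \<phi> (z + r * y)\<bar> \<le> (1 + \<bar>y\<bar>) * C" by (intro mult_mono C) auto
      then show "norm (y * deriv \<phi> (z + r * y)) \<le> norm (C * (1 + \<bar>y\<bar>) ^ 1)" using C(1) by (simp add: abs_mult mult_ac)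
    qed
  qed measurable
  let ?z = "x + \<alpha> * s" and ?r = "sqrt (\<mu> * s)" and ?k = "sqrt \<mu> * (inverse (sqrt s) / 2)"
  have i1: "integrable std_normal (\<lambda>y. deriv \<phi> (?z + ?r * y))" "integrable std_normal (\<lambda>y. deriv (deriv \<phi>) (?z + ?r * y))"
    using gauss_integrable[OF \<phi>1, of ?z 0 ?r] gauss_integrable[OF \<phi>2, of ?z 0 ?r] by simp_all
  have "(LINT y|std_normal. F' s y) = (LINT y|std_normal. \<alpha> * deriv \<phi> (?z + ?r * y) + ?k * (y * deriv \<phi> (?z + ?r * y)))"
    unfolding F'_def by (simp add: algebra_simps)
  also have "\<dots> = \<alpha> * (LINT y|std_normal. deriv \<phi> (?z + ?r * y)) + ?k * (LINT y|std_normal. y * deriv \<phi> (?z + ?r * y))"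
    using i1(1) yint[of ?z ?r] by simp
  also have "(LINT y|std_normal. y * deriv \<phi> (?z + ?r * y)) = ?r * (LINT y|std_normal. deriv (deriv \<phi>) (?z + ?r * y))"
    by (rule stein[OF \<phi>1])
  also have "?k * (?r * (LINT y|std_normal. deriv (deriv \<phi>) (?z + ?r * y))) = \<mu> / 2 * (LINT y|std_normal. deriv (deriv \<phi>) (?z + ?r * y))"
    using s \<mu> by (simp add: real_sqrt_mult field_simps)
  also have "\<alpha> * (LINT y|std_normal. deriv \<phi> (?z + ?r * y)) + \<mu> / 2 * (LINT y|std_normal. deriv (deriv \<phi>) (?z + ?r * y))
     = gauss (\<alpha> * s) (\<mu> * s) (\<lambda>x. \<alpha> * deriv \<phi> x + \<mu> / 2 * deriv (deriv \<phi>) x) x"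
    unfolding gauss_lincomb[OF \<phi>1 \<phi>2] by (simp add: gauss_def add.assoc)
  finally show ?thesis using d by (simp add: gauss_def F_def)
qed

lemma schwartz_isCont:
  assumes "schwartz \<phi>"
  shows "isCont \<phi> x"
  by (rule DERIV_isCont[OF schwartz_has_deriv[OF assms]])

lemma gauss_heat_tendsto:
  assumes "schwartz \<phi>" "X \<longlonglongrightarrow> s"
  shows "(\<lambda>i. gauss (\<alpha> * X i) (\<mu> * X i) \<phi> x) \<longlonglongrightarrow> gauss (\<alpha> * s) (\<mu> * s) \<phi> x"
proof -
  obtain C where "0 \<le> C" "\<And>x. \<bar>\<phi> x\<bar> \<le> C" using schwartz_bounded[OF assms(1)] by blast
  then show ?thesis
    by (intro gauss_tendsto[where C = C] schwartz_isCont[OF assms(1)] tendsto_intros assms(2)) auto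
qed

text \<open>At \<open>s = 0\<close> the square root is not differentiable and the chain rule fails.
  There the mean value theorem expresses the quotient by the derivative at intermediate positive
  times, which is continuous up to 0.\<close>

lemma gauss_heat_derivative:
  assumes \<phi>: "schwartz \<phi>" and \<mu>: "0 \<le> \<mu>" and s: "0 \<le> s"
  shows "((\<lambda>s. gauss (\<alpha> * s) (\<mu> * s) \<phi> x) has_real_derivative
     gauss (\<alpha> * s) (\<mu> * s) (\<lambda>x. \<alpha> * deriv \<phi> x + \<mu> / 2 * deriv (deriv \<phi>) x) x) (at s within {0..})"
proof (cases "s = 0")
  case False
  then show ?thesis
    using gauss_heat_derivative_pos[OF \<phi> \<mu>, of s \<alpha> x] s has_field_derivative_at_within by fastforce
next
  case True
  let ?\<psi> = "\<lambda>x. \<alpha> * deriv \<phi> x + \<mu> / 2 * deriv (deriv \<phi>) x"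
  let ?g = "\<lambda>s. gauss (\<alpha> * s) (\<mu> * s) \<phi> x" and ?d = "\<lambda>s. gauss (\<alpha> * s) (\<mu> * s) ?\<psi> x"
  have \<psi>: "schwartz ?\<psi>" by (intro schwartz_lincomb schwartz_deriv \<phi>)
  have cont: "continuous_on {0..} ?g"
    unfolding continuous_on_sequentially comp_def using gauss_heat_tendsto[OF \<phi>] by blast
  have "((\<lambda>y. (?g y - ?g 0) / (y - 0)) \<longlongrightarrow> ?d 0) (at 0 within {0..})"
    unfolding tendsto_at_iff_sequentially comp_def
  proof (intro allI impI)
    fix X :: "nat \<Rightarrow> real" assume X: "\<forall>i. X i \<in> {0..} - {0}" "X \<longlonglongrightarrow> 0"
    have ex: "\<exists>\<xi>. 0 < \<xi> \<and> \<xi> < X i \<and> ?g (X i) - ?g 0 = X i * ?d \<xi>" for i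
    proof -
      have pos: "0 < X i" using X(1)[rule_format, of i] by auto
      have "\<exists>l z. 0 < z \<and> z < X i \<and> (?g has_real_derivative l) (at z) \<and> ?g (X i) - ?g 0 = (X i - 0) * l"
      proof (rule MVT[OF pos])
        show "continuous_on {0..X i} ?g" by (rule continuous_on_subset[OF cont]) auto
        show "?g differentiable (at y)" if "0 < y" for y
          using gauss_heat_derivative_pos[OF \<phi> \<mu> that] real_differentiable_def by blast
      qed
      then obtain l z where "0 < z" "z < X i" "(?g has_real_derivative l) (at z)" "?g (X i) - ?g 0 = (X i - 0) * l"
        by blast
      moreover from this have "l = ?d z"
        using gauss_heat_derivative_pos[OF \<phi> \<mu>, of z \<alpha> x] DERIV_unique by blast
      ultimately show ?thesis by auto
    qed
    define \<xi> where "\<xi> i = (SOME \<xi>. 0 < \<xi> \<and> \<xi> < X i \<and> ?g (X i) - ?g 0 = X i * ?d \<xi>)" for i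
    have \<xi>: "0 < \<xi> i" "\<xi> i < X i" "?g (X i) - ?g 0 = X i * ?d (\<xi> i)" for i
      using someI_ex[OF ex[of i]] unfolding \<xi>_def by blast+
    have "\<xi> \<longlonglongrightarrow> 0"
      by (rule tendsto_sandwich[OF _ _ tendsto_const X(2)]) (use \<xi> in \<open>auto intro!: always_eventually less_imp_le\<close>)
    from gauss_heat_tendsto[OF \<psi> this] have "(\<lambda>i. ?d (\<xi> i)) \<longlonglongrightarrow> ?d 0" .
    moreover have "(?g (X i) - ?g 0) / (X i - 0) = ?d (\<xi> i)" for i
      unfolding \<xi>(3) using \<xi>(1,2)[of i] by simp
    ultimately show "(\<lambda>i. (?g (X i) - ?g 0) / (X i - 0)) \<longlonglongrightarrow> ?d 0" by simp
  qed
  then show ?thesis unfolding True has_field_derivative_iff .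
qed

text \<open>The semigroup whose transpose is generated by \<open>\<alpha>\<nabla> + \<lambda>\<Delta> - \<kappa>\<close>.\<close>

definition flow :: "real \<Rightarrow> real \<Rightarrow> real \<Rightarrow> real \<Rightarrow> (real \<Rightarrow> real) \<Rightarrow> real \<Rightarrow> real" where
  "flow \<alpha> lam \<kappa> s \<phi> x = exp (- \<kappa> * s) * gauss (- \<alpha> * s) (2 * lam * s) \<phi> x"

text \<open>Formal adjoint of \<alpha> nabla + lam Laplace - \<kappa>: the drift changes sign. The
  factors 1 and - \<kappa> make the body literally a linear combination of a linear combination, the
  shape to which \<open>schwartz_lincomb\<close> and \<open>flow_lincomb\<close> apply.\<close>

definition gen_adj :: "real \<Rightarrow> real \<Rightarrow> real \<Rightarrow> (real \<Rightarrow> real) \<Rightarrow> real \<Rightarrow> real" where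
  "gen_adj \<alpha> lam \<kappa> \<phi> x = 1 * (- \<alpha> * deriv \<phi> x + lam * deriv (deriv \<phi>) x) + - \<kappa> * \<phi> x"

lemma schwartz_gen_adj: "schwartz \<phi> \<Longrightarrow> schwartz (gen_adj \<alpha> lam \<kappa> \<phi>)"
  unfolding gen_adj_def by (intro schwartz_lincomb(1) schwartz_deriv)

lemma funpow_deriv_gen_adj:
  assumes "schwartz \<phi>"
  shows "(deriv ^^ k) (gen_adj \<alpha> lam \<kappa> \<phi>) = gen_adj \<alpha> lam \<kappa> ((deriv ^^ k) \<phi>)"
proof -
  have 1: "schwartz (deriv \<phi>)" "schwartz (deriv (deriv \<phi>))" by (intro schwartz_deriv assms)+
  have swap: "(deriv ^^ k) (deriv \<psi>) = deriv ((deriv ^^ k) \<psi>)" for \<psi> :: "real \<Rightarrow> real"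
    by (simp add: funpow_swap1)
  show ?thesis
    unfolding gen_adj_def[abs_def] schwartz_lincomb(2)[OF schwartz_lincomb(1)[OF 1] assms]
      schwartz_lincomb(2)[OF 1] swap ..
qed

lemma schwartz_cmult: "schwartz \<phi> \<Longrightarrow> schwartz (\<lambda>x. r * \<phi> x)"
  and funpow_deriv_cmult: "schwartz \<phi> \<Longrightarrow> (deriv ^^ k) (\<lambda>x. r * \<phi> x) = (\<lambda>x. r * (deriv ^^ k) \<phi> x)"
  using schwartz_lincomb[where \<phi> = \<phi> and \<psi> = \<phi> and r = r and s = 0] by auto

lemma schwartz_flow: "schwartz \<phi> \<Longrightarrow> schwartz (flow \<alpha> lam \<kappa> s \<phi>)"
  unfolding flow_def[abs_def] by (intro schwartz_cmult schwartz_gauss)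

lemma funpow_deriv_flow:
  "schwartz \<phi> \<Longrightarrow> (deriv ^^ k) (flow \<alpha> lam \<kappa> s \<phi>) = flow \<alpha> lam \<kappa> s ((deriv ^^ k) \<phi>)"
  unfolding flow_def[abs_def] by (simp add: funpow_deriv_cmult schwartz_gauss funpow_deriv_gauss)

lemma flow_lincomb:
  assumes "schwartz \<phi>" "schwartz \<psi>"
  shows "flow \<alpha> lam \<kappa> t (\<lambda>x. r * \<phi> x + s * \<psi> x) x = r * flow \<alpha> lam \<kappa> t \<phi> x + s * flow \<alpha> lam \<kappa> t \<psi> x"
  unfolding flow_def by (simp add: gauss_lincomb[OF assms] algebra_simps)

text \<open>Both operators have constant coefficients: averages over translates commute with
  derivatives.\<close>

lemma flow_gen_adj_commute:
  assumes "schwartz \<phi>"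
  shows "gen_adj \<alpha> lam \<kappa> (flow \<alpha> lam \<kappa> s \<phi>) = flow \<alpha> lam \<kappa> s (gen_adj \<alpha> lam \<kappa> \<phi>)"
proof
  fix x
  have 1: "schwartz (deriv \<phi>)" "schwartz (deriv (deriv \<phi>))" by (intro schwartz_deriv assms)+
  have d: "deriv (flow \<alpha> lam \<kappa> s \<psi>) = flow \<alpha> lam \<kappa> s (deriv \<psi>)" if "schwartz \<psi>" for \<psi>
    using funpow_deriv_flow[OF that, of 1] by simp
  show "gen_adj \<alpha> lam \<kappa> (flow \<alpha> lam \<kappa> s \<phi>) x = flow \<alpha> lam \<kappa> s (gen_adj \<alpha> lam \<kappa> \<phi>) x"
    unfolding gen_adj_def[abs_def] flow_lincomb[OF schwartz_lincomb(1)[OF 1] assms] flow_lincomb[OF 1]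
      d[OF assms] d[OF 1(1)] ..
qed

lemma flow_has_derivative:
  assumes \<phi>: "schwartz \<phi>" and lam: "0 \<le> lam" and s: "0 \<le> s"
  shows "((\<lambda>s. flow \<alpha> lam \<kappa> s \<phi> x) has_real_derivative flow \<alpha> lam \<kappa> s (gen_adj \<alpha> lam \<kappa> \<phi>) x) (at s within {0..})"
proof -
  have 1: "schwartz (\<lambda>x. - \<alpha> * deriv \<phi> x + lam * deriv (deriv \<phi>) x)"
    by (intro schwartz_lincomb schwartz_deriv \<phi>)
  have e: "((\<lambda>s. exp (- \<kappa> * s)) has_real_derivative - \<kappa> * exp (- \<kappa> * s)) (at s within {0..})"
    by (auto intro!: derivative_eq_intros)
  have g: "((\<lambda>s. gauss (- \<alpha> * s) (2 * lam * s) \<phi> x) has_real_derivative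
     gauss (- \<alpha> * s) (2 * lam * s) (\<lambda>x. - \<alpha> * deriv \<phi> x + lam * deriv (deriv \<phi>) x) x) (at s within {0..})"
    using gauss_heat_derivative[OF \<phi> _ s, of "2 * lam" "- \<alpha>" x] lam by simp
  have "flow \<alpha> lam \<kappa> s (gen_adj \<alpha> lam \<kappa> \<phi>) x = - \<kappa> * exp (- \<kappa> * s) * gauss (- \<alpha> * s) (2 * lam * s) \<phi> x
     + gauss (- \<alpha> * s) (2 * lam * s) (\<lambda>x. - \<alpha> * deriv \<phi> x + lam * deriv (deriv \<phi>) x) x * exp (- \<kappa> * s)"
    unfolding gen_adj_def[abs_def] flow_lincomb[OF 1 \<phi>] unfolding flow_def by simp
  with DERIV_mult[OF e g] show ?thesis unfolding flow_def by simp
qed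

lemma flow_0: "flow \<alpha> lam \<kappa> 0 \<phi> = \<phi>"
  by (simp add: flow_def fun_eq_iff gauss_no_variance)

lemma flow_decay_uniform:
  assumes "schwartz \<phi>" "0 \<le> lam"
  obtains C where "0 \<le> C" "\<And>s x. 0 \<le> s \<Longrightarrow> s \<le> T \<Longrightarrow> (1 + \<bar>x\<bar>) ^ m * \<bar>flow \<alpha> lam \<kappa> s \<phi> x\<bar> \<le> C"
proof -
  obtain C where C: "0 \<le> C" "\<And>\<theta> v x. \<bar>\<theta>\<bar> \<le> \<bar>\<alpha>\<bar> * T \<Longrightarrow> 0 \<le> v \<Longrightarrow> v \<le> 2 * lam * T \<Longrightarrow>
      (1 + \<bar>x\<bar>) ^ m * \<bar>(deriv ^^ 0) (gauss \<theta> v \<phi>) x\<bar> \<le> C"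
    using gauss_decay_uniform[OF assms(1)] by metis
  have "(1 + \<bar>x\<bar>) ^ m * \<bar>flow \<alpha> lam \<kappa> s \<phi> x\<bar> \<le> exp (\<bar>\<kappa>\<bar> * T) * C" if s: "0 \<le> s" "s \<le> T" for s x
  proof -
    have e: "exp (- \<kappa> * s) \<le> exp (\<bar>\<kappa>\<bar> * T)"
    proof -
      have "- \<kappa> * s \<le> \<bar>\<kappa>\<bar> * s" using s by (intro mult_right_mono) auto
      also have "\<dots> \<le> \<bar>\<kappa>\<bar> * T" using s by (intro mult_left_mono) auto
      finally show ?thesis by simp
    qed
    have "(1 + \<bar>x\<bar>) ^ m * \<bar>gauss (- \<alpha> * s) (2 * lam * s) \<phi> x\<bar> \<le> C"
      using C(2)[of "- \<alpha> * s" "2 * lam * s" x] s assms(2) by (simp add: abs_mult mult_left_mono)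
    with e have "exp (- \<kappa> * s) * ((1 + \<bar>x\<bar>) ^ m * \<bar>gauss (- \<alpha> * s) (2 * lam * s) \<phi> x\<bar>) \<le> exp (\<bar>\<kappa>\<bar> * T) * C"
      by (intro mult_mono) auto
    then show ?thesis by (simp add: flow_def abs_mult mult_ac)
  qed
  then show thesis using C(1) by (intro that[of "exp (\<bar>\<kappa>\<bar> * T) * C"]) auto
qed

text \<open>The mean value inequality applied twice, hence \<open>B\<close> where Taylor's formula
  would give B / 2. Only derivatives within \<open>S\<close> enter, so endpoints of a time interval
  are allowed.\<close>

lemma second_order_bound:
  fixes f f1 f2 :: "real \<Rightarrow> real"
  assumes S: "convex S" "r \<in> S" "r' \<in> S"
    and d1: "\<And>s. s \<in> S \<Longrightarrow> (f has_real_derivative f1 s) (at s within S)"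
    and d2: "\<And>s. s \<in> S \<Longrightarrow> (f1 has_real_derivative f2 s) (at s within S)"
    and B: "\<And>s. s \<in> S \<Longrightarrow> \<bar>f2 s\<bar> \<le> B"
  shows "\<bar>f r' - f r - (r' - r) * f1 r\<bar> \<le> B * (r' - r)\<^sup>2"
proof -
  let ?I = "closed_segment r r'"
  have sub: "?I \<subseteq> S" by (rule closed_segment_subset[OF S(2,3,1)])
  have B0: "0 \<le> B" using B[OF S(2)] by linarith
  have d: "((\<lambda>s. f s - s * f1 r) has_real_derivative f1 s - f1 r) (at s within ?I)" if "s \<in> ?I" for s
    using DERIV_subset[OF d1 sub] that sub by (auto intro!: derivative_eq_intros)
  have b: "norm (f1 s - f1 r) \<le> B * \<bar>r' - r\<bar>" if "s \<in> ?I" for s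
  proof -
    have "norm (f1 s - f1 r) \<le> B * norm (s - r)"
      by (rule field_differentiable_bound[OF S(1) d2]) (use B S that sub in auto)
    also have "\<dots> \<le> B * \<bar>r' - r\<bar>"
      using that B0 by (intro mult_left_mono) (auto simp: closed_segment_eq_real_ivl split: if_splits)
    finally show ?thesis .
  qed
  have "norm ((f r' - r' * f1 r) - (f r - r * f1 r)) \<le> B * \<bar>r' - r\<bar> * norm (r' - r)"
    by (rule field_differentiable_bound[OF _ d b]) auto
  then show ?thesis by (simp add: algebra_simps power2_eq_square)
qed

text \<open>The second time derivative is the flow of the twice iterated generator at
  \<open>\<phi>\<close>, which is again Schwartz; the quadratic remainder therefore keeps the full
  polynomial weight.\<close>

lemma flow_taylor:
  assumes \<phi>: "schwartz \<phi>" and lam: "0 \<le> lam"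
  obtains C where "0 \<le> C" "\<And>r r' x. 0 \<le> r \<Longrightarrow> r \<le> T \<Longrightarrow> 0 \<le> r' \<Longrightarrow> r' \<le> T \<Longrightarrow>
    (1 + \<bar>x\<bar>) ^ m * \<bar>flow \<alpha> lam \<kappa> r' \<phi> x - flow \<alpha> lam \<kappa> r \<phi> x - (r' - r) * flow \<alpha> lam \<kappa> r (gen_adj \<alpha> lam \<kappa> \<phi>) x\<bar>
      \<le> C * (r' - r)\<^sup>2"
proof -
  let ?G = "gen_adj \<alpha> lam \<kappa>"
  have G: "schwartz (?G \<phi>)" "schwartz (?G (?G \<phi>))" by (intro schwartz_gen_adj \<phi>)+
  obtain C where C: "0 \<le> C" "\<And>s x. 0 \<le> s \<Longrightarrow> s \<le> T \<Longrightarrow> (1 + \<bar>x\<bar>) ^ m * \<bar>flow \<alpha> lam \<kappa> s (?G (?G \<phi>)) x\<bar> \<le> C"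
    using flow_decay_uniform[OF G(2) lam] by blast
  have "(1 + \<bar>x\<bar>) ^ m * \<bar>flow \<alpha> lam \<kappa> r' \<phi> x - flow \<alpha> lam \<kappa> r \<phi> x - (r' - r) * flow \<alpha> lam \<kappa> r (?G \<phi>) x\<bar>
      \<le> C * (r' - r)\<^sup>2" if r: "0 \<le> r" "r \<le> T" "0 \<le> r'" "r' \<le> T" for r r' x
  proof -
    have pos: "0 < (1 + \<bar>x\<bar>) ^ m" by simp
    have "\<bar>flow \<alpha> lam \<kappa> r' \<phi> x - flow \<alpha> lam \<kappa> r \<phi> x - (r' - r) * flow \<alpha> lam \<kappa> r (?G \<phi>) x\<bar>
        \<le> C / (1 + \<bar>x\<bar>) ^ m * (r' - r)\<^sup>2"
    proof (rule second_order_bound[where S = "{0..T}" and ?f2.0 = "\<lambda>s. flow \<alpha> lam \<kappa> s (?G (?G \<phi>)) x"])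
      show "((\<lambda>s. flow \<alpha> lam \<kappa> s \<phi> x) has_real_derivative flow \<alpha> lam \<kappa> s (?G \<phi>) x) (at s within {0..T})"
        "((\<lambda>s. flow \<alpha> lam \<kappa> s (?G \<phi>) x) has_real_derivative flow \<alpha> lam \<kappa> s (?G (?G \<phi>)) x) (at s within {0..T})"
        if "s \<in> {0..T}" for s
        using that \<phi> G lam by (auto intro!: DERIV_subset[OF flow_has_derivative, of _ _ _ "{0..T}"])
      show "\<bar>flow \<alpha> lam \<kappa> s (?G (?G \<phi>)) x\<bar> \<le> C / (1 + \<bar>x\<bar>) ^ m" if "s \<in> {0..T}" for s
        using C(2)[of s x] that pos by (simp add: pos_le_divide_eq mult.commute)
    qed (use r in auto)
    then show ?thesis using pos by (simp add: pos_le_divide_eq mult.commute)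
  qed
  with C(1) show thesis by (rule that)
qed

section \<open>Uniform boundedness of tempered distributions\<close>

lemma schwartz_seminorm_upper:
  assumes "schwartz \<phi>" shows "\<bar>x ^ j * (deriv ^^ k) \<phi> x\<bar> \<le> schwartz_seminorm j k \<phi>"
proof -
  have "bounded (range (\<lambda>x. x ^ j * (deriv ^^ k) \<phi> x))" using assms by (simp add: schwartz_def)
  then have "bdd_above (range (\<lambda>x. \<bar>x ^ j * (deriv ^^ k) \<phi> x\<bar>))"
    by (auto simp: bounded_iff bdd_above_def)
  then show ?thesis unfolding schwartz_seminorm_def by (rule cSUP_upper[rotated]) simp
qed

lemma schwartz_seminorm_least:
  "(\<And>x. \<bar>x ^ j * (deriv ^^ k) \<phi> x\<bar> \<le> C) \<Longrightarrow> schwartz_seminorm j k \<phi> \<le> C"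
  unfolding schwartz_seminorm_def by (rule cSUP_least) auto

lemma schwartz_seminorm_nonneg: "schwartz \<phi> \<Longrightarrow> 0 \<le> schwartz_seminorm j k \<phi>"
  using schwartz_seminorm_upper[of \<phi> 0 j k] abs_ge_zero order_trans by blast

lemma schwartz_seminorm_cmult:
  assumes "schwartz \<phi>" shows "schwartz_seminorm j k (\<lambda>x. r * \<phi> x) \<le> \<bar>r\<bar> * schwartz_seminorm j k \<phi>"
proof (rule schwartz_seminorm_least)
  fix x
  have "\<bar>x ^ j * (deriv ^^ k) (\<lambda>x. r * \<phi> x) x\<bar> = \<bar>r\<bar> * \<bar>x ^ j * (deriv ^^ k) \<phi> x\<bar>"
    by (simp add: funpow_deriv_cmult[OF assms] abs_mult)
  also have "\<dots> \<le> \<bar>r\<bar> * schwartz_seminorm j k \<phi>"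
    by (intro mult_left_mono schwartz_seminorm_upper assms) auto
  finally show "\<bar>x ^ j * (deriv ^^ k) (\<lambda>x. r * \<phi> x) x\<bar> \<le> \<bar>r\<bar> * schwartz_seminorm j k \<phi>" .
qed

text \<open>The finite sums of seminorms occurring in \<open>tempered\<close>. They increase with
  \<open>N\<close>, so an estimate in one of them can be weakened to any later one.\<close>

definition schwartz_norm :: "nat \<Rightarrow> (real \<Rightarrow> real) \<Rightarrow> real" where
  "schwartz_norm N \<phi> = (\<Sum>j\<le>N. \<Sum>k\<le>N. schwartz_seminorm j k \<phi>)"

lemma schwartz_norm_nonneg: "schwartz \<phi> \<Longrightarrow> 0 \<le> schwartz_norm N \<phi>"
  unfolding schwartz_norm_def by (intro sum_nonneg schwartz_seminorm_nonneg)

lemma schwartz_norm_mono: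
  assumes "schwartz \<phi>" "N \<le> N'" shows "schwartz_norm N \<phi> \<le> schwartz_norm N' \<phi>"
proof -
  have "schwartz_norm N \<phi> \<le> (\<Sum>j\<le>N. \<Sum>k\<le>N'. schwartz_seminorm j k \<phi>)"
    unfolding schwartz_norm_def using assms
    by (intro sum_mono sum_mono2) (auto intro: schwartz_seminorm_nonneg)
  also have "\<dots> \<le> schwartz_norm N' \<phi>"
    unfolding schwartz_norm_def using assms
    by (intro sum_mono2 sum_nonneg) (auto intro: schwartz_seminorm_nonneg sum_nonneg)
  finally show ?thesis .
qed

lemma schwartz_norm_cmult:
  "schwartz \<phi> \<Longrightarrow> schwartz_norm N (\<lambda>x. r * \<phi> x) \<le> \<bar>r\<bar> * schwartz_norm N \<phi>"
  unfolding schwartz_norm_def sum_distrib_left by (intro sum_mono schwartz_seminorm_cmult)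

lemma schwartz_seminorm_le_norm:
  assumes "schwartz \<phi>" "j \<le> N" "k \<le> N"
  shows "schwartz_seminorm j k \<phi> \<le> schwartz_norm N \<phi>"
proof -
  have "schwartz_seminorm j k \<phi> \<le> (\<Sum>k\<le>N. schwartz_seminorm j k \<phi>)"
    by (rule member_le_sum) (use assms in \<open>auto intro: schwartz_seminorm_nonneg\<close>)
  also have "\<dots> \<le> schwartz_norm N \<phi>"
    unfolding schwartz_norm_def
    by (rule member_le_sum[of j _ "\<lambda>j. \<Sum>k\<le>N. schwartz_seminorm j k \<phi>"])
       (use assms in \<open>auto intro!: sum_nonneg schwartz_seminorm_nonneg\<close>)
  finally show ?thesis .
qed

lemma tempered_lincomb:
  "\<lbrakk>tempered T; schwartz \<phi>; schwartz \<psi>\<rbrakk> \<Longrightarrow> T (\<lambda>x. r * \<phi> x + s * \<psi> x) = r * T \<phi> + s * T \<psi>"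
  unfolding tempered_def by blast

lemma tempered_cmult: "\<lbrakk>tempered T; schwartz \<phi>\<rbrakk> \<Longrightarrow> T (\<lambda>x. r * \<phi> x) = r * T \<phi>"
  using tempered_lincomb[of T \<phi> \<phi> r 0] by simp

lemma tempered_add: "\<lbrakk>tempered T; schwartz \<phi>; schwartz \<psi>\<rbrakk> \<Longrightarrow> T (\<lambda>x. \<phi> x + \<psi> x) = T \<phi> + T \<psi>"
  using tempered_lincomb[of T \<phi> \<psi> 1 1] by simp

lemma schwartz_add: "\<lbrakk>schwartz \<phi>; schwartz \<psi>\<rbrakk> \<Longrightarrow> schwartz (\<lambda>x. \<phi> x + \<psi> x)"
  using schwartz_lincomb(1)[of \<phi> \<psi> 1 1] by simp

lemma schwartz_zero: "schwartz (\<lambda>x. 0)"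
proof -
  have "schwartz ((\<lambda>_ _. 0 :: real) (0::nat))"
    by (rule schwartzI[of "\<lambda>_ _. 0"]) auto
  then show ?thesis .
qed

lemma tempered_sum:
  fixes n :: nat
  assumes "tempered T" "\<And>i. schwartz (\<phi> i)"
  shows "schwartz (\<lambda>x. \<Sum>i<n. \<phi> i x)" "T (\<lambda>x. \<Sum>i<n. \<phi> i x) = (\<Sum>i<n. T (\<phi> i))"
proof (induction n)
  case 0
  show "schwartz (\<lambda>x. \<Sum>i<0. \<phi> i x)" by (simp add: schwartz_zero)
  show "T (\<lambda>x. \<Sum>i<0. \<phi> i x) = (\<Sum>i<0. T (\<phi> i))"
    using tempered_cmult[OF assms(1) schwartz_zero, of 0] by simp
next
  case (Suc n)
  show "schwartz (\<lambda>x. \<Sum>i<Suc n. \<phi> i x)" by (simp add: schwartz_add Suc assms(2))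
  show "T (\<lambda>x. \<Sum>i<Suc n. \<phi> i x) = (\<Sum>i<Suc n. T (\<phi> i))"
    by (simp add: tempered_add[OF assms(1) Suc(1) assms(2)] Suc(2))
qed

lemma tempered_bound:
  assumes "tempered T"
  obtains C N where "0 \<le> C" "\<And>\<phi>. schwartz \<phi> \<Longrightarrow> \<bar>T \<phi>\<bar> \<le> C * schwartz_norm N \<phi>"
proof -
  obtain C N where C: "\<And>\<phi>. schwartz \<phi> \<Longrightarrow> \<bar>T \<phi>\<bar> \<le> C * schwartz_norm N \<phi>"
    using assms unfolding tempered_def schwartz_norm_def by blast
  have "\<bar>T \<phi>\<bar> \<le> \<bar>C\<bar> * schwartz_norm N \<phi>" if "schwartz \<phi>" for \<phi>
    using C[OF that] mult_right_mono[OF abs_ge_self schwartz_norm_nonneg[OF that], of C N] by linarith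
  then show thesis by (intro that[of "\<bar>C\<bar>" N]) auto
qed

lemma tempered_diff:
  assumes "tempered T" "tempered U" shows "tempered (\<lambda>\<phi>. T \<phi> - U \<phi>)"
proof -
  obtain C N where C: "0 \<le> C" "\<And>\<phi>. schwartz \<phi> \<Longrightarrow> \<bar>T \<phi>\<bar> \<le> C * schwartz_norm N \<phi>" using tempered_bound[OF assms(1)] by blast
  obtain D L where D: "0 \<le> D" "\<And>\<phi>. schwartz \<phi> \<Longrightarrow> \<bar>U \<phi>\<bar> \<le> D * schwartz_norm L \<phi>" using tempered_bound[OF assms(2)] by blast
  have "\<bar>T \<phi> - U \<phi>\<bar> \<le> (C + D) * schwartz_norm (max N L) \<phi>" if "schwartz \<phi>" for \<phi>
  proof -
    have "\<bar>T \<phi>\<bar> \<le> C * schwartz_norm (max N L) \<phi>" "\<bar>U \<phi>\<bar> \<le> D * schwartz_norm (max N L) \<phi>"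
      using C D that by (auto intro!: order_trans[OF C(2)] order_trans[OF D(2)] mult_left_mono schwartz_norm_mono)
    then show ?thesis by (simp add: distrib_right)
  qed
  moreover have "T (\<lambda>x. r * \<phi> x + s * \<psi> x) - U (\<lambda>x. r * \<phi> x + s * \<psi> x) = r * (T \<phi> - U \<phi>) + s * (T \<psi> - U \<psi>)"
    if "schwartz \<phi>" "schwartz \<psi>" for \<phi> \<psi> r s
    using tempered_lincomb[OF assms(1) that] tempered_lincomb[OF assms(2) that] by (simp add: algebra_simps)
  ultimately show ?thesis unfolding tempered_def schwartz_norm_def by blast
qed

text \<open>Completeness of the Schwartz space in the form used below: summability in every seminorm
  makes all differentiated series converge uniformly by the Weierstrass test, so the sum may be
  differentiated term by term.\<close>

lemma schwartz_series:
  assumes \<phi>: "\<And>n. schwartz (\<phi> n)" and sum: "\<And>j k. summable (\<lambda>n. schwartz_seminorm j k (\<phi> n))"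
  shows "schwartz (\<lambda>x. \<Sum>n. \<phi> n x)"
    and "schwartz_seminorm j k (\<lambda>x. \<Sum>n. \<phi> n x) \<le> (\<Sum>n. schwartz_seminorm j k (\<phi> n))"
    and "summable (\<lambda>n. \<phi> n x)"
proof -
  define \<Phi> where "\<Phi> k x = (\<Sum>n. (deriv ^^ k) (\<phi> n) x)" for k x
  have summ: "summable (\<lambda>n. x ^ j * (deriv ^^ k) (\<phi> n) x)" for x j k
    by (rule summable_comparison_test'[OF sum[of j k], of 0]) (use schwartz_seminorm_upper[OF \<phi>] in auto)
  from summ[of x 0 0] show "summable (\<lambda>n. \<phi> n x)" by simp
  have d: "(\<Phi> k has_real_derivative \<Phi> (Suc k) x) (at x)" for k x
    unfolding \<Phi>_def[abs_def]
  proof (rule has_field_derivative_series'(2)[where S = UNIV and x = x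
        and f = "\<lambda>n x. (deriv ^^ k) (\<phi> n) x" and f' = "\<lambda>n x. (deriv ^^ Suc k) (\<phi> n) x"])
    show "uniformly_convergent_on UNIV (\<lambda>n x. \<Sum>i<n. (deriv ^^ Suc k) (\<phi> i) x)"
    proof (rule Weierstrass_m_test'[OF _ sum[of 0 "Suc k"]])
      show "norm ((deriv ^^ Suc k) (\<phi> n) x) \<le> schwartz_seminorm 0 (Suc k) (\<phi> n)" for n x
        using schwartz_seminorm_upper[OF \<phi>, of x 0 "Suc k" n] by simp
    qed
    show "summable (\<lambda>n. (deriv ^^ k) (\<phi> n) 0)" using summ[of 0 0 k] by simp
    show "((deriv ^^ k) (\<phi> n) has_real_derivative (deriv ^^ Suc k) (\<phi> n) x) (at x within UNIV)" for n x
      using schwartz_has_derivative[OF \<phi>] by simp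
  qed auto
  have \<Phi>0: "\<Phi> 0 = (\<lambda>x. \<Sum>n. \<phi> n x)" by (simp add: \<Phi>_def fun_eq_iff)
  have D: "(deriv ^^ k) (\<lambda>x. \<Sum>n. \<phi> n x) = \<Phi> k" for k
    using derivative_sequence[of \<Phi>, OF d] by (simp add: \<Phi>0)
  have b: "\<bar>x ^ j * \<Phi> k x\<bar> \<le> (\<Sum>n. schwartz_seminorm j k (\<phi> n))" for x j k
  proof -
    have "x ^ j * \<Phi> k x = (\<Sum>n. x ^ j * (deriv ^^ k) (\<phi> n) x)"
      unfolding \<Phi>_def using summ[of x 0 k] by (simp add: suminf_mult)
    also have "norm \<dots> \<le> (\<Sum>n. schwartz_seminorm j k (\<phi> n))"
      by (rule norm_suminf_le[OF _ sum]) (use schwartz_seminorm_upper[OF \<phi>] in simp)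
    finally show ?thesis by simp
  qed
  show "schwartz (\<lambda>x. \<Sum>n. \<phi> n x)"
    unfolding schwartz_def D bounded_iff
  proof (intro conjI allI)
    show "\<Phi> k differentiable at x" for k x using d real_differentiable_def by blast
    show "\<exists>a. \<forall>y\<in>range (\<lambda>x. x ^ j * \<Phi> k x). norm y \<le> a" for j k using b[of _ j k] by auto
  qed
  show "schwartz_seminorm j k (\<lambda>x. \<Sum>n. \<phi> n x) \<le> (\<Sum>n. schwartz_seminorm j k (\<phi> n))"
    by (rule schwartz_seminorm_least) (simp add: D b)
qed

lemma schwartz_norm_series:
  assumes "\<And>n. schwartz (\<phi> n)" "\<And>j k. summable (\<lambda>n. schwartz_seminorm j k (\<phi> n))"
  shows "schwartz_norm N (\<lambda>x. \<Sum>n. \<phi> n x) \<le> (\<Sum>n. schwartz_norm N (\<phi> n))"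
proof -
  have "schwartz_norm N (\<lambda>x. \<Sum>n. \<phi> n x) \<le> (\<Sum>j\<le>N. \<Sum>k\<le>N. \<Sum>n. schwartz_seminorm j k (\<phi> n))"
    unfolding schwartz_norm_def by (intro sum_mono schwartz_series(2) assms)
  also have "\<dots> = (\<Sum>j\<le>N. \<Sum>n. \<Sum>k\<le>N. schwartz_seminorm j k (\<phi> n))"
    by (intro sum.cong refl suminf_sum[symmetric] assms)
  also have "\<dots> = (\<Sum>n. schwartz_norm N (\<phi> n))"
    unfolding schwartz_norm_def by (intro suminf_sum[symmetric] summable_sum assms)
  finally show ?thesis .
qed

text \<open>The principle of uniform boundedness, by a gliding hump: summands that are small in all the
  seminorms used so far, but on which some functional is huge, add up to a Schwartz function on
  which the family is unbounded.\<close>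

lemma uniform_boundedness:
  assumes T: "\<And>i. i \<in> I \<Longrightarrow> tempered (T i)"
    and ptw: "\<And>\<phi>. schwartz \<phi> \<Longrightarrow> \<exists>B. \<forall>i\<in>I. \<bar>T i \<phi>\<bar> \<le> B"
  shows "\<exists>C N. \<forall>i\<in>I. \<forall>\<phi>. schwartz \<phi> \<longrightarrow> \<bar>T i \<phi>\<bar> \<le> C * schwartz_norm N \<phi>"
proof (rule ccontr)
  assume neg: "\<not> ?thesis"
  \<comment> \<open>Unboundedness is applied with the constant (R + 1) / \<epsilon>. Rescaling the
    function so that the functional takes absolute value R + 1 makes its norm at most
    \<epsilon>.\<close>
  have hump: "\<exists>i\<in>I. \<exists>\<phi>. schwartz \<phi> \<and> schwartz_norm N \<phi> \<le> \<epsilon> \<and> R < \<bar>T i \<phi>\<bar>" if "\<epsilon> > 0" "0 \<le> R" for N \<epsilon> R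
  proof -
    obtain i \<phi> where i: "i \<in> I" and \<phi>: "schwartz \<phi>" and big: "(R + 1) / \<epsilon> * schwartz_norm N \<phi> < \<bar>T i \<phi>\<bar>"
      using neg not_le by blast
    have d: "0 < \<bar>T i \<phi>\<bar>"
    proof -
      have "0 \<le> (R + 1) / \<epsilon> * schwartz_norm N \<phi>"
        using that by (intro mult_nonneg_nonneg schwartz_norm_nonneg \<phi>) auto
      with big show ?thesis by linarith
    qed
    define r where "r = (R + 1) / \<bar>T i \<phi>\<bar>"
    have r: "0 \<le> r" using that d by (simp add: r_def)
    have "schwartz_norm N (\<lambda>x. r * \<phi> x) \<le> r * schwartz_norm N \<phi>"
      using schwartz_norm_cmult[OF \<phi>, of N r] r by simp
    also have "\<dots> \<le> \<epsilon>"
      using big d that by (simp add: r_def field_simps)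
    finally have "schwartz_norm N (\<lambda>x. r * \<phi> x) \<le> \<epsilon>" .
    moreover have "R < \<bar>T i (\<lambda>x. r * \<phi> x)\<bar>"
      using tempered_cmult[OF T[OF i] \<phi>, of r] d that by (simp add: r_def abs_mult)
    ultimately show ?thesis using i schwartz_cmult[OF \<phi>] by blast
  qed
  define B where "B \<phi> = (SOME B. \<forall>i\<in>I. \<bar>T i \<phi>\<bar> \<le> B)" for \<phi>
  have B: "\<bar>T i \<phi>\<bar> \<le> B \<phi>" if "schwartz \<phi>" "i \<in> I" for i \<phi>
    using someI_ex[OF ptw[OF that(1)]] that(2) unfolding B_def by blast
  have "\<forall>i\<in>I. \<exists>CN. 0 \<le> fst CN \<and> (\<forall>\<phi>. schwartz \<phi> \<longrightarrow> \<bar>T i \<phi>\<bar> \<le> fst CN * schwartz_norm (snd CN) \<phi>)"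
  proof
    fix i assume "i \<in> I"
    then obtain C N where "0 \<le> C" "\<And>\<phi>. schwartz \<phi> \<Longrightarrow> \<bar>T i \<phi>\<bar> \<le> C * schwartz_norm N \<phi>"
      using tempered_bound[OF T] by blast
    then show "\<exists>CN. 0 \<le> fst CN \<and> (\<forall>\<phi>. schwartz \<phi> \<longrightarrow> \<bar>T i \<phi>\<bar> \<le> fst CN * schwartz_norm (snd CN) \<phi>)"
      by (intro exI[of _ "(C, N)"]) auto
  qed
  from bchoice[OF this] obtain CN where CN: "\<And>i. i \<in> I \<Longrightarrow> 0 \<le> fst (CN i)"
    "\<And>i \<phi>. i \<in> I \<Longrightarrow> schwartz \<phi> \<Longrightarrow> \<bar>T i \<phi>\<bar> \<le> fst (CN i) * schwartz_norm (snd (CN i)) \<phi>" by blast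
  \<comment> \<open>A pair \<open>p\<close> is an index with its hump. The hump is small in the
    \<open>n\<close>-th norm, so the series converges; small for the bounds of all functionals
    chosen before, so it barely disturbs them; and huge for its own functional compared with the
    pointwise bounds \<open>B\<close> at earlier humps, which hold whatever index is chosen
    now.\<close>
  define Q where "Q f n p \<longleftrightarrow> fst p \<in> I \<and> schwartz (snd p) \<and> schwartz_norm n (snd p) \<le> (1/2) ^ n \<and>
      (\<forall>j<n. fst (CN (fst (f j))) * schwartz_norm (snd (CN (fst (f j)))) (snd p) \<le> (1/2) ^ n) \<and>
      real n + 2 + (\<Sum>j<n. \<bar>B (snd (f j))\<bar>) < \<bar>T (fst p) (snd p)\<bar>"
    for f :: "nat \<Rightarrow> _" and n p
  have "\<exists>f. \<forall>n. Q f n (f n)"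
  proof (rule dependent_wellorder_choice)
    show "Q f n p = Q g n p" if "\<And>j. j < n \<Longrightarrow> f j = g j" for p f g n
    proof -
      have "(\<Sum>j<n. \<bar>B (snd (f j))\<bar>) = (\<Sum>j<n. \<bar>B (snd (g j))\<bar>)"
        using that by (intro sum.cong) auto
      then show ?thesis unfolding Q_def using that by auto
    qed
    show "\<exists>p. Q f n p" if prev: "\<And>j. j < n \<Longrightarrow> Q f j (f j)" for n f
    proof -
      \<comment> \<open>With \<open>S\<close> above every earlier constant and \<open>m\<close>
        above every earlier order, smallness in the single norm of order \<open>m\<close> meets all
        requirements at once.\<close>
      define S where "S = (\<Sum>j<n. fst (CN (fst (f j))))"
      define m where "m = Max (insert n ((\<lambda>j. snd (CN (fst (f j)))) ` {..<n}))"
      have fI: "fst (f j) \<in> I" if "j < n" for j using prev[OF that] by (simp add: Q_def)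
      have S: "0 \<le> S" unfolding S_def by (intro sum_nonneg CN fI) simp
      have e: "0 < (1/2::real) ^ n / (1 + S)" using S by simp
      obtain i \<phi> where i: "i \<in> I" and \<phi>: "schwartz \<phi>" and small: "schwartz_norm m \<phi> \<le> (1/2) ^ n / (1 + S)"
        and big: "real n + 2 + (\<Sum>j<n. \<bar>B (snd (f j))\<bar>) < \<bar>T i \<phi>\<bar>"
        using hump[OF e, of "real n + 2 + (\<Sum>j<n. \<bar>B (snd (f j))\<bar>)" m] by (auto simp: sum_nonneg add_nonneg_nonneg)
      have mono: "schwartz_norm k \<phi> \<le> (1/2) ^ n / (1 + S)" if "k \<le> m" for k
        using schwartz_norm_mono[OF \<phi> that] small by linarith
      have frac: "c * ((1/2) ^ n / (1 + S)) \<le> (1/2) ^ n" if "0 \<le> c" "c \<le> 1 + S" for c :: real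
        using that S by (simp add: divide_le_eq mult.commute)
      have "schwartz_norm n \<phi> \<le> (1/2) ^ n"
        using mono[of n] frac[of 1] S by (simp add: m_def)
      moreover have "fst (CN (fst (f j))) * schwartz_norm (snd (CN (fst (f j)))) \<phi> \<le> (1/2) ^ n" if "j < n" for j
      proof -
        have "fst (CN (fst (f j))) \<le> S"
          unfolding S_def by (rule member_le_sum) (use that CN fI in auto)
        then have "fst (CN (fst (f j))) * ((1/2) ^ n / (1 + S)) \<le> (1/2) ^ n"
          by (intro frac CN fI that) simp
        moreover have "fst (CN (fst (f j))) * schwartz_norm (snd (CN (fst (f j)))) \<phi>
            \<le> fst (CN (fst (f j))) * ((1/2) ^ n / (1 + S))"
          by (intro mult_left_mono mono CN fI that) (use that in \<open>auto simp: m_def\<close>)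
        ultimately show ?thesis by linarith
      qed
      ultimately have "Q f n (i, \<phi>)" using i \<phi> big by (simp add: Q_def)
      then show ?thesis by blast
    qed
  qed
  then obtain f where f: "\<And>n. Q f n (f n)" by blast
  define i where "i n = fst (f n)" for n
  define \<phi> where "\<phi> n = snd (f n)" for n
  have iI: "i n \<in> I" and \<phi>: "schwartz (\<phi> n)" and small: "schwartz_norm n (\<phi> n) \<le> (1/2) ^ n"
    and later: "j < n \<Longrightarrow> fst (CN (i j)) * schwartz_norm (snd (CN (i j))) (\<phi> n) \<le> (1/2) ^ n"
    and big: "real n + 2 + (\<Sum>j<n. \<bar>B (\<phi> j)\<bar>) < \<bar>T (i n) (\<phi> n)\<bar>" for n j
    using f[of n] unfolding Q_def i_def \<phi>_def by auto
  have geo: "summable (\<lambda>n. (1/2::real) ^ n)" by (rule summable_geometric) simp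
  have sn: "summable (\<lambda>n. schwartz_norm N (\<phi> n))" for N
  proof (rule summable_comparison_test'[OF geo, of N])
    show "norm (schwartz_norm N (\<phi> n)) \<le> (1/2) ^ n" if "N \<le> n" for n
      using schwartz_norm_mono[OF \<phi> that, of n] small[of n] schwartz_norm_nonneg[OF \<phi>, of N n] by simp
  qed
  have ss: "summable (\<lambda>n. schwartz_seminorm j k (\<phi> n))" for j k
    by (rule summable_comparison_test'[OF sn[of "max j k"], of 0])
       (use schwartz_seminorm_le_norm[OF \<phi>] schwartz_seminorm_nonneg[OF \<phi>] in auto)
  define \<Phi> where "\<Phi> = (\<lambda>x. \<Sum>n. \<phi> n x)"
  have \<Phi>: "schwartz \<Phi>" unfolding \<Phi>_def by (rule schwartz_series[OF \<phi> ss])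
  have unbounded: "real L < \<bar>T (i L) \<Phi>\<bar>" for L
  proof -
    let ?T = "T (i L)" and ?C = "fst (CN (i L))" and ?N = "snd (CN (i L))"
    define \<Psi> where "\<Psi> = (\<lambda>x. \<Sum>n. \<phi> (n + Suc L) x)"
    have T': "tempered ?T" by (rule T[OF iI])
    have ss': "summable (\<lambda>n. schwartz_seminorm j k (\<phi> (n + Suc L)))" for j k
      using ss by (subst summable_iff_shift)
    have \<Psi>: "schwartz \<Psi>" unfolding \<Psi>_def by (rule schwartz_series[OF \<phi> ss'])
    have split: "\<Phi> = (\<lambda>x. (\<lambda>x. \<Sum>n<L. \<phi> n x) x + (\<lambda>x. \<phi> L x + \<Psi> x) x)"
    proof
      fix x
      have "\<Phi> x = \<Psi> x + (\<Sum>n<Suc L. \<phi> n x)"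
        unfolding \<Phi>_def \<Psi>_def by (rule suminf_split_initial_segment[OF schwartz_series(3)[OF \<phi> ss]])
      then show "\<Phi> x = (\<Sum>n<L. \<phi> n x) + (\<phi> L x + \<Psi> x)" by simp
    qed
    have "?T \<Phi> = (\<Sum>n<L. ?T (\<phi> n)) + (?T (\<phi> L) + ?T \<Psi>)"
      unfolding split
      by (simp add: tempered_add[OF T' tempered_sum(1)[OF T' \<phi>] schwartz_add[OF \<phi> \<Psi>]]
          tempered_add[OF T' \<phi> \<Psi>] tempered_sum(2)[OF T' \<phi>])
    \<comment> \<open>Earlier humps are controlled by pointwise boundedness, later ones by the
      geometric bounds, with total at most 1; the surplus 2 in \<open>big\<close> absorbs the
      latter.\<close>
    moreover have "\<bar>\<Sum>n<L. ?T (\<phi> n)\<bar> \<le> (\<Sum>j<L. \<bar>B (\<phi> j)\<bar>)"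
      by (rule order_trans[OF sum_abs], intro sum_mono order_trans[OF B[OF \<phi> iI] abs_ge_self])
    moreover have "\<bar>?T \<Psi>\<bar> \<le> 1"
    proof -
      have "\<bar>?T \<Psi>\<bar> \<le> ?C * schwartz_norm ?N \<Psi>" by (rule CN(2)[OF iI \<Psi>])
      also have "\<dots> \<le> ?C * (\<Sum>n. schwartz_norm ?N (\<phi> (n + Suc L)))"
        unfolding \<Psi>_def by (intro mult_left_mono schwartz_norm_series \<phi> ss' CN iI)
      also have "\<dots> = (\<Sum>n. ?C * schwartz_norm ?N (\<phi> (n + Suc L)))"
        using sn by (intro suminf_mult[symmetric]) (subst summable_iff_shift)
      also have "\<dots> \<le> (\<Sum>n. (1/2) ^ Suc n)"
      proof (rule suminf_le)
        fix n
        have "?C * schwartz_norm ?N (\<phi> (n + Suc L)) \<le> (1/2) ^ (n + Suc L)" by (rule later) simp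
        also have "\<dots> \<le> (1/2) ^ Suc n" by (rule power_decreasing) auto
        finally show "?C * schwartz_norm ?N (\<phi> (n + Suc L)) \<le> (1/2) ^ Suc n" .
        show "summable (\<lambda>n. ?C * schwartz_norm ?N (\<phi> (n + Suc L)))"
          using sn by (intro summable_mult) (subst summable_iff_shift)
        show "summable (\<lambda>n. (1/2::real) ^ Suc n)" using geo by (subst summable_Suc_iff)
      qed
      also have "\<dots> = 1" using power_half_series by (rule sums_unique[symmetric])
      finally show ?thesis .
    qed
    ultimately show ?thesis using big[of L] by linarith
  qed
  obtain L where "B \<Phi> < real L" using reals_Archimedean2 by blast
  with unbounded[of L] B[OF \<Phi> iI[of L]] show False by linarith
qed

section \<open>Fundamental solutions\<close>

definition drift_diffusion :: "real \<Rightarrow> real \<Rightarrow> real \<Rightarrow> distribution \<Rightarrow> distribution" where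
  "drift_diffusion \<alpha> lam \<kappa> T \<phi> = \<alpha> * dist_nabla T \<phi> + lam * dist_laplace T \<phi> - \<kappa> * T \<phi>"

lemma drift_diffusion_eq:
  assumes lin: "\<And>\<phi> \<psi> r s. schwartz \<phi> \<Longrightarrow> schwartz \<psi> \<Longrightarrow> T (\<lambda>x. r * \<phi> x + s * \<psi> x) = r * T \<phi> + s * T \<psi>"
    and \<phi>: "schwartz \<phi>"
  shows "drift_diffusion \<alpha> lam \<kappa> T \<phi> = T (gen_adj \<alpha> lam \<kappa> \<phi>)"
proof -
  have 1: "schwartz (deriv \<phi>)" "schwartz (deriv (deriv \<phi>))" by (intro schwartz_deriv \<phi>)+
  show ?thesis
    unfolding gen_adj_def[abs_def] lin[OF schwartz_lincomb(1)[OF 1] \<phi>] lin[OF 1]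
    by (simp add: drift_diffusion_def dist_nabla_def dist_laplace_def)
qed

lemma tempered_flow: "tempered (\<lambda>\<phi>. flow \<alpha> lam \<kappa> t \<phi> 0)"
  unfolding tempered_def
proof (intro conjI allI impI exI[of _ "exp (- \<kappa> * t)"] exI[of _ "0::nat"])
  show "flow \<alpha> lam \<kappa> t (\<lambda>x. r * \<phi> x + s * \<psi> x) 0 = r * flow \<alpha> lam \<kappa> t \<phi> 0 + s * flow \<alpha> lam \<kappa> t \<psi> 0"
    if "schwartz \<phi>" "schwartz \<psi>" for \<phi> \<psi> r s
    by (rule flow_lincomb[OF that])
  show "\<bar>flow \<alpha> lam \<kappa> t \<phi> 0\<bar> \<le> exp (- \<kappa> * t) * (\<Sum>j\<le>0. \<Sum>k\<le>0. schwartz_seminorm j k \<phi>)" if "schwartz \<phi>" for \<phi>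
  proof -
    have "\<bar>gauss (- \<alpha> * t) (2 * lam * t) \<phi> 0\<bar> \<le> schwartz_seminorm 0 0 \<phi>"
      by (rule gauss_bound) (use schwartz_seminorm_upper[OF that, of _ 0 0] in simp)
    then show ?thesis by (simp add: flow_def abs_mult)
  qed
qed

lemma flow_fundamental_solution:
  assumes "0 \<le> lam"
  shows "is_fundamental_solution (drift_diffusion \<alpha> lam \<kappa>) (\<lambda>t \<phi>. flow \<alpha> lam \<kappa> t \<phi> 0)"
  unfolding is_fundamental_solution_def
proof (intro conjI allI impI tempered_flow)
  show "flow \<alpha> lam \<kappa> 0 \<phi> 0 = \<phi> 0" for \<phi> by (simp add: flow_0)
  show "((\<lambda>s. flow \<alpha> lam \<kappa> s \<phi> 0) has_real_derivative drift_diffusion \<alpha> lam \<kappa> (\<lambda>\<phi>. flow \<alpha> lam \<kappa> t \<phi> 0) \<phi>)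
      (at t within {0..})" if "schwartz \<phi>" "0 \<le> t" for \<phi> t
    using flow_has_derivative[OF that(1) assms that(2)] by (simp add: drift_diffusion_eq flow_lincomb that)
qed

lemma schwartz_norm_le_decay:
  assumes "\<And>k x. k \<le> N \<Longrightarrow> (1 + \<bar>x\<bar>) ^ N * \<bar>(deriv ^^ k) \<phi> x\<bar> \<le> C"
  shows "schwartz_norm N \<phi> \<le> real (Suc N) * (real (Suc N) * C)"
proof -
  have "schwartz_seminorm j k \<phi> \<le> C" if "j \<le> N" "k \<le> N" for j k
  proof (rule schwartz_seminorm_least)
    fix x :: real
    have "\<bar>x\<bar> ^ j \<le> (1 + \<bar>x\<bar>) ^ j" by (rule power_mono) auto
    also have "\<dots> \<le> (1 + \<bar>x\<bar>) ^ N" by (rule power_increasing) (use that in auto)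
    finally have "\<bar>x ^ j * (deriv ^^ k) \<phi> x\<bar> \<le> (1 + \<bar>x\<bar>) ^ N * \<bar>(deriv ^^ k) \<phi> x\<bar>"
      unfolding abs_mult power_abs by (rule mult_right_mono) simp
    with assms[OF that(2), of x] show "\<bar>x ^ j * (deriv ^^ k) \<phi> x\<bar> \<le> C" by linarith
  qed
  then have "schwartz_norm N \<phi> \<le> (\<Sum>j\<le>N. \<Sum>k\<le>N. C)"
    unfolding schwartz_norm_def by (intro sum_mono) auto
  then show ?thesis by simp
qed

text \<open>Derivatives commute with flow and generator, so the pointwise expansion applies to each
  of the finitely many derivatives in the norm. The coefficients 1 and -1 keep the remainder a
  nested linear combination, on which a tempered distribution can be expanded directly.\<close>

lemma flow_taylor_norm:
  assumes \<phi>: "schwartz \<phi>" and lam: "0 \<le> lam"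
  obtains C where "0 \<le> C" "\<And>r r'. 0 \<le> r \<Longrightarrow> r \<le> T \<Longrightarrow> 0 \<le> r' \<Longrightarrow> r' \<le> T \<Longrightarrow>
    schwartz_norm N (\<lambda>x. 1 * (\<lambda>x. 1 * flow \<alpha> lam \<kappa> r' \<phi> x + -1 * flow \<alpha> lam \<kappa> r \<phi> x) x
        + - (r' - r) * flow \<alpha> lam \<kappa> r (gen_adj \<alpha> lam \<kappa> \<phi>) x) \<le> C * (r' - r)\<^sup>2"
proof -
  have "\<forall>k. \<exists>C\<ge>0. \<forall>r r' x. 0 \<le> r \<longrightarrow> r \<le> T \<longrightarrow> 0 \<le> r' \<longrightarrow> r' \<le> T \<longrightarrow>
    (1 + \<bar>x\<bar>) ^ N * \<bar>flow \<alpha> lam \<kappa> r' ((deriv ^^ k) \<phi>) x - flow \<alpha> lam \<kappa> r ((deriv ^^ k) \<phi>) x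
      - (r' - r) * flow \<alpha> lam \<kappa> r (gen_adj \<alpha> lam \<kappa> ((deriv ^^ k) \<phi>)) x\<bar> \<le> C * (r' - r)\<^sup>2"
    by (metis flow_taylor[OF schwartz_funpow_deriv[OF \<phi>] lam])
  then obtain C where C0: "\<And>k. 0 \<le> C k" and C: "\<And>k r r' x. 0 \<le> r \<Longrightarrow> r \<le> T \<Longrightarrow> 0 \<le> r' \<Longrightarrow> r' \<le> T \<Longrightarrow>
    (1 + \<bar>x\<bar>) ^ N * \<bar>flow \<alpha> lam \<kappa> r' ((deriv ^^ k) \<phi>) x - flow \<alpha> lam \<kappa> r ((deriv ^^ k) \<phi>) x
      - (r' - r) * flow \<alpha> lam \<kappa> r (gen_adj \<alpha> lam \<kappa> ((deriv ^^ k) \<phi>)) x\<bar> \<le> C k * (r' - r)\<^sup>2"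
    by metis
  define C' where "C' = (\<Sum>k\<le>N. C k)"
  have "schwartz_norm N (\<lambda>x. 1 * (\<lambda>x. 1 * flow \<alpha> lam \<kappa> r' \<phi> x + -1 * flow \<alpha> lam \<kappa> r \<phi> x) x
        + - (r' - r) * flow \<alpha> lam \<kappa> r (gen_adj \<alpha> lam \<kappa> \<phi>) x) \<le> real (Suc N) * (real (Suc N) * (C' * (r' - r)\<^sup>2))"
    if r: "0 \<le> r" "r \<le> T" "0 \<le> r'" "r' \<le> T" for r r'
  proof (rule schwartz_norm_le_decay)
    fix k x assume "k \<le> N"
    then have "C k \<le> C'" unfolding C'_def by (intro member_le_sum) (auto simp: C0)
    then have le: "C k * (r' - r)\<^sup>2 \<le> C' * (r' - r)\<^sup>2" by (rule mult_right_mono) simp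
    have S: "schwartz (flow \<alpha> lam \<kappa> r' \<phi>)" "schwartz (flow \<alpha> lam \<kappa> r \<phi>)" "schwartz (flow \<alpha> lam \<kappa> r (gen_adj \<alpha> lam \<kappa> \<phi>))"
      by (intro schwartz_flow schwartz_gen_adj \<phi>)+
    show "(1 + \<bar>x\<bar>) ^ N * \<bar>(deriv ^^ k) (\<lambda>x. 1 * (\<lambda>x. 1 * flow \<alpha> lam \<kappa> r' \<phi> x + -1 * flow \<alpha> lam \<kappa> r \<phi> x) x
        + - (r' - r) * flow \<alpha> lam \<kappa> r (gen_adj \<alpha> lam \<kappa> \<phi>) x) x\<bar> \<le> C' * (r' - r)\<^sup>2"
      unfolding schwartz_lincomb(2)[OF schwartz_lincomb(1)[OF S(1,2)] S(3)] schwartz_lincomb(2)[OF S(1,2)]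
        funpow_deriv_flow[OF \<phi>] funpow_deriv_flow[OF schwartz_gen_adj[OF \<phi>]] funpow_deriv_gen_adj[OF \<phi>]
      using order_trans[OF C[OF r, of x k] le]
      by (simp only: mult_1_left mult_minus1 mult_minus_left add_uminus_conv_diff)
  qed
  moreover have "0 \<le> real (Suc N) * (real (Suc N) * C')" unfolding C'_def by (intro mult_nonneg_nonneg sum_nonneg C0) auto
  ultimately show thesis by (intro that[of "real (Suc N) * (real (Suc N) * C')"]) (auto simp: mult.assoc)
qed

text \<open>If \<open>D\<close> is the difference of two solutions, \<open>s \<mapsto> D s (flow (t - s) \<phi>)\<close> has derivative zero.
  Uniform boundedness makes the remainder of the flow negligible, as \<open>D s\<close> varies with \<open>s\<close>.\<close>

lemma fundamental_solution_unique_aux: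
  assumes lam: "0 \<le> lam"
    and D: "\<And>s. 0 \<le> s \<Longrightarrow> tempered (D s)" "\<And>\<phi>. schwartz \<phi> \<Longrightarrow> D 0 \<phi> = 0"
    and der: "\<And>\<phi> s. schwartz \<phi> \<Longrightarrow> 0 \<le> s \<Longrightarrow>
      ((\<lambda>s. D s \<phi>) has_real_derivative D s (gen_adj \<alpha> lam \<kappa> \<phi>)) (at s within {0..})"
    and \<phi>: "schwartz \<phi>" and t: "0 \<le> t"
  shows "D t \<phi> = 0"
proof -
  let ?G = "gen_adj \<alpha> lam \<kappa>" and ?S = "flow \<alpha> lam \<kappa>"
  have cont: "continuous_on {0..} (\<lambda>s. D s \<psi>)" if "schwartz \<psi>" for \<psi>
    unfolding continuous_on_eq_continuous_within using DERIV_continuous[OF der[OF that]] by auto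
  \<comment> \<open>Temperedness gives constants for each \<open>s\<close> separately. Continuity in
    \<open>s\<close> at a fixed test function bounds the family pointwise on the compact interval,
    and uniform boundedness makes the constants common.\<close>
  have "\<exists>C N. \<forall>s\<in>{0..t}. \<forall>\<psi>. schwartz \<psi> \<longrightarrow> \<bar>D s \<psi>\<bar> \<le> C * schwartz_norm N \<psi>"
  proof (rule uniform_boundedness)
    fix \<psi> assume "schwartz \<psi>"
    then have "compact ((\<lambda>s. D s \<psi>) ` {0..t})"
      by (intro compact_continuous_image continuous_on_subset[OF cont]) auto
    then show "\<exists>B. \<forall>s\<in>{0..t}. \<bar>D s \<psi>\<bar> \<le> B"
      using compact_imp_bounded[of "(\<lambda>s. D s \<psi>) ` {0..t}"] by (auto simp: bounded_iff)
  qed (use D in auto)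
  then obtain C N where "\<And>s \<psi>. s \<in> {0..t} \<Longrightarrow> schwartz \<psi> \<Longrightarrow> \<bar>D s \<psi>\<bar> \<le> C * schwartz_norm N \<psi>" by blast
  then have C: "\<bar>D s \<psi>\<bar> \<le> \<bar>C\<bar> * schwartz_norm N \<psi>" if "s \<in> {0..t}" "schwartz \<psi>" for s \<psi>
    using that mult_right_mono[OF abs_ge_self schwartz_norm_nonneg, of \<psi> C N] order_trans by blast
  obtain B where B: "0 \<le> B" "\<And>r r'. 0 \<le> r \<Longrightarrow> r \<le> t \<Longrightarrow> 0 \<le> r' \<Longrightarrow> r' \<le> t \<Longrightarrow>
    schwartz_norm N (\<lambda>x. 1 * (\<lambda>x. 1 * ?S r' \<phi> x + -1 * ?S r \<phi> x) x + - (r' - r) * ?S r (?G \<phi>) x) \<le> B * (r' - r)\<^sup>2"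
    using flow_taylor_norm[OF \<phi> lam, where T = t and N = N and \<alpha> = \<alpha> and \<kappa> = \<kappa>] by blast
  define g where "g s = D s (?S (t - s) \<phi>)" for s
  have "(g has_real_derivative 0) (at s within {0..t})" if s: "s \<in> {0..t}" for s
  proof -
    let ?\<psi> = "?S (t - s) \<phi>"
    have \<psi>: "schwartz ?\<psi>" by (intro schwartz_flow \<phi>)
    have G\<psi>: "schwartz (?G ?\<psi>)" by (intro schwartz_gen_adj \<psi>)
    have est: "\<bar>(g s' - g s) / (s' - s) - ((D s' ?\<psi> - D s ?\<psi>) / (s' - s) - D s' (?G ?\<psi>))\<bar> \<le> \<bar>C\<bar> * B * \<bar>s' - s\<bar>"
      if s': "s' \<in> {0..t}" "s' \<noteq> s" for s'
    proof -
      let ?R = "\<lambda>x. 1 * (\<lambda>x. 1 * ?S (t - s') \<phi> x + -1 * ?S (t - s) \<phi> x) x + - ((t - s') - (t - s)) * ?S (t - s) (?G \<phi>) x"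
      have T: "tempered (D s')" using D(1) s' by simp
      have S: "schwartz (?S (t - s') \<phi>)" "schwartz (?S (t - s) (?G \<phi>))" by (intro schwartz_flow schwartz_gen_adj \<phi>)+
      have R: "schwartz ?R" by (rule schwartz_lincomb(1)[OF schwartz_lincomb(1)[OF S(1) \<psi>] S(2)])
      have "D s' ?R = 1 * (1 * D s' (?S (t - s') \<phi>) + -1 * D s' ?\<psi>) + - ((t - s') - (t - s)) * D s' (?S (t - s) (?G \<phi>))"
        by (simp only: tempered_lincomb[OF T schwartz_lincomb(1)[OF S(1) \<psi>] S(2)] tempered_lincomb[OF T S(1) \<psi>])
      also have "\<dots> = (g s' - g s) - ((D s' ?\<psi> - D s ?\<psi>) - (s' - s) * D s' (?G ?\<psi>))"
        by (simp add: g_def flow_gen_adj_commute[OF \<phi>] algebra_simps)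
      finally have eq: "D s' ?R = (g s' - g s) - ((D s' ?\<psi> - D s ?\<psi>) - (s' - s) * D s' (?G ?\<psi>))" .
      have "\<bar>D s' ?R\<bar> \<le> \<bar>C\<bar> * (B * ((t - s') - (t - s))\<^sup>2)"
        by (rule order_trans[OF C[OF s'(1) R]], intro mult_left_mono B(2)) (use s s' in auto)
      also have "((t - s') - (t - s))\<^sup>2 = \<bar>s' - s\<bar> * \<bar>s' - s\<bar>"
        by (simp add: power2_eq_square algebra_simps flip: abs_mult)
      finally have "\<bar>D s' ?R\<bar> \<le> \<bar>C\<bar> * B * \<bar>s' - s\<bar> * \<bar>s' - s\<bar>"
        by (simp only: mult.assoc)
      moreover have "(g s' - g s) / (s' - s) - ((D s' ?\<psi> - D s ?\<psi>) / (s' - s) - D s' (?G ?\<psi>)) = D s' ?R / (s' - s)"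
      proof -
        have "(p - (q - d * e)) / d = p / d - (q / d - e)" if "d \<noteq> 0" for p q d e :: real
          using that by (simp add: field_simps)
        from this[of "s' - s"] show ?thesis unfolding eq using s'(2) by simp
      qed
      ultimately show ?thesis using s'(2) by (simp add: abs_divide divide_le_eq)
    qed
    \<comment> \<open>The motion of \<open>D\<close> and that of its argument contribute the same
      term with opposite signs.\<close>
    have lim: "((\<lambda>s'. (D s' ?\<psi> - D s ?\<psi>) / (s' - s) - D s' (?G ?\<psi>)) \<longlongrightarrow> D s (?G ?\<psi>) - D s (?G ?\<psi>)) (at s within {0..t})"
    proof (intro tendsto_diff)
      have "((\<lambda>s. D s ?\<psi>) has_real_derivative D s (?G ?\<psi>)) (at s within {0..t})"
        by (rule DERIV_subset[OF der[OF \<psi>]]) (use s in auto)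
      then show "((\<lambda>s'. (D s' ?\<psi> - D s ?\<psi>) / (s' - s)) \<longlongrightarrow> D s (?G ?\<psi>)) (at s within {0..t})"
        by (simp add: has_field_derivative_iff)
      have "continuous_on {0..t} (\<lambda>s. D s (?G ?\<psi>))" by (rule continuous_on_subset[OF cont[OF G\<psi>]]) auto
      then show "((\<lambda>s'. D s' (?G ?\<psi>)) \<longlongrightarrow> D s (?G ?\<psi>)) (at s within {0..t})"
        using s by (simp add: continuous_on_def)
    qed
    have "((\<lambda>s'. (g s' - g s) / (s' - s) - ((D s' ?\<psi> - D s ?\<psi>) / (s' - s) - D s' (?G ?\<psi>))) \<longlongrightarrow> 0) (at s within {0..t})"
    proof (rule Lim_null_comparison)
      show "\<forall>\<^sub>F s' in at s within {0..t}. norm ((g s' - g s) / (s' - s) - ((D s' ?\<psi> - D s ?\<psi>) / (s' - s) - D s' (?G ?\<psi>)))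
          \<le> \<bar>C\<bar> * B * \<bar>s' - s\<bar>"
        using est by (auto simp: eventually_at_filter)
      have "((\<lambda>s'. \<bar>C\<bar> * B * \<bar>s' - s\<bar>) \<longlongrightarrow> \<bar>C\<bar> * B * \<bar>s - s\<bar>) (at s within {0..t})"
        by (intro tendsto_intros)
      then show "((\<lambda>s'. \<bar>C\<bar> * B * \<bar>s' - s\<bar>) \<longlongrightarrow> 0) (at s within {0..t})" by simp
    qed
    from tendsto_add[OF this lim] show ?thesis by (simp add: has_field_derivative_iff)
  qed
  then have "g t = g 0"
    using field_differentiable_bound[of "{0..t}" g "\<lambda>_. 0" 0 t 0] t by auto
  then show ?thesis using D(2)[OF schwartz_flow[OF \<phi>]] by (simp add: g_def flow_0)
qed

text \<open>The flow evaluated at the origin is one solution, and the difference of any other from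
  it starts at zero and stays zero on Schwartz functions; this settles the definite
  description.\<close>

lemma fundamental_solution_eq_flow:
  assumes lam: "0 \<le> lam" and G: "G = drift_diffusion \<alpha> lam \<kappa>" and \<phi>: "schwartz \<phi>" and t: "0 \<le> t"
  shows "fundamental_solution G t \<phi> = flow \<alpha> lam \<kappa> t \<phi> 0"
  unfolding fundamental_solution_def
proof (rule the_equality)
  show "\<exists>P. is_fundamental_solution G P \<and> P t \<phi> = flow \<alpha> lam \<kappa> t \<phi> 0"
    unfolding G using flow_fundamental_solution[OF lam] by blast
  fix r assume "\<exists>P. is_fundamental_solution G P \<and> P t \<phi> = r"
  then obtain P where P: "is_fundamental_solution G P" and r: "P t \<phi> = r" by blast
  define D where "D s \<psi> = P s \<psi> - flow \<alpha> lam \<kappa> s \<psi> 0" for s \<psi>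
  have PT: "tempered (P s)" if "0 \<le> s" for s using P that by (simp add: is_fundamental_solution_def)
  have "D t \<phi> = 0"
  proof (rule fundamental_solution_unique_aux[OF lam _ _ _ \<phi> t])
    show "tempered (D s)" if "0 \<le> s" for s
      unfolding D_def[abs_def] by (rule tempered_diff[OF PT[OF that] tempered_flow])
    show "D 0 \<psi> = 0" if "schwartz \<psi>" for \<psi>
      using P that by (simp add: is_fundamental_solution_def D_def flow_0)
    show "((\<lambda>s. D s \<psi>) has_real_derivative D s (gen_adj \<alpha> lam \<kappa> \<psi>)) (at s within {0..})"
      if "schwartz \<psi>" "0 \<le> s" for \<psi> s
    proof -
      have *: "((\<lambda>s. P s \<psi>) has_real_derivative drift_diffusion \<alpha> lam \<kappa> (P s) \<psi>) (at s within {0..})"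
        using P that by (simp add: is_fundamental_solution_def G)
      have "((\<lambda>s. P s \<psi>) has_real_derivative P s (gen_adj \<alpha> lam \<kappa> \<psi>)) (at s within {0..})"
      proof -
        have "drift_diffusion \<alpha> lam \<kappa> (P s) \<psi> = P s (gen_adj \<alpha> lam \<kappa> \<psi>)"
          by (rule drift_diffusion_eq[OF _ that(1)], rule tempered_lincomb[OF PT[OF that(2)]])
        with * show ?thesis by simp
      qed
      from DERIV_diff[OF this flow_has_derivative[OF that(1) lam that(2)]] show ?thesis by (simp add: D_def)
    qed
  qed
  then show "r = flow \<alpha> lam \<kappa> t \<phi> 0" by (simp add: D_def r)
qed

section \<open>The lattice equation\<close>

abbreviation sites :: "int measure" where "sites \<equiv> count_space UNIV"

text \<open>The generator applied to the coordinate at \<open>x\<close>: the Hamiltonian part gives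
  the first difference, a flip at \<open>x\<close> gives -2 times the coordinate, and exchanges over
  the two bonds at \<open>x\<close> give the discrete Laplacian. Linear functions are thus mapped to
  linear functions, which closes the equation.\<close>

definition lattice_op :: "real \<Rightarrow> real \<Rightarrow> (int \<Rightarrow> real) \<Rightarrow> int \<Rightarrow> real" where
  "lattice_op \<gamma> lam u x =
     u (x + 1) - u (x - 1) - 2 * \<gamma> * u x + lam * (u (x + 1) + u (x - 1) - 2 * u x)"

section \<open>Bilinear forms of the two-point function\<close>

text \<open>Transpose of \<open>lattice_op\<close> under summation over sites: the two shifts are
  interchanged, which reverses the drift and preserves the symmetric terms.\<close>

definition lattice_adj :: "real \<Rightarrow> real \<Rightarrow> (int \<Rightarrow> real) \<Rightarrow> int \<Rightarrow> real" where
  "lattice_adj \<gamma> lam \<phi> x =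
     \<phi> (x - 1) - \<phi> (x + 1) - 2 * \<gamma> * \<phi> x + lam * (\<phi> (x + 1) + \<phi> (x - 1) - 2 * \<phi> x)"

abbreviation site_pairs :: "(int \<times> int) measure" where "site_pairs \<equiv> count_space UNIV"

lemma integrable_site_pairs:
  fixes \<phi> g :: "int \<Rightarrow> real"
  assumes "integrable sites \<phi>" "integrable sites g"
  shows "integrable site_pairs (\<lambda>p. \<phi> (fst p) * g (snd p))"
  using abs_summable_on_product[where f = \<phi> and g = g and A = UNIV and B = UNIV] assms
  by (simp add: Infinite_Set_Sum.abs_summable_on_def case_prod_beta)

lemma integrable_sites_shift:
  "integrable sites (\<lambda>x. f (x + k)) \<longleftrightarrow> integrable sites f" for f :: "int \<Rightarrow> real"
  by (rule integrable_bij_count_space) (auto intro!: bij_betwI[of _ _ _ "\<lambda>x. x - k"])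

text \<open>A summable function on the integers is bounded by its sum, so its square is dominated by
  a multiple of it.\<close>

lemma integrable_sites_square:
  fixes \<phi> :: "int \<Rightarrow> real"
  assumes "integrable sites \<phi>"
  shows "integrable sites (\<lambda>x. (\<phi> x)\<^sup>2)"
proof -
  define C where "C = (LINT x|sites. \<bar>\<phi> x\<bar>)"
  have C: "\<bar>\<phi> x\<bar> \<le> C" for x
  proof -
    have "(LINT z|sites. indicator {x} z * \<bar>\<phi> z\<bar>) \<le> C"
      unfolding C_def
      by (rule integral_mono') (use assms in \<open>auto split: split_indicator\<close>)
    moreover have "(LINT z|sites. indicator {x} z * \<bar>\<phi> z\<bar>) = \<bar>\<phi> x\<bar>"
    proof -
      have "(LINT z|sites. indicator {x} z * \<bar>\<phi> z\<bar>) = (LINT z|sites. indicator {x} z *\<^sub>R \<bar>\<phi> x\<bar>)"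
        by (rule Bochner_Integration.integral_cong) (auto split: split_indicator)
      then show ?thesis by simp
    qed
    ultimately show ?thesis by simp
  qed
  show ?thesis
  proof (rule Bochner_Integration.integrable_bound[OF integrable_mult_right[of C, OF assms]])
    show "AE x in sites. norm ((\<phi> x)\<^sup>2) \<le> norm (C * \<phi> x)"
    proof (rule AE_I2)
      fix x
      have "\<bar>\<phi> x\<bar> * \<bar>\<phi> x\<bar> \<le> \<bar>C\<bar> * \<bar>\<phi> x\<bar>" using C[of x] by (intro mult_right_mono) auto
      then show "norm ((\<phi> x)\<^sup>2) \<le> norm (C * \<phi> x)" by (simp add: power2_eq_square abs_mult)
    qed
  qed simp
qed

text \<open>All that the scaling limits take from the process: initial covariance, closed equation
  and boundedness as a form on square-summable functions. From here the argument is deterministic.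
  The last assumption concerns finite sets only, as it will come from finite linear combinations of
  coordinates.\<close>

locale lattice_correlation =
  fixes \<beta> \<gamma> lam :: real and u :: "real \<Rightarrow> int \<Rightarrow> int \<Rightarrow> real"
  assumes \<beta>: "\<beta> > 0" and \<gamma>: "0 \<le> \<gamma>" and lam: "0 \<le> lam"
    and u_0: "u 0 x y = of_bool (x = y) / \<beta>"
    and u_ode: "0 \<le> t \<Longrightarrow>
      ((\<lambda>t. u t x y) has_real_derivative lattice_op \<gamma> lam (\<lambda>z. u t z y) x) (at t within {0..})"
    and u_bilinear: "0 \<le> t \<Longrightarrow> finite A \<Longrightarrow> finite B \<Longrightarrow>
      \<bar>\<Sum>x\<in>A. \<Sum>y\<in>B. \<phi> x * g y * u t x y\<bar> \<le> sqrt (\<Sum>x\<in>A. (\<phi> x)\<^sup>2) * sqrt (\<Sum>y\<in>B. (g y)\<^sup>2) / \<beta>"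
begin

lemma u_bound: "0 \<le> t \<Longrightarrow> \<bar>u t x y\<bar> \<le> 1 / \<beta>"
  using u_bilinear[of t "{x}" "{y}" "\<lambda>_. 1" "\<lambda>_. 1"] by simp

text \<open>An integral over counting measure, so that dominated convergence and differentiation
  under the integral apply; \<open>Q_infsum\<close> links it to the unordered sums of the
  correlation fields.\<close>

definition Q :: "real \<Rightarrow> (int \<Rightarrow> real) \<Rightarrow> (int \<Rightarrow> real) \<Rightarrow> real" where
  "Q t \<phi> g = (LINT p|site_pairs. \<phi> (fst p) * g (snd p) * u t (fst p) (snd p))"

lemma Q_integrable:
  assumes "integrable sites \<phi>" "integrable sites g" "0 \<le> t"
  shows "integrable site_pairs (\<lambda>p. \<phi> (fst p) * g (snd p) * u t (fst p + k) (snd p))"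
proof (rule Bochner_Integration.integrable_bound[OF integrable_mult_right[of "1 / \<beta>", OF integrable_site_pairs[OF assms(1,2)]]])
  show "AE p in site_pairs. norm (\<phi> (fst p) * g (snd p) * u t (fst p + k) (snd p)) \<le> norm (1 / \<beta> * (\<phi> (fst p) * g (snd p)))"
  proof (rule AE_I2)
    fix p :: "int \<times> int"
    have "\<bar>\<phi> (fst p) * g (snd p)\<bar> * \<bar>u t (fst p + k) (snd p)\<bar> \<le> \<bar>\<phi> (fst p) * g (snd p)\<bar> * (1 / \<beta>)"
      by (intro mult_left_mono u_bound assms) auto
    then show "norm (\<phi> (fst p) * g (snd p) * u t (fst p + k) (snd p)) \<le> norm (1 / \<beta> * (\<phi> (fst p) * g (snd p)))"
      using \<beta> by (simp add: abs_mult mult_ac)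
  qed
qed simp

lemma Q_shift:
  "Q t (\<lambda>x. \<phi> (x - k)) g = (LINT p|site_pairs. \<phi> (fst p) * g (snd p) * u t (fst p + k) (snd p))"
proof -
  have "bij_betw (\<lambda>p::int \<times> int. (fst p + k, snd p)) UNIV UNIV"
    by (rule bij_betwI[of _ _ _ "\<lambda>p. (fst p - k, snd p)"]) auto
  from integral_bij_count_space[OF this, of "\<lambda>p. \<phi> (fst p - k) * g (snd p) * u t (fst p) (snd p)"]
  show ?thesis by (simp add: Q_def)
qed

text \<open>The finite bound holds on boxes exhausting all pairs of sites and passes to the limit,
  because the integrand is absolutely summable. Summability is used for convergence only; the
  estimate involves just the square norms.\<close>

lemma Q_bound:
  assumes \<phi>: "integrable sites \<phi>" and g: "integrable sites g" and t: "0 \<le> t"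
  shows "\<bar>Q t \<phi> g\<bar> \<le> sqrt (LINT x|sites. (\<phi> x)\<^sup>2) * sqrt (LINT y|sites. (g y)\<^sup>2) / \<beta>"
proof -
  define A :: "nat \<Rightarrow> int set" where "A N = {- int N..int N}" for N
  let ?F = "\<lambda>p. \<phi> (fst p) * g (snd p) * u t (fst p) (snd p)"
  have F: "integrable site_pairs ?F" using Q_integrable[OF assms, of 0] by simp
  have fin: "finite (A N)" for N by (simp add: A_def)
  have "(\<lambda>N. LINT p|site_pairs. indicator (A N \<times> A N) p * ?F p) \<longlonglongrightarrow> (LINT p|site_pairs. ?F p)"
  proof (rule integral_dominated_convergence[where w = "\<lambda>p. \<bar>?F p\<bar>"])
    show "integrable site_pairs (\<lambda>p. \<bar>?F p\<bar>)" using F by (rule integrable_abs)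
    show "AE p in site_pairs. (\<lambda>N. indicator (A N \<times> A N) p * ?F p) \<longlonglongrightarrow> ?F p"
    proof (rule AE_I2)
      fix p :: "int \<times> int"
      have "\<forall>\<^sub>F N in sequentially. indicator (A N \<times> A N) p * ?F p = ?F p"
      proof (rule eventually_sequentiallyI)
        fix N assume "nat \<bar>fst p\<bar> + nat \<bar>snd p\<bar> \<le> N"
        then have "p \<in> A N \<times> A N" by (cases p) (auto simp: A_def)
        then show "indicator (A N \<times> A N) p * ?F p = ?F p" by simp
      qed
      then show "(\<lambda>N. indicator (A N \<times> A N) p * ?F p) \<longlonglongrightarrow> ?F p" by (rule tendsto_eventually)
    qed
    show "AE p in site_pairs. norm (indicator (A N \<times> A N) p * ?F p) \<le> \<bar>?F p\<bar>" for N
      by (rule AE_I2) (auto split: split_indicator)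
  qed auto
  moreover have "\<bar>LINT p|site_pairs. indicator (A N \<times> A N) p * ?F p\<bar>
      \<le> sqrt (LINT x|sites. (\<phi> x)\<^sup>2) * sqrt (LINT y|sites. (g y)\<^sup>2) / \<beta>" for N
  proof -
    have le: "(\<Sum>x\<in>A N. (\<psi> x)\<^sup>2) \<le> (LINT x|sites. (\<psi> x)\<^sup>2)" if "integrable sites \<psi>" for \<psi> :: "int \<Rightarrow> real"
    proof -
      have "(\<Sum>x\<in>A N. (\<psi> x)\<^sup>2) = (LINT x|sites. (\<Sum>z\<in>A N. indicator {z} x *\<^sub>R (\<psi> z)\<^sup>2))"
        by (subst Bochner_Integration.integral_sum) auto
      also have "\<dots> \<le> (LINT x|sites. (\<psi> x)\<^sup>2)"
      proof (rule integral_mono'[OF integrable_sites_square[OF that]])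
        fix x
        have "(\<Sum>z\<in>A N. indicator {z} x *\<^sub>R (\<psi> z)\<^sup>2) = (\<Sum>z\<in>A N. if z = x then (\<psi> x)\<^sup>2 else 0)"
          by (rule sum.cong) (auto split: split_indicator)
        also have "\<dots> \<le> (\<psi> x)\<^sup>2" using fin by (simp add: sum.delta)
        finally show "(\<Sum>z\<in>A N. indicator {z} x *\<^sub>R (\<psi> z)\<^sup>2) \<le> (\<psi> x)\<^sup>2" .
      qed simp
      finally show ?thesis .
    qed
    have "(LINT p|site_pairs. indicator (A N \<times> A N) p * ?F p)
        = (LINT p|site_pairs. (\<Sum>q\<in>A N \<times> A N. indicator {q} p *\<^sub>R ?F q))"
    proof (rule Bochner_Integration.integral_cong)
      fix p :: "int \<times> int"
      have "(\<Sum>q\<in>A N \<times> A N. indicator {q} p *\<^sub>R ?F q) = (\<Sum>q\<in>A N \<times> A N. if q = p then ?F p else 0)"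
        by (rule sum.cong) (auto split: split_indicator)
      then show "indicator (A N \<times> A N) p * ?F p = (\<Sum>q\<in>A N \<times> A N. indicator {q} p *\<^sub>R ?F q)"
        using fin by (simp add: sum.delta split: split_indicator)
    qed simp
    also have "\<dots> = (\<Sum>q\<in>A N \<times> A N. ?F q)"
      by (subst Bochner_Integration.integral_sum) auto
    also have "\<dots> = (\<Sum>x\<in>A N. \<Sum>y\<in>A N. \<phi> x * g y * u t x y)"
      by (simp add: sum.cartesian_product case_prod_beta)
    finally have "\<bar>LINT p|site_pairs. indicator (A N \<times> A N) p * ?F p\<bar>
        \<le> sqrt (\<Sum>x\<in>A N. (\<phi> x)\<^sup>2) * sqrt (\<Sum>y\<in>A N. (g y)\<^sup>2) / \<beta>"
      using u_bilinear[OF t fin fin] by simp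
    also have "\<dots> \<le> sqrt (LINT x|sites. (\<phi> x)\<^sup>2) * sqrt (LINT y|sites. (g y)\<^sup>2) / \<beta>"
      using \<beta> le[OF \<phi>] le[OF g] by (intro divide_right_mono mult_mono) (auto intro: sum_nonneg)
    finally show ?thesis .
  qed
  ultimately have "\<bar>LINT p|site_pairs. ?F p\<bar> \<le> sqrt (LINT x|sites. (\<phi> x)\<^sup>2) * sqrt (LINT y|sites. (g y)\<^sup>2) / \<beta>"
    by (intro LIMSEQ_le_const2[OF tendsto_rabs]) auto
  then show ?thesis by (simp add: Q_def)
qed

lemma Q_at_0: "Q 0 \<phi> g = (LINT x|sites. \<phi> x * g x) / \<beta>"
proof -
  have "Q 0 \<phi> g = infsetsum (\<lambda>p. \<phi> (fst p) * g (snd p) * u 0 (fst p) (snd p)) UNIV"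
    by (simp add: Q_def infsetsum_def)
  also have "\<dots> = infsetsum (\<lambda>p. \<phi> (fst p) * g (snd p) / \<beta>) (range (\<lambda>x. (x, x)))"
    by (rule infsetsum_cong_neutral) (auto simp: u_0)
  also have "\<dots> = infsetsum (\<lambda>x. \<phi> x * g x / \<beta>) UNIV"
    by (subst infsetsum_reindex) (auto simp: inj_on_def)
  finally show ?thesis by (simp add: infsetsum_def)
qed

text \<open>Product rule under the sum, then a shift of the summation index moves the lattice
  operator from \<open>u\<close> to the test function. The majorant \<open>m\<close> has to be
  uniform in time.\<close>

lemma Q_has_derivative:
  assumes S: "convex S" "S \<subseteq> {0..}" "s0 \<in> S"
    and \<phi>: "\<And>s x. s \<in> S \<Longrightarrow> ((\<lambda>s. \<phi> s x) has_real_derivative \<phi>' s x) (at s within S)"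
    and m: "\<And>s x. s \<in> S \<Longrightarrow> \<bar>\<phi> s x\<bar> \<le> m x" "\<And>s x. s \<in> S \<Longrightarrow> \<bar>\<phi>' s x\<bar> \<le> m x" "integrable sites m"
    and g: "integrable sites g"
  shows "((\<lambda>s. Q s (\<phi> s) g) has_real_derivative
     Q s0 (\<lambda>x. \<phi>' s0 x + lattice_adj \<gamma> lam (\<phi> s0) x) g) (at s0 within S)"
proof -
  define F where "F s p = \<phi> s (fst p) * g (snd p) * u s (fst p) (snd p)" for s and p :: "int \<times> int"
  define F' where "F' s p = \<phi>' s (fst p) * g (snd p) * u s (fst p) (snd p)
      + \<phi> s (fst p) * g (snd p) * lattice_op \<gamma> lam (\<lambda>z. u s z (snd p)) (fst p)" for s and p :: "int \<times> int"
  \<comment> \<open>Each entry of \<open>u\<close> is at most 1 / \<beta>: one unit for the term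
    with \<open>\<phi>'\<close>, and 2 + 2 |\<gamma>| + 4 |lam| for the lattice operator acting on
    \<open>u\<close>.\<close>
  define K where "K = (3 + 2 * \<bar>\<gamma>\<bar> + 4 * \<bar>lam\<bar>) / \<beta>"
  have int: "integrable sites (\<phi> s)" "integrable sites (\<phi>' s)" if "s \<in> S" for s
    using order_trans[OF m(1)[OF that] abs_ge_self] order_trans[OF m(2)[OF that] abs_ge_self]
    by (auto intro!: Bochner_Integration.integrable_bound[OF m(3)] AE_I2)
  have S0: "0 \<le> s" if "s \<in> S" for s using S that by auto
  have op_bound: "\<bar>lattice_op \<gamma> lam (\<lambda>z. u s z y) x\<bar> \<le> (2 + 2 * \<bar>\<gamma>\<bar> + 4 * \<bar>lam\<bar>) / \<beta>" if "s \<in> S" for s x y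
  proof -
    have ub: "\<bar>u s z y\<bar> \<le> 1 / \<beta>" for z by (rule u_bound[OF S0[OF that]])
    have "\<bar>2 * \<gamma> * u s x y\<bar> \<le> 2 * \<bar>\<gamma>\<bar> * (1 / \<beta>)" unfolding abs_mult using ub by (intro mult_mono) auto
    moreover have "\<bar>lam * (u s (x + 1) y + u s (x - 1) y - 2 * u s x y)\<bar> \<le> \<bar>lam\<bar> * (4 * (1 / \<beta>))"
      unfolding abs_mult using ub[of "x + 1"] ub[of "x - 1"] ub[of x] by (intro mult_left_mono) linarith+
    moreover have "\<bar>A - B - C + D\<bar> \<le> a + a + c + d" if "\<bar>A\<bar> \<le> a" "\<bar>B\<bar> \<le> a" "\<bar>C\<bar> \<le> c" "\<bar>D\<bar> \<le> d" for A B C D a c d :: real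
      using that by linarith
    ultimately have "\<bar>lattice_op \<gamma> lam (\<lambda>z. u s z y) x\<bar> \<le> 1 / \<beta> + 1 / \<beta> + 2 * \<bar>\<gamma>\<bar> * (1 / \<beta>) + \<bar>lam\<bar> * (4 * (1 / \<beta>))"
      unfolding lattice_op_def using ub by blast
    also have "\<dots> = (2 + 2 * \<bar>\<gamma>\<bar> + 4 * \<bar>lam\<bar>) / \<beta>" by (simp add: add_divide_distrib)
    finally show ?thesis .
  qed
  have "((\<lambda>s. LINT p|site_pairs. F s p) has_real_derivative (LINT p|site_pairs. F' s0 p)) (at s0 within S)"
  proof (rule has_real_derivative_integral[OF S(1,3), where w = "\<lambda>p. K * \<bar>m (fst p) * g (snd p)\<bar>"])
    show "integrable site_pairs (F s)" if "s \<in> S" for s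
      unfolding F_def using Q_integrable[OF int(1)[OF that] g S0[OF that], of 0] by simp
    show "((\<lambda>s. F s p) has_real_derivative F' s p) (at s within S)" if "s \<in> S" for s p
    proof -
      have "((\<lambda>s. u s (fst p) (snd p)) has_real_derivative lattice_op \<gamma> lam (\<lambda>z. u s z (snd p)) (fst p)) (at s within S)"
        by (rule DERIV_subset[OF u_ode[OF S0[OF that]] S(2)])
      from DERIV_mult[OF DERIV_cmult_right[OF \<phi>[OF that]] this]
      show ?thesis unfolding F_def F'_def by (simp add: algebra_simps)
    qed
    show "\<bar>F' s p\<bar> \<le> K * \<bar>m (fst p) * g (snd p)\<bar>" if s: "s \<in> S" for s p
    proof -
      have mm: "\<bar>\<phi> s x\<bar> \<le> \<bar>m x\<bar>" "\<bar>\<phi>' s x\<bar> \<le> \<bar>m x\<bar>" for x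
        using m(1,2)[OF s, of x] by linarith+
      have "\<bar>\<phi>' s (fst p) * g (snd p) * u s (fst p) (snd p)\<bar> \<le> \<bar>m (fst p)\<bar> * \<bar>g (snd p)\<bar> * (1 / \<beta>)"
        unfolding abs_mult using u_bound[OF S0[OF s]] mm by (intro mult_mono) auto
      moreover have "\<bar>\<phi> s (fst p) * g (snd p) * lattice_op \<gamma> lam (\<lambda>z. u s z (snd p)) (fst p)\<bar>
          \<le> \<bar>m (fst p)\<bar> * \<bar>g (snd p)\<bar> * ((2 + 2 * \<bar>\<gamma>\<bar> + 4 * \<bar>lam\<bar>) / \<beta>)"
        unfolding abs_mult using op_bound[OF s] mm by (intro mult_mono) auto
      moreover have "\<bar>m (fst p)\<bar> * \<bar>g (snd p)\<bar> * (1 / \<beta>) + \<bar>m (fst p)\<bar> * \<bar>g (snd p)\<bar> * ((2 + 2 * \<bar>\<gamma>\<bar> + 4 * \<bar>lam\<bar>) / \<beta>)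
          = K * \<bar>m (fst p) * g (snd p)\<bar>"
        unfolding K_def abs_mult distrib_left[symmetric] add_divide_distrib[symmetric] by (simp add: add.assoc)
      ultimately show ?thesis unfolding F'_def by linarith
    qed
    show "integrable site_pairs (\<lambda>p. K * \<bar>m (fst p) * g (snd p)\<bar>)"
      by (intro integrable_mult_right integrable_abs integrable_site_pairs m g)
  qed simp
  moreover have "(LINT p|site_pairs. F' s0 p) = Q s0 (\<lambda>x. \<phi>' s0 x + lattice_adj \<gamma> lam (\<phi> s0) x) g"
  proof -
    let ?i = "\<lambda>\<psi> k p. \<psi> (fst p) * g (snd p) * u s0 (fst p + k) (snd p)"
    note i = Q_integrable[OF _ g S0[OF S(3)]]
    have sh: "integrable sites (\<lambda>x. \<phi> s0 (x + k))" for k using int(1)[OF S(3)] by (simp add: integrable_sites_shift)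
    have sh': "integrable sites (\<lambda>x. \<phi> s0 (x - k))" for k using sh[of "- k"] by simp
    have "F' s0 = (\<lambda>p. ?i (\<phi>' s0) 0 p + (((?i (\<phi> s0) 1 p - ?i (\<phi> s0) (- 1) p) - 2 * \<gamma> * ?i (\<phi> s0) 0 p)
        + lam * ((?i (\<phi> s0) 1 p + ?i (\<phi> s0) (- 1) p) - 2 * ?i (\<phi> s0) 0 p)))"
      by (auto simp: F'_def lattice_op_def algebra_simps)
    then have "(LINT p|site_pairs. F' s0 p) = Q s0 (\<phi>' s0) g
        + (((Q s0 (\<lambda>x. \<phi> s0 (x - 1)) g - Q s0 (\<lambda>x. \<phi> s0 (x - (- 1))) g) - 2 * \<gamma> * Q s0 (\<phi> s0) g)
        + lam * ((Q s0 (\<lambda>x. \<phi> s0 (x - 1)) g + Q s0 (\<lambda>x. \<phi> s0 (x - (- 1))) g) - 2 * Q s0 (\<phi> s0) g))"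
      unfolding Q_shift using i[OF int(1)[OF S(3)], of 1] i[OF int(1)[OF S(3)], of "- 1"] i[OF int(1)[OF S(3)], of 0] i[OF int(2)[OF S(3)], of 0]
      by (simp add: Q_def)
    also have "\<dots> = (LINT p|site_pairs. ?i (\<phi>' s0) 0 p
        + (((?i (\<lambda>x. \<phi> s0 (x - 1)) 0 p - ?i (\<lambda>x. \<phi> s0 (x + 1)) 0 p) - 2 * \<gamma> * ?i (\<phi> s0) 0 p)
        + lam * ((?i (\<lambda>x. \<phi> s0 (x - 1)) 0 p + ?i (\<lambda>x. \<phi> s0 (x + 1)) 0 p) - 2 * ?i (\<phi> s0) 0 p)))"
      using i[OF int(1)[OF S(3)], of 0] i[OF int(2)[OF S(3)], of 0] i[OF sh[of 1], of 0] i[OF sh'[of 1], of 0]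
      by (simp add: Q_def)
    also have "\<dots> = Q s0 (\<lambda>x. \<phi>' s0 x + lattice_adj \<gamma> lam (\<phi> s0) x) g"
      unfolding Q_def by (rule Bochner_Integration.integral_cong) (auto simp: lattice_adj_def algebra_simps)
    finally show ?thesis .
  qed
  ultimately show ?thesis unfolding F_def Q_def by simp
qed

end

section \<open>Riemann sums\<close>

text \<open>The points mapped to site \<open>k\<close> form an interval of length 1 / n. Riemann
  sums thereby become Lebesgue integrals of step functions, where dominated convergence and
  translation invariance are available.\<close>

lemma distr_floor_lborel:
  assumes n: "0 < (n::real)"
  shows "distr lborel sites (\<lambda>y. \<lfloor>n * y\<rfloor>) = density sites (\<lambda>_. ennreal (1 / n))"
proof (rule measure_eqI_countable[where A = UNIV])
  have [measurable]: "(\<lambda>y. \<lfloor>n * y\<rfloor>) \<in> borel \<rightarrow>\<^sub>M sites" by measurable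
  fix k :: int
  have "(\<lambda>y. \<lfloor>n * y\<rfloor>) -` {k} = {of_int k / n..<(of_int k + 1) / n}"
    using n by (auto simp: floor_eq_iff field_simps) linarith?
  then have "emeasure (distr lborel sites (\<lambda>y. \<lfloor>n * y\<rfloor>)) {k} = ennreal ((of_int k + 1) / n - of_int k / n)"
    using n by (subst emeasure_distr) (auto simp: divide_right_mono)
  also have "(of_int k + 1) / n - of_int k / n = 1 / n" by (simp add: add_divide_distrib)
  finally show "emeasure (distr lborel sites (\<lambda>y. \<lfloor>n * y\<rfloor>)) {k} = emeasure (density sites (\<lambda>_. ennreal (1 / n))) {k}"
    by (simp add: emeasure_density nn_integral_count_space_indicator[symmetric] nn_integral_count_space_finite)
qed auto

lemma riemann_sum_eq_integral:
  fixes G :: "int \<Rightarrow> real"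
  assumes n: "0 < (n::real)"
  shows "integrable sites G \<longleftrightarrow> integrable lborel (\<lambda>y. G \<lfloor>n * y\<rfloor>)"
    and "(LINT x|sites. G x) / n = (LINT y|lborel. G \<lfloor>n * y\<rfloor>)"
proof -
  have m: "(\<lambda>y. \<lfloor>n * y\<rfloor>) \<in> lborel \<rightarrow>\<^sub>M sites" by measurable
  have "integrable lborel (\<lambda>y. G \<lfloor>n * y\<rfloor>) \<longleftrightarrow> integrable (distr lborel sites (\<lambda>y. \<lfloor>n * y\<rfloor>)) G"
    by (rule integrable_distr_eq[OF m, symmetric]) simp
  also have "\<dots> \<longleftrightarrow> integrable sites (\<lambda>x. (1 / n) *\<^sub>R G x)"
    unfolding distr_floor_lborel[OF n] using n by (subst integrable_density) auto
  also have "\<dots> \<longleftrightarrow> integrable sites G"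
    using n by (simp only: real_scaleR_def integrable_mult_left_iff) simp
  finally show "integrable sites G \<longleftrightarrow> integrable lborel (\<lambda>y. G \<lfloor>n * y\<rfloor>)" by simp
  have "(LINT y|lborel. G \<lfloor>n * y\<rfloor>) = (LINT x|distr lborel sites (\<lambda>y. \<lfloor>n * y\<rfloor>). G x)"
    by (rule integral_distr[OF m, symmetric]) simp
  also have "\<dots> = (LINT x|sites. (1 / n) *\<^sub>R G x)"
    unfolding distr_floor_lborel[OF n] using n by (subst integral_density) auto
  finally show "(LINT x|sites. G x) / n = (LINT y|lborel. G \<lfloor>n * y\<rfloor>)" by simp
qed

text \<open>Cauchy profile serving as common majorant: it dominates every Schwartz function up to a
  constant, is integrable, and, unlike a Gaussian, loses only a bounded factor under bounded
  shifts.\<close>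

definition peak :: "real \<Rightarrow> real" where "peak z = 1 / (1 + z\<^sup>2)"

definition peak_mass :: real where "peak_mass = (LINT y|lborel. peak y)"

lemma peak_pos: "0 < peak z"
  unfolding peak_def by (simp add: add_pos_nonneg)

lemma peak_le_1: "peak z \<le> 1"
  unfolding peak_def by (simp add: divide_le_eq add_pos_nonneg)

lemma peak_measurable [measurable]: "peak \<in> borel_measurable borel"
  unfolding peak_def[abs_def] by measurable

text \<open>From q^2 \<le> 2 p^2 + 2 (p - q)^2 one gets 1 + q^2 \<le> 3 + 2 p^2, whence the constant
  3.\<close>

lemma peak_near:
  assumes "\<bar>p - q\<bar> \<le> 1" shows "peak p \<le> 3 * peak q"
proof -
  have "q\<^sup>2 \<le> 2 * p\<^sup>2 + 2 * (p - q)\<^sup>2"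
    using zero_le_power2[of "2 * p - q"] by (simp add: power2_eq_square algebra_simps)
  moreover have "(p - q)\<^sup>2 \<le> 1"
    using assms by (simp add: abs_square_le_1)
  ultimately have "1 + q\<^sup>2 \<le> 3 * (1 + p\<^sup>2)"
    using zero_le_power2[of p] by argo
  moreover have "0 < 1 + p\<^sup>2" "0 < 1 + q\<^sup>2" by (auto simp: add_pos_nonneg)
  ultimately show ?thesis unfolding peak_def by (simp add: field_simps)
qed

lemma peak_integrable: "integrable lborel (\<lambda>y. peak (y + c))"
  using lborel_integrable_real_affine[OF integrable_inverse_square_lborel, of 1 c]
  by (simp add: peak_def add.commute)

lemma peak_integral: "(LINT y|lborel. peak (y + c)) = peak_mass"
  using lborel_integral_real_affine[of 1 peak c] by (simp add: peak_mass_def add.commute)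

lemma peak_mass_nonneg: "0 \<le> peak_mass"
  unfolding peak_mass_def by (rule Bochner_Integration.integral_nonneg) (simp add: peak_pos less_imp_le)

lemma peak_nn_integral: "(\<integral>\<^sup>+y. ennreal (peak (y + c)) \<partial>lborel) = ennreal peak_mass"
  using nn_integral_eq_integral[OF peak_integrable[of c]] peak_integral[of c] by (simp add: peak_pos less_imp_le)

lemma floor_near:
  assumes "1 \<le> (n::real)" shows "\<bar>of_int \<lfloor>n * y\<rfloor> / n - y\<bar> \<le> 1 / n" "1 / n \<le> 1"
proof -
  have "of_int \<lfloor>n * y\<rfloor> \<le> n * y" "n * y - 1 \<le> of_int \<lfloor>n * y\<rfloor>" by linarith+
  from divide_right_mono[OF this(1), of n] divide_right_mono[OF this(2), of n]
  have "of_int \<lfloor>n * y\<rfloor> / n \<le> y" "y - 1 / n \<le> of_int \<lfloor>n * y\<rfloor> / n"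
    using assms by (simp_all add: diff_divide_distrib)
  then show "\<bar>of_int \<lfloor>n * y\<rfloor> / n - y\<bar> \<le> 1 / n" using assms by (auto simp: abs_le_iff)
qed (use assms in simp)

text \<open>Replacing the grid point by \<open>y\<close> costs the factor 3; exchanging integrals
  and translating then leaves the mass of \<open>peak\<close>. The bound does not involve
  \<open>n\<close>, \<open>c\<close>, the drift or the variance, which matters since displacement
  and variance may diverge with the scaling.\<close>

lemma gauss_riemann_sum_bound:
  fixes w :: "real \<Rightarrow> real"
  assumes n: "1 \<le> (n::real)" and w [measurable]: "w \<in> borel_measurable borel"
    and C: "0 \<le> C" "\<And>z. \<bar>w z\<bar> \<le> C * peak z"
  shows "integrable sites (\<lambda>x. gauss \<theta> v w (of_int x / n + c))"
    and "(LINT x|sites. \<bar>gauss \<theta> v w (of_int x / n + c)\<bar>) / n \<le> 3 * C * peak_mass"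
proof -
  interpret p: prob_space std_normal by (rule prob_space_std_normal)
  interpret pair_sigma_finite std_normal lborel
    by (rule pair_sigma_finite.intro) (rule p.sigma_finite_measure_axioms, rule sigma_finite_lborel)
  have n0: "0 < n" using n by simp
  let ?g = "\<lambda>y. gauss \<theta> v w (of_int \<lfloor>n * y\<rfloor> / n + c)"
  have gm [measurable]: "(\<lambda>x. gauss \<theta> v w x) \<in> borel_measurable borel"
    unfolding gauss_def by measurable
  have wb: "\<bar>w z\<bar> \<le> C" for z using C(2)[of z] mult_left_mono[OF peak_le_1 C(1), of z] by simp
  have "ennreal \<bar>?g y\<bar> \<le> (\<integral>\<^sup>+z. ennreal (3 * C * peak (y + (c + \<theta> + sqrt v * z))) \<partial>std_normal)" for y
  proof -
    have "\<bar>?g y\<bar> \<le> (LINT z|std_normal. \<bar>w (of_int \<lfloor>n * y\<rfloor> / n + c + (\<theta> + sqrt v * z))\<bar>)"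
      unfolding gauss_def by (rule integral_abs_bound)
    also have "\<dots> \<le> (LINT z|std_normal. 3 * C * peak (y + (c + \<theta> + sqrt v * z)))"
    proof (rule integral_mono)
      show "integrable std_normal (\<lambda>z. \<bar>w (of_int \<lfloor>n * y\<rfloor> / n + c + (\<theta> + sqrt v * z))\<bar>)"
        by (rule p.integrable_const_bound[where B = C]) (use wb in auto)
      show "integrable std_normal (\<lambda>z. 3 * C * peak (y + (c + \<theta> + sqrt v * z)))"
        by (intro integrable_mult_right p.integrable_const_bound[where B = 1])
           (use peak_le_1 peak_pos in \<open>auto simp: less_imp_le\<close>)
      fix z
      have "\<bar>w (of_int \<lfloor>n * y\<rfloor> / n + c + (\<theta> + sqrt v * z))\<bar> \<le> C * peak (of_int \<lfloor>n * y\<rfloor> / n + c + (\<theta> + sqrt v * z))"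
        by (rule C)
      also have "\<dots> \<le> C * (3 * peak (y + (c + \<theta> + sqrt v * z)))"
        using floor_near(1)[OF n, of y] floor_near(2)[OF n] by (intro mult_left_mono peak_near C(1)) simp
      finally show "\<bar>w (of_int \<lfloor>n * y\<rfloor> / n + c + (\<theta> + sqrt v * z))\<bar> \<le> 3 * C * peak (y + (c + \<theta> + sqrt v * z))" by simp
    qed
    finally have "ennreal \<bar>?g y\<bar> \<le> ennreal (LINT z|std_normal. 3 * C * peak (y + (c + \<theta> + sqrt v * z)))"
      by (rule ennreal_leI)
    also have "\<dots> = (\<integral>\<^sup>+z. ennreal (3 * C * peak (y + (c + \<theta> + sqrt v * z))) \<partial>std_normal)"
      by (rule nn_integral_eq_integral[symmetric])
         (auto intro!: integrable_mult_right p.integrable_const_bound[where B = 1] simp: peak_le_1 peak_pos less_imp_le C)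
    finally show ?thesis .
  qed
  \<comment> \<open>Tonelli's theorem for nonnegative integrals: finiteness obtained here is what
    yields integrability of the step function.\<close>
  then have "(\<integral>\<^sup>+y. ennreal \<bar>?g y\<bar> \<partial>lborel)
      \<le> (\<integral>\<^sup>+y. (\<integral>\<^sup>+z. ennreal (3 * C * peak (y + (c + \<theta> + sqrt v * z))) \<partial>std_normal) \<partial>lborel)"
    by (intro nn_integral_mono)
  also have "\<dots> = (\<integral>\<^sup>+z. (\<integral>\<^sup>+y. ennreal (3 * C * peak (y + (c + \<theta> + sqrt v * z))) \<partial>lborel) \<partial>std_normal)"
    by (rule Fubini') measurable
  also have "\<dots> = (\<integral>\<^sup>+z. ennreal (3 * C) * ennreal peak_mass \<partial>std_normal)"
    using C by (intro nn_integral_cong) (simp add: ennreal_mult' nn_integral_cmult peak_nn_integral)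
  also have "\<dots> = ennreal (3 * C) * ennreal peak_mass" using p.emeasure_space_1 by simp
  also have "\<dots> = ennreal (3 * C * peak_mass)" using C by (simp add: ennreal_mult')
  finally have le: "(\<integral>\<^sup>+y. ennreal \<bar>?g y\<bar> \<partial>lborel) \<le> ennreal (3 * C * peak_mass)" .
  have "(\<integral>\<^sup>+y. ennreal (norm (?g y)) \<partial>lborel) < \<infinity>"
    using le_less_trans[OF le, of \<infinity>] by simp
  then have int: "integrable lborel ?g" by (intro integrableI_bounded) auto
  then show "integrable sites (\<lambda>x. gauss \<theta> v w (of_int x / n + c))"
    unfolding riemann_sum_eq_integral(1)[OF n0] .
  have "(LINT x|sites. \<bar>gauss \<theta> v w (of_int x / n + c)\<bar>) / n = (LINT y|lborel. \<bar>?g y\<bar>)"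
    by (rule riemann_sum_eq_integral(2)[OF n0])
  moreover have "ennreal (LINT y|lborel. \<bar>?g y\<bar>) = (\<integral>\<^sup>+y. ennreal \<bar>?g y\<bar> \<partial>lborel)"
    by (rule nn_integral_eq_integral[symmetric]) (use int in auto)
  with le have "ennreal (LINT y|lborel. \<bar>?g y\<bar>) \<le> ennreal (3 * C * peak_mass)" by simp
  then have "(LINT y|lborel. \<bar>?g y\<bar>) \<le> 3 * C * peak_mass"
    by (subst (asm) ennreal_le_iff) (intro mult_nonneg_nonneg C peak_mass_nonneg, simp)
  ultimately show "(LINT x|sites. \<bar>gauss \<theta> v w (of_int x / n + c)\<bar>) / n \<le> 3 * C * peak_mass"
    by (simp only:)
qed

lemma gauss_id: "gauss 0 0 w = w"
  by (simp add: fun_eq_iff gauss_no_variance)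

lemma riemann_sum_bound:
  fixes w :: "real \<Rightarrow> real"
  assumes "1 \<le> (n::real)" "w \<in> borel_measurable borel" "0 \<le> C" "\<And>z. \<bar>w z\<bar> \<le> C * peak z"
  shows "integrable sites (\<lambda>x. w (of_int x / n + c))"
    and "(LINT x|sites. \<bar>w (of_int x / n + c)\<bar>) / n \<le> 3 * C * peak_mass"
  using gauss_riemann_sum_bound[OF assms, of 0 0 c] unfolding gauss_id .

lemma schwartz_peak:
  assumes "schwartz \<phi>"
  obtains C where "0 \<le> C" "\<And>z. \<bar>(deriv ^^ k) \<phi> z\<bar> \<le> C * peak z"
proof -
  obtain C where C: "0 \<le> C" "\<And>x. (1 + \<bar>x\<bar>) ^ 2 * \<bar>(deriv ^^ k) \<phi> x\<bar> \<le> C" using schwartz_decay[OF assms] by blast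
  have "\<bar>(deriv ^^ k) \<phi> z\<bar> \<le> C * peak z" for z
  proof -
    have "(1 + z\<^sup>2) * \<bar>(deriv ^^ k) \<phi> z\<bar> \<le> (1 + \<bar>z\<bar>) ^ 2 * \<bar>(deriv ^^ k) \<phi> z\<bar>"
      by (intro mult_right_mono square_decay_le) auto
    with C(2)[of z] have "(1 + z\<^sup>2) * \<bar>(deriv ^^ k) \<phi> z\<bar> \<le> C" by linarith
    then show ?thesis unfolding peak_def by (simp add: pos_le_divide_eq add_pos_nonneg mult.commute)
  qed
  with C(1) show thesis by (rule that)
qed

text \<open>Interpolation: the square norm is at most the sup norm times the sum norm, so smallness
  of the sup norm alone makes it small.\<close>

lemma riemann_sum_square_bound:
  fixes F :: "int \<Rightarrow> real"
  assumes n: "0 < (n::real)" and F: "integrable sites F" and S: "\<And>x. \<bar>F x\<bar> \<le> S" and L: "(LINT x|sites. \<bar>F x\<bar>) / n \<le> L"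
  shows "(LINT x|sites. (F x)\<^sup>2) / n \<le> S * L"
proof -
  have S0: "0 \<le> S" using S[of 0] by linarith
  have "(LINT x|sites. (F x)\<^sup>2) \<le> (LINT x|sites. S * \<bar>F x\<bar>)"
  proof (rule integral_mono')
    show "integrable sites (\<lambda>x. S * \<bar>F x\<bar>)" using F by simp
    show "(F x)\<^sup>2 \<le> S * \<bar>F x\<bar>" for x
      using mult_right_mono[OF S[of x], of "\<bar>F x\<bar>"] by (simp add: power2_eq_square)
  qed (use S0 in simp)
  then have "(LINT x|sites. (F x)\<^sup>2) / n \<le> S * ((LINT x|sites. \<bar>F x\<bar>) / n)"
    using n by (simp add: divide_right_mono)
  also have "\<dots> \<le> S * L" by (rule mult_left_mono[OF L S0])
  finally show ?thesis .
qed

text \<open>The normal density is at most 1, and the change of variables yields 1 / sqrt v: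
  smoothing from integrable to bounded functions, the source of decay beyond the diffusive
  scale.\<close>

lemma gauss_sup_bound:
  assumes v: "0 < v" and w: "integrable lborel w"
  shows "\<bar>gauss \<theta> v w x\<bar> \<le> (LINT y|lborel. \<bar>w y\<bar>) / sqrt v"
proof -
  note [measurable] = borel_measurable_integrable[OF w, simplified]
  let ?t = "x + \<theta>"
  have i: "integrable lborel (\<lambda>y. \<bar>w (?t + sqrt v * y)\<bar>)"
    using lborel_integrable_real_affine[OF integrable_abs[OF w], of "sqrt v" ?t] v by simp
  have n1: "std_normal_density y \<le> 1" for y
  proof -
    have "1 \<le> sqrt (2 * pi)" using pi_ge_two by (intro real_le_rsqrt) auto
    moreover have "exp (- y\<^sup>2 / 2) \<le> 1" by simp
    ultimately have "1 / sqrt (2 * pi) * exp (- y\<^sup>2 / 2) \<le> 1 * 1" by (intro mult_mono) auto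
    then show ?thesis by (simp add: std_normal_density_def)
  qed
  have "\<bar>gauss \<theta> v w x\<bar> = \<bar>LINT y|lborel. std_normal_density y * w (?t + sqrt v * y)\<bar>"
    unfolding gauss_def by (subst integral_density) (auto simp: add.assoc)
  also have "\<dots> \<le> (LINT y|lborel. \<bar>std_normal_density y * w (?t + sqrt v * y)\<bar>)" by (rule integral_abs_bound)
  also have "\<dots> \<le> (LINT y|lborel. \<bar>w (?t + sqrt v * y)\<bar>)"
    by (rule integral_mono'[OF i]) (use n1 in \<open>auto simp: abs_mult mult_left_le_one_le\<close>)
  also have "\<dots> = (LINT y|lborel. \<bar>w y\<bar>) / sqrt v"
    using lborel_integral_real_affine[of "sqrt v" "\<lambda>y. \<bar>w y\<bar>" ?t] v by simp
  finally show ?thesis .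
qed

lemma schwartz_taylor:
  assumes "schwartz f"
  shows "\<exists>t. \<bar>t\<bar> \<le> \<bar>x\<bar> \<and> f (z + x) =
     (\<Sum>m<n. (deriv ^^ m) f z / fact m * x ^ m) + (deriv ^^ n) f (z + t) / fact n * x ^ n"
proof -
  have "\<exists>t. \<bar>t\<bar> \<le> \<bar>x\<bar> \<and> (\<lambda>x. f (z + x)) x =
     (\<Sum>m<n. (\<lambda>m t. (deriv ^^ m) f (z + t)) m 0 / fact m * x ^ m) + (\<lambda>m t. (deriv ^^ m) f (z + t)) n t / fact n * x ^ n"
  proof (rule Maclaurin_bi_le)
    have "((\<lambda>t. (deriv ^^ m) f (z + t)) has_real_derivative (deriv ^^ Suc m) f (z + t) * 1) (at t)" for m t
      by (rule DERIV_chain2[OF schwartz_has_derivative[OF assms]]) (auto intro!: derivative_eq_intros)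
    then show "\<forall>m t. m < n \<and> \<bar>t\<bar> \<le> \<bar>x\<bar> \<longrightarrow>
        ((\<lambda>t. (deriv ^^ m) f (z + t)) has_real_derivative (deriv ^^ Suc m) f (z + t)) (at t)"
      by simp
  qed simp
  then show ?thesis by simp
qed

text \<open>In the first central difference the even Taylor terms cancel, in the second one the odd
  terms; the expansion to third order thus bounds both defects by d^3. The cruder bounds serve when
  the time derivative is estimated directly.\<close>

lemma schwartz_differences:
  assumes f: "schwartz f"
  obtains C where "0 \<le> C"
    "\<And>d z. 0 \<le> d \<Longrightarrow> d \<le> 1 \<Longrightarrow> \<bar>f (z - d) - f (z + d)\<bar> \<le> C * d * peak z"
    "\<And>d z. 0 \<le> d \<Longrightarrow> d \<le> 1 \<Longrightarrow> \<bar>f (z - d) - f (z + d) + 2 * d * deriv f z\<bar> \<le> C * d ^ 3 * peak z"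
    "\<And>d z. 0 \<le> d \<Longrightarrow> d \<le> 1 \<Longrightarrow> \<bar>f (z + d) + f (z - d) - 2 * f z\<bar> \<le> C * d\<^sup>2 * peak z"
    "\<And>d z. 0 \<le> d \<Longrightarrow> d \<le> 1 \<Longrightarrow> \<bar>f (z + d) + f (z - d) - 2 * f z - d\<^sup>2 * deriv (deriv f) z\<bar> \<le> C * d ^ 3 * peak z"
    "\<And>z. \<bar>f z\<bar> \<le> C * peak z"
proof -
  have "\<exists>C. \<forall>k\<le>3. \<forall>z. \<bar>(deriv ^^ k) f z\<bar> \<le> C * peak z"
  proof -
    have "\<forall>k. \<exists>C. 0 \<le> C \<and> (\<forall>z. \<bar>(deriv ^^ k) f z\<bar> \<le> C * peak z)"
      using schwartz_peak[OF f] by metis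
    then obtain B where B: "\<And>k. 0 \<le> B k" "\<And>k z. \<bar>(deriv ^^ k) f z\<bar> \<le> B k * peak z" by metis
    have "\<bar>(deriv ^^ k) f z\<bar> \<le> (\<Sum>i\<le>3. B i) * peak z" if "k \<le> 3" for k z
    proof -
      have "B k \<le> (\<Sum>i\<le>3. B i)" by (rule member_le_sum) (use that B in auto)
      then have "B k * peak z \<le> (\<Sum>i\<le>3. B i) * peak z" by (rule mult_right_mono) (simp add: peak_pos less_imp_le)
      with B(2)[of k z] show ?thesis by linarith
    qed
    then show ?thesis by blast
  qed
  then obtain B where B: "\<And>k z. k \<le> 3 \<Longrightarrow> \<bar>(deriv ^^ k) f z\<bar> \<le> B * peak z" by blast
  have B0: "0 \<le> B" using order_trans[OF abs_ge_zero B[of 0 0]] peak_pos[of 0] by (simp add: zero_le_mult_iff)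
  have near: "\<bar>(deriv ^^ k) f (z + t)\<bar> \<le> 3 * B * peak z" if "k \<le> 3" "\<bar>t\<bar> \<le> 1" for k z t
  proof -
    have "\<bar>(deriv ^^ k) f (z + t)\<bar> \<le> B * peak (z + t)" by (rule B[OF that(1)])
    also have "\<dots> \<le> B * (3 * peak z)" by (intro mult_left_mono peak_near B0) (use that in simp)
    finally show ?thesis by simp
  qed
  have remainder: "\<exists>r. \<bar>r\<bar> \<le> 3 * B * peak z \<and> f (z + x) = (\<Sum>m<k. (deriv ^^ m) f z / fact m * x ^ m) + r / fact k * x ^ k"
    if "k \<le> 3" "\<bar>x\<bar> \<le> 1" for k x z
    using schwartz_taylor[OF f, of x z k] near[OF that(1)] that(2) by (meson order_trans)
  \<comment> \<open>Factor 3 for evaluating derivatives within distance 1 of \<open>z\<close>,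
    factor 2 for the two remainders at \<open>z + d\<close> and \<open>z - d\<close>.\<close>
  define C where "C = 6 * B"
  show thesis
  proof (rule that[of C])
    show "0 \<le> C" using B0 by (simp add: C_def)
    show "\<bar>f z\<bar> \<le> C * peak z" for z
      using B[of 0 z] mult_right_mono[of B C "peak z"] B0 peak_pos[of z] by (simp add: C_def)
    fix d z :: real assume d: "0 \<le> d" "d \<le> 1"
    define p where "p = 3 * B * peak z"
    have Cp: "C * peak z = 2 * p" by (simp add: C_def p_def)
    have Cd: "C * x * peak z = 2 * p * x" for x
    proof -
      have "C * x * peak z = (C * peak z) * x" by (simp add: mult_ac)
      then show ?thesis by (simp only: Cp)
    qed
    have scale: "\<bar>r * d ^ k\<bar> \<le> q * d ^ k" if "\<bar>r\<bar> \<le> q" for r q :: real and k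
      using that d by (simp add: abs_mult mult_right_mono)
    { obtain r where r: "\<bar>r\<bar> \<le> p" "f (z + d) = f z + r * d"
        using remainder[of 1 d z] d unfolding p_def by auto
      obtain s where s: "\<bar>s\<bar> \<le> p" "f (z - d) = f z - s * d"
        using remainder[of 1 "- d" z] d unfolding p_def by auto
      have "f (z - d) - f (z + d) = (- s - r) * d ^ 1" unfolding r s by (simp add: algebra_simps)
      moreover have "\<bar>(- s - r) * d ^ 1\<bar> \<le> 2 * p * d ^ 1" by (rule scale) (use r s in linarith)
      ultimately show "\<bar>f (z - d) - f (z + d)\<bar> \<le> C * d * peak z" unfolding Cd by simp }
    { obtain r where r: "\<bar>r\<bar> \<le> p" "f (z + d) = f z + deriv f z * d + r / 2 * d\<^sup>2"
        using remainder[of 2 d z] d unfolding p_def by (auto simp: numeral_2_eq_2)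
      obtain s where s: "\<bar>s\<bar> \<le> p" "f (z - d) = f z - deriv f z * d + s / 2 * d\<^sup>2"
        using remainder[of 2 "- d" z] d unfolding p_def by (auto simp: numeral_2_eq_2)
      have "f (z + d) + f (z - d) - 2 * f z = (r / 2 + s / 2) * d ^ 2" unfolding r s by (simp add: algebra_simps)
      moreover have "\<bar>(r / 2 + s / 2) * d ^ 2\<bar> \<le> 2 * p * d ^ 2" by (rule scale) (use r s in linarith)
      ultimately show "\<bar>f (z + d) + f (z - d) - 2 * f z\<bar> \<le> C * d\<^sup>2 * peak z" unfolding Cd by simp }
    obtain r where r: "\<bar>r\<bar> \<le> p" "f (z + d) = f z + deriv f z * d + deriv (deriv f) z / 2 * d\<^sup>2 + r / 6 * d ^ 3"
      using remainder[of 3 d z] d unfolding p_def by (auto simp: eval_nat_numeral)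
    obtain s where s: "\<bar>s\<bar> \<le> p" "f (z - d) = f z - deriv f z * d + deriv (deriv f) z / 2 * d\<^sup>2 - s / 6 * d ^ 3"
      using remainder[of 3 "- d" z] d unfolding p_def by (auto simp: eval_nat_numeral)
    have "f (z - d) - f (z + d) + 2 * d * deriv f z = (- s / 6 - r / 6) * d ^ 3" unfolding r s by (simp add: algebra_simps)
    moreover have "\<bar>(- s / 6 - r / 6) * d ^ 3\<bar> \<le> 2 * p * d ^ 3" by (rule scale) (use r s in linarith)
    ultimately show "\<bar>f (z - d) - f (z + d) + 2 * d * deriv f z\<bar> \<le> C * d ^ 3 * peak z" unfolding Cd by simp
    have "f (z + d) + f (z - d) - 2 * f z - d\<^sup>2 * deriv (deriv f) z = (r / 6 - s / 6) * d ^ 3" unfolding r s by (simp add: algebra_simps)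
    moreover have "\<bar>(r / 6 - s / 6) * d ^ 3\<bar> \<le> 2 * p * d ^ 3" by (rule scale) (use r s in linarith)
    ultimately show "\<bar>f (z + d) + f (z - d) - 2 * f z - d\<^sup>2 * deriv (deriv f) z\<bar> \<le> C * d ^ 3 * peak z" unfolding Cd by simp
  qed
qed

section \<open>Backward evolution of test functions\<close>

text \<open>The offset \<open>c\<close> carries the moving frame, so that both correlation fields
  sample the same function.\<close>

definition sample :: "real \<Rightarrow> real \<Rightarrow> (real \<Rightarrow> real) \<Rightarrow> int \<Rightarrow> real" where
  "sample n c f x = f (of_int x / n + c)"

definition diff_bound :: "(real \<Rightarrow> real) \<Rightarrow> real \<Rightarrow> bool" where
  "diff_bound f C \<longleftrightarrow> 0 \<le> C \<and> (\<forall>d z. 0 \<le> d \<longrightarrow> d \<le> 1 \<longrightarrow>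
     \<bar>f (z - d) - f (z + d)\<bar> \<le> C * d * peak z \<and>
     \<bar>f (z - d) - f (z + d) + 2 * d * deriv f z\<bar> \<le> C * d ^ 3 * peak z \<and>
     \<bar>f (z + d) + f (z - d) - 2 * f z\<bar> \<le> C * d\<^sup>2 * peak z \<and>
     \<bar>f (z + d) + f (z - d) - 2 * f z - d\<^sup>2 * deriv (deriv f) z\<bar> \<le> C * d ^ 3 * peak z \<and>
     \<bar>f z\<bar> \<le> C * peak z)"

lemma schwartz_diff_bound:
  assumes "schwartz f" obtains C where "diff_bound f C"
  by (rule schwartz_differences[OF assms]) (rule that, unfold diff_bound_def, blast)

definition sample_l2_bound :: "(real \<Rightarrow> real) \<Rightarrow> real \<Rightarrow> bool" where
  "sample_l2_bound h D \<longleftrightarrow> 0 \<le> D \<and> (\<forall>n\<ge>1. (LINT x|sites. (sample n 0 h x)\<^sup>2) / n \<le> D\<^sup>2)"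

lemma sqrt_peak_mass_square: "(C * sqrt (3 * peak_mass))\<^sup>2 = C * (3 * C * peak_mass)"
  using peak_mass_nonneg by (simp add: power2_eq_square)

lemma peak_bound_nonneg: "(\<And>z. \<bar>w z\<bar> \<le> C * peak z) \<Longrightarrow> 0 \<le> C"
  using peak_pos[of 0] order_trans[OF abs_ge_zero, of "w 0" "C * peak 0"] by (simp add: zero_le_mult_iff)

text \<open>The constant is the square root of the sup bound \<open>C\<close> times the sum bound 3
  C times the mass of \<open>peak\<close>.\<close>

lemma gauss_sample_l2:
  assumes n: "1 \<le> (n::real)" and w: "w \<in> borel_measurable borel" "\<And>z. \<bar>w z\<bar> \<le> C * peak z"
  shows "integrable sites (sample n c (gauss \<theta> v w))"
    and "(LINT x|sites. (sample n c (gauss \<theta> v w) x)\<^sup>2) / n \<le> (C * sqrt (3 * peak_mass))\<^sup>2"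
proof -
  have C: "0 \<le> C" by (rule peak_bound_nonneg[OF w(2)])
  have wC: "\<bar>w z\<bar> \<le> C" for z using w(2)[of z] mult_left_mono[OF peak_le_1 C, of z] by simp
  show int: "integrable sites (sample n c (gauss \<theta> v w))"
    unfolding sample_def by (rule gauss_riemann_sum_bound(1)[OF n w(1) C w(2)])
  show "(LINT x|sites. (sample n c (gauss \<theta> v w) x)\<^sup>2) / n \<le> (C * sqrt (3 * peak_mass))\<^sup>2"
    unfolding sqrt_peak_mass_square
    by (rule riemann_sum_square_bound[OF _ int])
       (use n gauss_bound[OF wC] gauss_riemann_sum_bound(2)[OF n w(1) C w(2)] in \<open>auto simp: sample_def\<close>)
qed

lemma sample_l2:
  assumes "1 \<le> (n::real)" "w \<in> borel_measurable borel" "\<And>z. \<bar>w z\<bar> \<le> C * peak z"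
  shows "integrable sites (sample n c w)"
    and "(LINT x|sites. (sample n c w x)\<^sup>2) / n \<le> (C * sqrt (3 * peak_mass))\<^sup>2"
  using gauss_sample_l2[OF assms, of c 0 0] unfolding gauss_id .

lemma schwartz_sample_integrable:
  assumes "schwartz h" "1 \<le> (n::real)" shows "integrable sites (sample n c h)"
proof -
  obtain C where "\<And>z. \<bar>(deriv ^^ 0) h z\<bar> \<le> C * peak z" using schwartz_peak[OF assms(1)] by blast
  then have "\<bar>h z\<bar> \<le> C * peak z" for z by simp
  then show ?thesis by (rule sample_l2(1)[OF assms(2) schwartz_measurable[OF assms(1)]])
qed

lemma schwartz_sample_l2_bound:
  assumes "schwartz h" obtains D where "sample_l2_bound h D"
proof -
  obtain C where C: "0 \<le> C" "\<And>z. \<bar>(deriv ^^ 0) h z\<bar> \<le> C * peak z" using schwartz_peak[OF assms] by blast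
  have "sample_l2_bound h (C * sqrt (3 * peak_mass))"
    unfolding sample_l2_bound_def
    using sample_l2(2)[OF _ schwartz_measurable[OF assms], of _ C] C peak_mass_nonneg by simp
  then show thesis by (rule that)
qed

text \<open>For shifts of any size the loss is quadratic in the shift; this covers the frame
  displacement over a bounded time.\<close>

lemma peak_shift_le: "peak p \<le> 2 * (1 + (p - q)\<^sup>2) * peak q"
proof -
  define e where "e = (p - q)\<^sup>2"
  have "q\<^sup>2 \<le> 2 * p\<^sup>2 + 2 * e"
    unfolding e_def using zero_le_power2[of "2 * p - q"] by (simp add: power2_eq_square algebra_simps)
  moreover have "0 \<le> p\<^sup>2 * e" "0 \<le> e" by (auto simp: e_def)
  moreover have "2 * (1 + e) * (1 + p\<^sup>2) = 2 + 2 * e + 2 * p\<^sup>2 + 2 * (p\<^sup>2 * e)" by (simp add: algebra_simps)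
  ultimately have "1 + q\<^sup>2 \<le> 2 * (1 + e) * (1 + p\<^sup>2)" by linarith
  moreover have "0 < 1 + p\<^sup>2" "0 < 1 + q\<^sup>2" by (auto simp: add_pos_nonneg)
  ultimately show ?thesis unfolding peak_def e_def by (simp add: field_simps)
qed

context lattice_correlation
begin

text \<open>The prefactor 1 / n is shared equally by the two square norms, each of which becomes the
  root of a Riemann sum bounded uniformly in the mesh.\<close>

lemma Q_scaled_bound:
  assumes n: "1 \<le> (n::real)" and \<phi>: "integrable sites \<phi>" "(LINT x|sites. (\<phi> x)\<^sup>2) / n \<le> A\<^sup>2" "0 \<le> A"
    and h: "sample_l2_bound h D" "integrable sites (sample n 0 h)" and t: "0 \<le> t"
  shows "\<bar>Q t \<phi> (sample n 0 h) / n\<bar> \<le> A * D / \<beta>"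
proof -
  let ?g = "sample n 0 h"
  have D: "0 \<le> D" "(LINT x|sites. (?g x)\<^sup>2) / n \<le> D\<^sup>2" using h(1) n by (auto simp: sample_l2_bound_def)
  have n0: "0 < n" using n by simp
  have "sqrt (LINT x|sites. (\<phi> x)\<^sup>2) * sqrt (LINT x|sites. (?g x)\<^sup>2) / n
      = sqrt ((LINT x|sites. (\<phi> x)\<^sup>2) / n) * sqrt ((LINT x|sites. (?g x)\<^sup>2) / n)"
    using n0 by (simp add: real_sqrt_divide)
  also have "\<dots> \<le> A * D"
    using D \<phi> n0 by (intro mult_mono real_le_lsqrt) (auto intro!: divide_nonneg_pos Bochner_Integration.integral_nonneg)
  finally have "sqrt (LINT x|sites. (\<phi> x)\<^sup>2) * sqrt (LINT x|sites. (?g x)\<^sup>2) / n / \<beta> \<le> A * D / \<beta>"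
    using \<beta> by (intro divide_right_mono) auto
  moreover have "\<bar>Q t \<phi> ?g / n\<bar> \<le> sqrt (LINT x|sites. (\<phi> x)\<^sup>2) * sqrt (LINT x|sites. (?g x)\<^sup>2) / \<beta> / n"
    using divide_right_mono[OF Q_bound[OF \<phi>(1) h(2) t], of n] n0 by (simp add: abs_divide)
  ultimately show ?thesis by (simp add: mult.commute)
qed

text \<open>In lattice time and on the mesh \<open>1 / n\<close>, the drift \<open>2\<close> and the diffusivity \<open>lam\<close> of the lattice
  equation become \<open>2 / n\<close> and \<open>lam / n\<^sup>2\<close>. The corresponding flow solves the backward lattice equation
  up to the Taylor remainder \<open>\<rho>\<close>.\<close>

lemma backward_flow:
  assumes n: "1 \<le> (n::real)" and f: "schwartz f" and h: "schwartz h"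
    and C: "diff_bound f C" and D: "sample_l2_bound h D" and \<sigma>: "0 \<le> \<sigma>" "\<sigma> \<le> \<tau>"
  shows "\<bar>Q \<tau> (sample n \<theta> f) (sample n 0 h) / n
     - Q (\<tau> - \<sigma>) (sample n \<theta> (flow (2 / n) (lam / n\<^sup>2) (2 * \<gamma>) \<sigma> f)) (sample n 0 h) / n\<bar>
     \<le> \<sigma> * (C * (1 + lam) / n ^ 3 * sqrt (3 * peak_mass) * D / \<beta>)"
proof -
  let ?S = "flow (2 / n) (lam / n\<^sup>2) (2 * \<gamma>)" and ?G = "gen_adj (2 / n) (lam / n\<^sup>2) (2 * \<gamma>)"
  let ?I = "{\<tau> - \<sigma>..\<tau>}"
  define d where "d = 1 / n"
  have d: "0 \<le> d" "d \<le> 1" using n by (auto simp: d_def)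
  have l: "0 \<le> lam / n\<^sup>2" using lam by simp
  have f1: "schwartz (deriv f)" "schwartz (deriv (deriv f))" by (intro schwartz_deriv f)+
  have Gf: "schwartz (?G f)" by (rule schwartz_gen_adj[OF f])
  \<comment> \<open>Difference between the lattice generator and its continuum counterpart,
    evaluated on \<open>f\<close> itself; the flip terms of the two cancel exactly.\<close>
  define \<rho> where "\<rho> z = (f (z - d) - f (z + d) + 2 * d * deriv f z)
      + lam * (f (z + d) + f (z - d) - 2 * f z - d\<^sup>2 * deriv (deriv f) z)" for z
  have C0: "0 \<le> C" using C by (simp add: diff_bound_def)
  have \<rho>: "\<bar>\<rho> z\<bar> \<le> (C * (1 + lam) / n ^ 3) * peak z" for z
  proof -
    have "\<bar>f (z - d) - f (z + d) + 2 * d * deriv f z\<bar> \<le> C * d ^ 3 * peak z"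
      and "\<bar>f (z + d) + f (z - d) - 2 * f z - d\<^sup>2 * deriv (deriv f) z\<bar> \<le> C * d ^ 3 * peak z"
      using C d unfolding diff_bound_def by blast+
    from add_mono[OF this(1) mult_left_mono[OF this(2) lam]]
    have "\<bar>\<rho> z\<bar> \<le> C * d ^ 3 * peak z + lam * (C * d ^ 3 * peak z)"
      unfolding \<rho>_def using lam by (intro order_trans[OF abs_triangle_ineq]) (simp add: abs_mult)
    also have "\<dots> = (C * (1 + lam) / n ^ 3) * peak z" by (simp add: d_def power_divide algebra_simps add_divide_distrib)
    finally show ?thesis .
  qed
  note [measurable] = schwartz_measurable[OF f] schwartz_measurable[OF f1(1)] schwartz_measurable[OF f1(2)]
  have \<rho>m: "\<rho> \<in> borel_measurable borel" unfolding \<rho>_def by measurable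
  \<comment> \<open>The flow commutes with lattice shifts and derivatives, so the defect at any time
    is the flow of the defect of \<open>f\<close>. It is therefore enough to estimate
    \<open>\<rho>\<close> once.\<close>
  have residual: "?S r \<rho> z = - ?S r (?G f) z + (?S r f (z - d) - ?S r f (z + d) - 2 * \<gamma> * ?S r f z
      + lam * (?S r f (z + d) + ?S r f (z - d) - 2 * ?S r f z))" for r z
  proof -
    let ?e = "exp (- (2 * \<gamma>) * r)" and ?g = "gauss (- (2 / n) * r) (2 * (lam / n\<^sup>2) * r)"
    define p where "p \<phi> a y = \<phi> (z + a + (- (2 / n) * r + sqrt (2 * (lam / n\<^sup>2) * r) * y))"
      for \<phi> :: "real \<Rightarrow> real" and a y
    have i: "integrable std_normal (p \<phi> a)" if "schwartz \<phi>" for \<phi> a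
      unfolding p_def by (rule gauss_integrable[OF that])
    have gp: "(LINT y|std_normal. p \<phi> a y) = ?g \<phi> (z + a)" for \<phi> a
      by (simp add: p_def gauss_def)
    have "?g \<rho> z = (LINT y|std_normal. (p f (- d) y - p f d y + 2 * d * p (deriv f) 0 y)
        + lam * (p f d y + p f (- d) y - 2 * p f 0 y - d\<^sup>2 * p (deriv (deriv f)) 0 y))"
    proof -
      have e: "z + - d + q = z + q - d" "z + d + q = z + q + d" "z + 0 + q = z + q" for q :: real by simp_all
      show ?thesis unfolding gauss_def \<rho>_def p_def e ..
    qed
    also have "\<dots> = ((LINT y|std_normal. p f (- d) y) - (LINT y|std_normal. p f d y) + 2 * d * (LINT y|std_normal. p (deriv f) 0 y))
        + lam * ((LINT y|std_normal. p f d y) + (LINT y|std_normal. p f (- d) y) - 2 * (LINT y|std_normal. p f 0 y)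
          - d\<^sup>2 * (LINT y|std_normal. p (deriv (deriv f)) 0 y))"
      using i[OF f, of "- d"] i[OF f, of d] i[OF f, of 0] i[OF f1(1), of 0] i[OF f1(2), of 0] by simp
    finally have g\<rho>: "?g \<rho> z = (?g f (z - d) - ?g f (z + d) + 2 * d * ?g (deriv f) z)
      + lam * (?g f (z + d) + ?g f (z - d) - 2 * ?g f z - d\<^sup>2 * ?g (deriv (deriv f)) z)"
      unfolding gp by simp
    have gG: "?g (?G f) z = - (2 / n) * ?g (deriv f) z + lam / n\<^sup>2 * ?g (deriv (deriv f)) z - 2 * \<gamma> * ?g f z"
      unfolding gen_adj_def[abs_def] gauss_lincomb[OF schwartz_lincomb(1)[OF f1] f] gauss_lincomb[OF f1] by simp
    show ?thesis
      unfolding flow_def g\<rho> gG by (simp add: d_def power_divide algebra_simps)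
  qed
  \<comment> \<open>These constants may depend on \<open>n\<close> and \<open>\<sigma>\<close>: they
    only supply a summable majorant for differentiating and do not enter the final bound.\<close>
  obtain C1 where C1: "\<And>s x. 0 \<le> s \<Longrightarrow> s \<le> \<sigma> \<Longrightarrow> (1 + \<bar>x\<bar>) ^ 2 * \<bar>?S s f x\<bar> \<le> C1"
    using flow_decay_uniform[OF f l] by metis
  obtain C2 where C2: "\<And>s x. 0 \<le> s \<Longrightarrow> s \<le> \<sigma> \<Longrightarrow> (1 + \<bar>x\<bar>) ^ 2 * \<bar>?S s (?G f) x\<bar> \<le> C2"
    using flow_decay_uniform[OF Gf l] by metis
  have topeak: "\<bar>y\<bar> \<le> max C1 C2 * peak z" if "(1 + \<bar>z\<bar>) ^ 2 * \<bar>y\<bar> \<le> max C1 C2" for y z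
  proof -
    have "(1 + z\<^sup>2) * \<bar>y\<bar> \<le> (1 + \<bar>z\<bar>) ^ 2 * \<bar>y\<bar>" by (intro mult_right_mono square_decay_le) auto
    with that have "(1 + z\<^sup>2) * \<bar>y\<bar> \<le> max C1 C2" by linarith
    then show ?thesis unfolding peak_def by (simp add: pos_le_divide_eq add_pos_nonneg mult.commute)
  qed
  define \<phi> where "\<phi> s = sample n \<theta> (?S (\<tau> - s) f)" for s
  define \<phi>' where "\<phi>' s x = - sample n \<theta> (?S (\<tau> - s) (?G f)) x" for s x
  have hint: "integrable sites (sample n 0 h)" by (rule schwartz_sample_integrable[OF h n])
  have der: "((\<lambda>s. Q s (\<phi> s) (sample n 0 h) / n) has_real_derivative
      Q s (sample n \<theta> (?S (\<tau> - s) \<rho>)) (sample n 0 h) / n) (at s within ?I)" if s: "s \<in> ?I" for s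
  proof -
    have "((\<lambda>s. Q s (\<phi> s) (sample n 0 h)) has_real_derivative
      Q s (\<lambda>x. \<phi>' s x + lattice_adj \<gamma> lam (\<phi> s) x) (sample n 0 h)) (at s within ?I)"
    proof (rule Q_has_derivative[where m = "\<lambda>x. max C1 C2 * peak (of_int x / n + \<theta>)"])
      show "((\<lambda>s. \<phi> s x) has_real_derivative \<phi>' s x) (at s within ?I)" if "s \<in> ?I" for s x
      proof -
        have "((\<lambda>r. ?S r f (of_int x / n + \<theta>)) has_real_derivative ?S (\<tau> - s) (?G f) (of_int x / n + \<theta>))
            (at (\<tau> - s) within (\<lambda>s. \<tau> - s) ` ?I)"
          by (rule DERIV_subset[OF flow_has_derivative[OF f l]]) (use that \<sigma> in auto)
        moreover have "((\<lambda>s. \<tau> - s) has_real_derivative - 1) (at s within ?I)"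
          by (auto intro!: derivative_eq_intros)
        ultimately show ?thesis
          using DERIV_image_chain[of "\<lambda>r. ?S r f (of_int x / n + \<theta>)" _ "\<lambda>s. \<tau> - s" s ?I "- 1"]
          by (simp add: \<phi>_def \<phi>'_def sample_def comp_def)
      qed
      show "\<bar>\<phi> s x\<bar> \<le> max C1 C2 * peak (of_int x / n + \<theta>)" if "s \<in> ?I" for s x
        unfolding \<phi>_def sample_def by (rule topeak, rule max.coboundedI1, rule C1) (use that in auto)
      show "\<bar>\<phi>' s x\<bar> \<le> max C1 C2 * peak (of_int x / n + \<theta>)" if "s \<in> ?I" for s x
        unfolding \<phi>'_def sample_def abs_minus_cancel by (rule topeak, rule max.coboundedI2, rule C2) (use that in auto)
      show "integrable sites (\<lambda>x. max C1 C2 * peak (of_int x / n + \<theta>))"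
        by (intro integrable_mult_right riemann_sum_bound(1)[OF n, of peak 1])
           (auto simp: peak_pos less_imp_le)
    qed (use \<sigma> s hint in auto)
    moreover have "(\<lambda>x. \<phi>' s x + lattice_adj \<gamma> lam (\<phi> s) x) = sample n \<theta> (?S (\<tau> - s) \<rho>)"
    proof
      fix x
      have sh: "of_int (x + 1) / n + \<theta> = of_int x / n + \<theta> + d" "of_int (x - 1) / n + \<theta> = of_int x / n + \<theta> - d"
        by (simp_all add: d_def add_divide_distrib diff_divide_distrib)
      show "\<phi>' s x + lattice_adj \<gamma> lam (\<phi> s) x = sample n \<theta> (?S (\<tau> - s) \<rho>) x"
        unfolding lattice_adj_def \<phi>'_def \<phi>_def sample_def residual sh by simp
    qed
    ultimately show ?thesis by (intro DERIV_cdivide) simp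
  qed
  let ?B = "C * (1 + lam) / n ^ 3 * sqrt (3 * peak_mass) * D / \<beta>"
  have "norm (Q \<tau> (\<phi> \<tau>) (sample n 0 h) / n - Q (\<tau> - \<sigma>) (\<phi> (\<tau> - \<sigma>)) (sample n 0 h) / n) \<le> ?B * norm (\<tau> - (\<tau> - \<sigma>))"
  proof (rule field_differentiable_bound[OF _ der])
    fix s assume s: "s \<in> ?I"
    let ?c = "exp (- (2 * \<gamma>) * (\<tau> - s))"
    \<comment> \<open>Damping only helps, as \<open>\<gamma>\<close> is nonnegative; with the
      drift-independent Gaussian bound this makes the estimate the same at all intermediate
      times.\<close>
    have c: "0 \<le> ?c" "?c \<le> 1" using \<gamma> s by auto
    have eq: "sample n \<theta> (?S (\<tau> - s) \<rho>) x = ?c * sample n \<theta> (gauss (- (2 / n) * (\<tau> - s)) (2 * (lam / n\<^sup>2) * (\<tau> - s)) \<rho>) x" for x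
      by (simp add: sample_def flow_def)
    note gl = gauss_sample_l2[OF n \<rho>m \<rho>, where c = \<theta> and \<theta> = "- (2 / n) * (\<tau> - s)" and v = "2 * (lam / n\<^sup>2) * (\<tau> - s)"]
    have "(LINT x|sites. (sample n \<theta> (?S (\<tau> - s) \<rho>) x)\<^sup>2) / n \<le> (C * (1 + lam) / n ^ 3 * sqrt (3 * peak_mass))\<^sup>2"
    proof -
      have "(LINT x|sites. (sample n \<theta> (?S (\<tau> - s) \<rho>) x)\<^sup>2) / n
          = ?c\<^sup>2 * ((LINT x|sites. (sample n \<theta> (gauss (- (2 / n) * (\<tau> - s)) (2 * (lam / n\<^sup>2) * (\<tau> - s)) \<rho>) x)\<^sup>2) / n)"
        unfolding eq by (simp add: power_mult_distrib)
      also have "\<dots> \<le> 1 * (C * (1 + lam) / n ^ 3 * sqrt (3 * peak_mass))\<^sup>2"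
        using c gl(2) n by (intro mult_mono power_le_one) (auto intro!: divide_nonneg_pos Bochner_Integration.integral_nonneg)
      finally show ?thesis by simp
    qed
    moreover have "integrable sites (sample n \<theta> (?S (\<tau> - s) \<rho>))"
      unfolding eq[abs_def] by (intro integrable_mult_right gl(1))
    ultimately show "norm (Q s (sample n \<theta> (?S (\<tau> - s) \<rho>)) (sample n 0 h) / n) \<le> ?B"
      unfolding real_norm_def
      by (intro Q_scaled_bound[OF n _ _ _ D hint]) (use s \<sigma> C0 lam n peak_mass_nonneg in auto)
  qed (use \<sigma> in auto)
  moreover have "\<phi> \<tau> = sample n \<theta> f" "\<phi> (\<tau> - \<sigma>) = sample n \<theta> (?S \<sigma> f)"
    by (simp_all add: \<phi>_def flow_0)
  ultimately show ?thesis using \<sigma> by (simp add: mult.commute)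
qed

text \<open>\<open>\<epsilon>\<close> is the speed of the frame in lattice time: 0 for the fixed
  frame, and 2 / n for the moving one, where its transport term cancels the leading part of the
  central difference. \<open>E\<close> measures what is left of the drift.\<close>

lemma time_derivative_bound:
  assumes n: "1 \<le> (n::real)" and f: "schwartz f" and h: "schwartz h"
    and C: "diff_bound f C" and D: "sample_l2_bound h D" and \<tau>: "0 < \<tau>"
    and E: "0 \<le> E" "\<And>z. \<bar>f (z - 1 / n) - f (z + 1 / n) + \<epsilon> * deriv f z\<bar> \<le> E * peak z"
  shows "\<exists>R. ((\<lambda>s. Q s (sample n (\<epsilon> * s) f) (sample n 0 h) / n) has_real_derivative R) (at \<tau>)
     \<and> \<bar>R\<bar> \<le> (E + 2 * \<gamma> * C + lam * C / n\<^sup>2) * sqrt (3 * peak_mass) * D / \<beta>"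
proof -
  define d where "d = 1 / n"
  have d: "0 \<le> d" "d \<le> 1" using n by (auto simp: d_def)
  have f1: "schwartz (deriv f)" by (rule schwartz_deriv[OF f])
  have C0: "0 \<le> C" using C by (simp add: diff_bound_def)
  define \<psi> where "\<psi> z = (f (z - d) - f (z + d) + \<epsilon> * deriv f z) + - (2 * \<gamma> * f z) + lam * (f (z + d) + f (z - d) - 2 * f z)" for z
  let ?B = "E + 2 * \<gamma> * C + lam * C / n\<^sup>2"
  have \<psi>: "\<bar>\<psi> z\<bar> \<le> ?B * peak z" for z
  proof -
    have a: "\<bar>f (z + d) + f (z - d) - 2 * f z\<bar> \<le> C * d\<^sup>2 * peak z" and b: "\<bar>f z\<bar> \<le> C * peak z"
      using C d unfolding diff_bound_def by blast+
    have c: "\<bar>f (z - d) - f (z + d) + \<epsilon> * deriv f z\<bar> \<le> E * peak z" using E(2) by (simp add: d_def)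
    have b': "\<bar>- (2 * \<gamma> * f z)\<bar> \<le> 2 * \<gamma> * (C * peak z)"
      using mult_left_mono[OF b, of "2 * \<gamma>"] \<gamma> by (simp add: abs_mult)
    have a': "\<bar>lam * (f (z + d) + f (z - d) - 2 * f z)\<bar> \<le> lam * (C * d\<^sup>2 * peak z)"
      using mult_left_mono[OF a lam] lam by (simp add: abs_mult)
    have "\<bar>\<psi> z\<bar> \<le> E * peak z + 2 * \<gamma> * (C * peak z) + lam * (C * d\<^sup>2 * peak z)"
      unfolding \<psi>_def by (intro order_trans[OF abs_triangle_ineq] add_mono a' b' c)
    also have "\<dots> = ?B * peak z" by (simp add: d_def power_divide algebra_simps)
    finally show ?thesis .
  qed
  note [measurable] = schwartz_measurable[OF f] schwartz_measurable[OF f1]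
  have \<psi>m: "\<psi> \<in> borel_measurable borel" unfolding \<psi>_def by measurable
  obtain C1 where C1: "0 \<le> C1" "\<And>z. \<bar>(deriv ^^ 1) f z\<bar> \<le> C1 * peak z" using schwartz_peak[OF f] by blast
  have fC: "\<bar>f z\<bar> \<le> C * peak z" for z using C d by (auto simp: diff_bound_def)
  \<comment> \<open>A neighbourhood of \<open>\<tau>\<close> on which the frame moves by a bounded
    amount, so that one summable majorant suffices.\<close>
  let ?S = "{0..2 * \<tau>}"
  define A where "A = 2 * (1 + (\<epsilon> * (2 * \<tau>))\<^sup>2)"
  have pk: "peak (z + \<epsilon> * s) \<le> A * peak z" if "s \<in> ?S" for s z
  proof -
    have "peak (z + \<epsilon> * s) \<le> 2 * (1 + (\<epsilon> * s)\<^sup>2) * peak z" using peak_shift_le[of "z + \<epsilon> * s" z] by simp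
    also have "\<dots> \<le> A * peak z"
    proof -
      have "(\<epsilon> * s)\<^sup>2 \<le> (\<epsilon> * (2 * \<tau>))\<^sup>2"
        unfolding power_mult_distrib[of \<epsilon>] by (intro mult_left_mono power_mono) (use that in auto)
      then show ?thesis unfolding A_def using peak_pos[of z]
        by (intro mult_right_mono mult_left_mono add_left_mono) auto
    qed
    finally show ?thesis .
  qed
  define m where "m x = (C + \<bar>\<epsilon>\<bar> * C1) * (A * peak (of_int x / n))" for x :: int
  define \<phi>' where "\<phi>' s x = \<epsilon> * sample n (\<epsilon> * s) (deriv f) x" for s x
  have hint: "integrable sites (sample n 0 h)" by (rule schwartz_sample_integrable[OF h n])
  have "((\<lambda>s. Q s (sample n (\<epsilon> * s) f) (sample n 0 h)) has_real_derivative
      Q \<tau> (\<lambda>x. \<phi>' \<tau> x + lattice_adj \<gamma> lam (sample n (\<epsilon> * \<tau>) f) x) (sample n 0 h)) (at \<tau> within ?S)"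
  proof (rule Q_has_derivative[where m = m])
    show "((\<lambda>s. sample n (\<epsilon> * s) f x) has_real_derivative \<phi>' s x) (at s within ?S)" for s x
    proof -
      have "((\<lambda>s. of_int x / n + \<epsilon> * s) has_real_derivative \<epsilon>) (at s within ?S)"
        by (auto intro!: derivative_eq_intros)
      from DERIV_chain2[OF schwartz_has_deriv[OF f] this] show ?thesis
        by (simp add: sample_def \<phi>'_def mult.commute)
    qed
    have A0: "0 \<le> A" by (simp add: A_def)
    show "\<bar>sample n (\<epsilon> * s) f x\<bar> \<le> m x" if "s \<in> ?S" for s x
    proof -
      have "\<bar>sample n (\<epsilon> * s) f x\<bar> \<le> C * peak (of_int x / n + \<epsilon> * s)" unfolding sample_def by (rule fC)
      also have "\<dots> \<le> (C + \<bar>\<epsilon>\<bar> * C1) * (A * peak (of_int x / n))"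
        using C0 C1(1) A0 pk[OF that] peak_pos by (intro mult_mono) (auto simp: less_imp_le)
      finally show ?thesis by (simp add: m_def)
    qed
    show "\<bar>\<phi>' s x\<bar> \<le> m x" if "s \<in> ?S" for s x
    proof -
      have "\<bar>\<phi>' s x\<bar> \<le> \<bar>\<epsilon>\<bar> * (C1 * peak (of_int x / n + \<epsilon> * s))"
        unfolding \<phi>'_def sample_def abs_mult using C1(2) by (intro mult_left_mono) auto
      also have "\<dots> = (\<bar>\<epsilon>\<bar> * C1) * peak (of_int x / n + \<epsilon> * s)" by simp
      also have "\<dots> \<le> (C + \<bar>\<epsilon>\<bar> * C1) * (A * peak (of_int x / n))"
        using C0 C1(1) A0 pk[OF that] peak_pos by (intro mult_mono) (auto simp: less_imp_le)
      finally show ?thesis by (simp add: m_def)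
    qed
    show "integrable sites m"
      unfolding m_def using riemann_sum_bound(1)[OF n, of peak 1 0]
      by (intro integrable_mult_right) (auto simp: peak_pos less_imp_le)
  qed (use \<tau> hint in auto)
  moreover have "(\<lambda>x. \<phi>' \<tau> x + lattice_adj \<gamma> lam (sample n (\<epsilon> * \<tau>) f) x) = sample n (\<epsilon> * \<tau>) \<psi>"
  proof
    fix x
    have sh: "of_int (x + 1) / n + \<epsilon> * \<tau> = of_int x / n + \<epsilon> * \<tau> + d" "of_int (x - 1) / n + \<epsilon> * \<tau> = of_int x / n + \<epsilon> * \<tau> - d"
      by (simp_all add: d_def add_divide_distrib diff_divide_distrib)
    show "\<phi>' \<tau> x + lattice_adj \<gamma> lam (sample n (\<epsilon> * \<tau>) f) x = sample n (\<epsilon> * \<tau>) \<psi> x"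
      unfolding lattice_adj_def \<phi>'_def sample_def \<psi>_def sh by simp
  qed
  moreover have "at \<tau> within ?S = at \<tau>"
    by (rule at_within_open_subset[of _ "{0<..<2 * \<tau>}"]) (use \<tau> in auto)
  ultimately have "((\<lambda>s. Q s (sample n (\<epsilon> * s) f) (sample n 0 h) / n) has_real_derivative
      Q \<tau> (sample n (\<epsilon> * \<tau>) \<psi>) (sample n 0 h) / n) (at \<tau>)"
    by (intro DERIV_cdivide) simp
  moreover have "\<bar>Q \<tau> (sample n (\<epsilon> * \<tau>) \<psi>) (sample n 0 h) / n\<bar> \<le> ?B * sqrt (3 * peak_mass) * D / \<beta>"
    using sample_l2[OF n \<psi>m \<psi>] \<tau> C0 E(1) lam \<gamma> peak_mass_nonneg
    by (intro Q_scaled_bound[OF n _ _ _ D hint]) auto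
  ultimately show ?thesis by blast
qed

end

section \<open>Limits of the correlation field\<close>

lemma gauss_recenter: "gauss \<theta> v f (x + c) = gauss (\<theta> + c) v f x"
  by (simp add: gauss_def add_ac)

lemma riemann_sum_limit:
  assumes f: "schwartz f" and h: "schwartz h" and lim: "\<theta> \<longlonglongrightarrow> \<theta>'" "v \<longlonglongrightarrow> v'"
  shows "(\<lambda>n. (LINT x|sites. gauss (\<theta> n) (v n) f (of_int x / real n) * h (of_int x / real n)) / real n)
     \<longlonglongrightarrow> (LINT y|lborel. gauss \<theta>' v' f y * h y)"
  \<comment> \<open>Passing to \<open>Suc n\<close> discards n = 0, where the rescaled grid
    degenerates because division by zero gives 0.\<close>
  unfolding filterlim_sequentially_Suc[symmetric, of "\<lambda>n. (LINT x|sites. gauss (\<theta> n) (v n) f (of_int x / real n) * h (of_int x / real n)) / real n"]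
proof -
  obtain B where B: "0 \<le> B" "\<And>x. \<bar>f x\<bar> \<le> B" using schwartz_bounded[OF f] by blast
  obtain C where C: "0 \<le> C" "\<And>z. \<bar>(deriv ^^ 0) h z\<bar> \<le> C * peak z" using schwartz_peak[OF h] by blast
  note [measurable] = schwartz_measurable[OF h] schwartz_measurable[OF f]
  have gm [measurable]: "gauss \<theta> v f \<in> borel_measurable borel" for \<theta> v
    by (rule schwartz_measurable[OF schwartz_gauss[OF f]])
  let ?p = "\<lambda>n y. of_int \<lfloor>real (Suc n) * y\<rfloor> / real (Suc n)"
  have near: "\<bar>?p n y - y\<bar> \<le> 1 / real (Suc n)" "1 / real (Suc n) \<le> 1" for n y
    by (rule floor_near(1), simp) simp
  have p: "(\<lambda>n. ?p n y) \<longlonglongrightarrow> y" for y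
  proof (rule LIM_zero_cancel, rule Lim_null_comparison)
    show "\<forall>\<^sub>F n in sequentially. norm (?p n y - y) \<le> 1 / real (Suc n)" using near(1) by (intro always_eventually allI) simp
    show "(\<lambda>n. 1 / real (Suc n)) \<longlonglongrightarrow> 0" using LIMSEQ_inverse_real_of_nat by (simp add: inverse_eq_divide)
  qed
  have "(\<lambda>n. LINT y|lborel. gauss (\<theta> (Suc n)) (v (Suc n)) f (?p n y) * h (?p n y))
      \<longlonglongrightarrow> (LINT y|lborel. gauss \<theta>' v' f y * h y)"
  proof (rule integral_dominated_convergence[where w = "\<lambda>y. B * (3 * C * peak (y + 0))"])
    show "integrable lborel (\<lambda>y. B * (3 * C * peak (y + 0)))"
      by (intro integrable_mult_right peak_integrable)
    show "AE y in lborel. (\<lambda>n. gauss (\<theta> (Suc n)) (v (Suc n)) f (?p n y) * h (?p n y)) \<longlonglongrightarrow> gauss \<theta>' v' f y * h y"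
    proof (intro AE_I2 tendsto_mult)
      fix y
      \<comment> \<open>The moving evaluation point is absorbed into the drift, so one continuity
        statement covers point, drift and variance together.\<close>
      have "(\<lambda>n. gauss (\<theta> (Suc n) + ?p n y) (v (Suc n)) f 0) \<longlonglongrightarrow> gauss (\<theta>' + y) v' f 0"
        using lim by (intro gauss_tendsto[where C = B] schwartz_isCont[OF f] B tendsto_add p) (simp_all add: filterlim_sequentially_Suc)
      then show "(\<lambda>n. gauss (\<theta> (Suc n)) (v (Suc n)) f (?p n y)) \<longlonglongrightarrow> gauss \<theta>' v' f y"
        by (simp flip: gauss_recenter)
      show "(\<lambda>n. h (?p n y)) \<longlonglongrightarrow> h y" by (rule isCont_tendsto_compose[OF schwartz_isCont[OF h] p])
    qed
    show "AE y in lborel. norm (gauss (\<theta> (Suc n)) (v (Suc n)) f (?p n y) * h (?p n y)) \<le> B * (3 * C * peak (y + 0))" for n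
    proof (rule AE_I2)
      fix y
      have "\<bar>h (?p n y)\<bar> \<le> C * peak (?p n y)" using C(2)[of "?p n y"] by simp
      also have "\<dots> \<le> C * (3 * peak y)"
        using near(1)[of n y] near(2)[of n] by (intro mult_left_mono peak_near C(1)) linarith
      finally have "\<bar>gauss (\<theta> (Suc n)) (v (Suc n)) f (?p n y)\<bar> * \<bar>h (?p n y)\<bar> \<le> B * (3 * C * peak y)"
        by (intro mult_mono gauss_bound B) simp_all
      then show "norm (gauss (\<theta> (Suc n)) (v (Suc n)) f (?p n y) * h (?p n y)) \<le> B * (3 * C * peak (y + 0))"
        by (simp add: abs_mult)
    qed
  qed measurable
  moreover have "(LINT x|sites. gauss (\<theta> (Suc n)) (v (Suc n)) f (of_int x / real (Suc n)) * h (of_int x / real (Suc n))) / real (Suc n)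
      = (LINT y|lborel. gauss (\<theta> (Suc n)) (v (Suc n)) f (?p n y) * h (?p n y))" for n
    by (rule riemann_sum_eq_integral(2)) simp
  ultimately show "(\<lambda>n. (LINT x|sites. gauss (\<theta> (Suc n)) (v (Suc n)) f (of_int x / real (Suc n)) * h (of_int x / real (Suc n))) / real (Suc n))
     \<longlonglongrightarrow> (LINT y|lborel. gauss \<theta>' v' f y * h y)"
    by simp
qed

text \<open>Fubini identifies the limit of the Riemann sums with a Gaussian average of the
  correlation function at the origin, which is how the fundamental solution acts in
  \<open>dist_pairing\<close>.\<close>

lemma gauss_correlation:
  assumes f: "schwartz f" and h: "schwartz h"
  shows "(LINT y|lborel. gauss \<theta> v f y * h y) = gauss \<theta> v (\<lambda>x. LINT y|lborel. f (y + x) * h y) 0"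
proof -
  interpret p: prob_space std_normal by (rule prob_space_std_normal)
  interpret pair_sigma_finite std_normal lborel
    by (rule pair_sigma_finite.intro) (rule p.sigma_finite_measure_axioms, rule sigma_finite_lborel)
  obtain B where B: "0 \<le> B" "\<And>x. \<bar>f x\<bar> \<le> B" using schwartz_bounded[OF f] by blast
  note [measurable] = schwartz_measurable[OF h] schwartz_measurable[OF f]
  let ?F = "\<lambda>z y. f (y + (\<theta> + sqrt v * z)) * h y"
  have bd: "norm (?F z y) \<le> B * \<bar>h y\<bar>" for z y
    using B(2)[of "y + (\<theta> + sqrt v * z)"] by (simp add: abs_mult mult_right_mono)
  have ih: "integrable lborel (\<lambda>y. B * \<bar>h y\<bar>)" using schwartz_integrable[OF h] by simp
  have iF: "integrable lborel (?F z)" for z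
    by (rule Bochner_Integration.integrable_bound[OF ih]) (use bd B in \<open>auto simp: abs_mult\<close>)
  have "integrable (std_normal \<Otimes>\<^sub>M lborel) (\<lambda>(z, y). ?F z y)"
  proof (rule Fubini_integrable)
    have "\<bar>LINT y|lborel. norm (?F z y)\<bar> \<le> (LINT y|lborel. B * \<bar>h y\<bar>)" for z
    proof -
      have "(LINT y|lborel. norm (?F z y)) \<le> (LINT y|lborel. B * \<bar>h y\<bar>)"
        by (rule integral_mono'[OF ih]) (use bd B in auto)
      moreover have "0 \<le> (LINT y|lborel. norm (?F z y))" by simp
      ultimately show ?thesis by simp
    qed
    then show "integrable std_normal (\<lambda>z. LINT y|lborel. norm (case (z, y) of (z, y) \<Rightarrow> ?F z y))"
      by (intro p.integrable_const_bound[where B = "LINT y|lborel. B * \<bar>h y\<bar>"]) auto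
    show "AE z in std_normal. integrable lborel (\<lambda>y. case (z, y) of (z, y) \<Rightarrow> ?F z y)"
      using iF by (intro AE_I2) simp
  qed measurable
  from Fubini_integral[OF this] show ?thesis
    by (simp add: gauss_def)
qed

context
  fixes \<beta> lam :: real and \<gamma> :: "nat \<Rightarrow> real" and u :: "nat \<Rightarrow> real \<Rightarrow> int \<Rightarrow> int \<Rightarrow> real"
    and f h :: "real \<Rightarrow> real" and \<tau> \<theta> :: "nat \<Rightarrow> real"
  assumes L: "\<And>n. n \<ge> 1 \<Longrightarrow> lattice_correlation \<beta> (\<gamma> n) lam (u n)"
    and f: "schwartz f" and h: "schwartz h" and \<tau>: "\<And>n. 0 \<le> \<tau> n"
begin

text \<open>Common form of both correlation fields at lattice time \<open>\<tau> n\<close>; the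
  offset \<open>\<theta> n\<close> is 0 in the fixed frame and 2 \<open>\<tau> n\<close> / n in the
  moving one.\<close>

definition field_corr :: "nat \<Rightarrow> real" where
  "field_corr n = lattice_correlation.Q (u n) (\<tau> n) (sample (real n) (\<theta> n) f) (sample (real n) 0 h) / real n"

text \<open>The test function is carried back all the way to time 0, where the covariance is
  diagonal. The last three limits are those of total damping, net displacement and accumulated
  variance.\<close>

lemma field_corr_tendsto:
  assumes t3: "(\<lambda>n. \<tau> n / real n ^ 3) \<longlonglongrightarrow> 0"
    and \<kappa>: "(\<lambda>n. 2 * \<gamma> n * \<tau> n) \<longlonglongrightarrow> \<kappa>" and shift: "(\<lambda>n. \<theta> n - 2 * \<tau> n / real n) \<longlonglongrightarrow> \<theta>'"
    and v: "(\<lambda>n. 2 * lam * \<tau> n / (real n)\<^sup>2) \<longlonglongrightarrow> v'"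
  shows "field_corr \<longlonglongrightarrow> 1 / \<beta> * (exp (- \<kappa>) * (LINT y|lborel. gauss \<theta>' v' f y * h y))"
proof -
  obtain C where C: "diff_bound f C" by (rule schwartz_diff_bound[OF f])
  obtain D where D: "sample_l2_bound h D" by (rule schwartz_sample_l2_bound[OF h])
  let ?R = "\<lambda>n. (LINT x|sites. gauss (\<theta> n - 2 * \<tau> n / real n) (2 * lam * \<tau> n / (real n)\<^sup>2) f (of_int x / real n) * h (of_int x / real n)) / real n"
  let ?A = "\<lambda>n. 1 / \<beta> * (exp (- (2 * \<gamma> n * \<tau> n)) * ?R n)"
  have A: "?A \<longlonglongrightarrow> 1 / \<beta> * (exp (- \<kappa>) * (LINT y|lborel. gauss \<theta>' v' f y * h y))"
    by (intro tendsto_mult tendsto_const tendsto_exp tendsto_minus \<kappa> riemann_sum_limit f h shift v)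
  let ?E = "\<lambda>n. (\<tau> n / real n ^ 3) * (C * (1 + lam) * sqrt (3 * peak_mass) * D / \<beta>)"
  have E: "?E \<longlonglongrightarrow> 0" by (rule tendsto_mult_left_zero[OF t3])
  have "\<forall>\<^sub>F n in sequentially. norm (field_corr n - ?A n) \<le> ?E n"
  proof (rule eventually_sequentiallyI[of 1])
    fix n :: nat assume n: "1 \<le> n"
    interpret lattice_correlation \<beta> "\<gamma> n" lam "u n" by (rule L[OF n])
    have n1: "1 \<le> real n" using n by simp
    have "sample (real n) (\<theta> n) (flow (2 / real n) (lam / (real n)\<^sup>2) (2 * \<gamma> n) (\<tau> n) f) x * sample (real n) 0 h x
      = exp (- (2 * \<gamma> n * \<tau> n)) * (gauss (\<theta> n - 2 * \<tau> n / real n) (2 * lam * \<tau> n / (real n)\<^sup>2) f (of_int x / real n) * h (of_int x / real n))" for x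
      using gauss_recenter[of "- (2 * \<tau> n / real n)" "2 * lam * \<tau> n / (real n)\<^sup>2" f "of_int x / real n" "\<theta> n"]
      by (simp add: sample_def flow_def)
    then have "Q 0 (sample (real n) (\<theta> n) (flow (2 / real n) (lam / (real n)\<^sup>2) (2 * \<gamma> n) (\<tau> n) f)) (sample (real n) 0 h) / real n = ?A n"
      unfolding Q_at_0 by simp
    then show "norm (field_corr n - ?A n) \<le> ?E n"
      using backward_flow[OF n1 f h C D \<tau> order_refl, of n "\<theta> n"]
      by (simp add: field_corr_def)
  qed
  from Lim_null_comparison[OF this E] have "(\<lambda>n. field_corr n - ?A n) \<longlonglongrightarrow> 0" .
  from tendsto_add[OF this A] show ?thesis by simp
qed

lemma field_corr_decay:
  assumes \<sigma>: "\<And>n. 0 \<le> \<sigma> n" "\<And>n. n \<ge> 1 \<Longrightarrow> \<sigma> n \<le> \<tau> n" and s3: "(\<lambda>n. \<sigma> n / real n ^ 3) \<longlonglongrightarrow> 0"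
    and A: "A \<longlonglongrightarrow> 0" "\<And>n. 0 \<le> A n" "\<And>n. n \<ge> 1 \<Longrightarrow>
      (LINT x|sites. (sample (real n) (\<theta> n) (flow (2 / real n) (lam / (real n)\<^sup>2) (2 * \<gamma> n) (\<sigma> n) f) x)\<^sup>2) / real n \<le> (A n)\<^sup>2"
  shows "field_corr \<longlonglongrightarrow> 0"
proof -
  obtain C where C: "diff_bound f C" by (rule schwartz_diff_bound[OF f])
  obtain D where D: "sample_l2_bound h D" by (rule schwartz_sample_l2_bound[OF h])
  let ?E = "\<lambda>n. (\<sigma> n / real n ^ 3) * (C * (1 + lam) * sqrt (3 * peak_mass) * D / \<beta>) + A n * D / \<beta>"
  have "?E \<longlonglongrightarrow> 0 * (C * (1 + lam) * sqrt (3 * peak_mass) * D / \<beta>) + 0 * D / \<beta>"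
    unfolding divide_inverse[of _ \<beta>] by (intro tendsto_intros s3 A)
  then have E: "?E \<longlonglongrightarrow> 0" by simp
  have "\<forall>\<^sub>F n in sequentially. norm (field_corr n) \<le> ?E n"
  proof (rule eventually_sequentiallyI[of 1])
    fix n :: nat assume n: "1 \<le> n"
    interpret lattice_correlation \<beta> "\<gamma> n" lam "u n" by (rule L[OF n])
    have n1: "1 \<le> real n" using n by simp
    let ?\<phi> = "sample (real n) (\<theta> n) (flow (2 / real n) (lam / (real n)\<^sup>2) (2 * \<gamma> n) (\<sigma> n) f)"
    have "\<bar>Q (\<tau> n - \<sigma> n) ?\<phi> (sample (real n) 0 h) / real n\<bar> \<le> A n * D / \<beta>"
      using n1 A \<sigma>(2) n D
      by (intro Q_scaled_bound schwartz_sample_integrable schwartz_flow f h) auto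
    moreover have "\<sigma> n * (C * (1 + lam) / real n ^ 3 * sqrt (3 * peak_mass) * D / \<beta>)
        = (\<sigma> n / real n ^ 3) * (C * (1 + lam) * sqrt (3 * peak_mass) * D / \<beta>)" by simp
    ultimately show "norm (field_corr n) \<le> ?E n"
      using backward_flow[OF n1 f h C D \<sigma>(1)[of n] \<sigma>(2)[OF n], of "\<theta> n"]
      unfolding field_corr_def real_norm_def by linarith
  qed
  from Lim_null_comparison[OF this E] show ?thesis .
qed

text \<open>The spatial average is bounded in square norm uniformly in drift and variance, so the
  diverging damping alone drives the transported function to zero.\<close>

lemma field_corr_flip_decay:
  assumes \<sigma>: "\<And>n. 0 \<le> \<sigma> n" "\<And>n. n \<ge> 1 \<Longrightarrow> \<sigma> n \<le> \<tau> n" and s3: "(\<lambda>n. \<sigma> n / real n ^ 3) \<longlonglongrightarrow> 0"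
    and inf: "filterlim (\<lambda>n. \<gamma> n * \<sigma> n) at_top sequentially"
  shows "field_corr \<longlonglongrightarrow> 0"
proof -
  obtain C where C: "0 \<le> C" "\<And>z. \<bar>(deriv ^^ 0) f z\<bar> \<le> C * peak z" using schwartz_peak[OF f] by blast
  then have C': "\<And>z. \<bar>f z\<bar> \<le> C * peak z" by simp
  let ?e = "\<lambda>n. exp (- (2 * (\<gamma> n * \<sigma> n)))"
  show ?thesis
  proof (rule field_corr_decay[OF \<sigma> s3, where A = "\<lambda>n. ?e n * (C * sqrt (3 * peak_mass))"])
    have "filterlim (\<lambda>n. 2 * (\<gamma> n * \<sigma> n)) at_top sequentially"
      by (rule filterlim_tendsto_pos_mult_at_top[OF tendsto_const _ inf]) simp
    then have "filterlim (\<lambda>n. - (2 * (\<gamma> n * \<sigma> n))) at_bot sequentially"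
      by (simp add: filterlim_uminus_at_bot)
    then have "?e \<longlonglongrightarrow> 0" by (rule filterlim_compose[OF exp_at_bot])
    from tendsto_mult_left_zero[OF this] show "(\<lambda>n. ?e n * (C * sqrt (3 * peak_mass))) \<longlonglongrightarrow> 0" .
    show "0 \<le> ?e n * (C * sqrt (3 * peak_mass))" for n using C peak_mass_nonneg by simp
    fix n :: nat assume n: "1 \<le> n"
    then have n1: "1 \<le> real n" by simp
    note gl = gauss_sample_l2(2)[OF n1 schwartz_measurable[OF f] C', of "\<theta> n" "- (2 / real n) * \<sigma> n" "2 * (lam / (real n)\<^sup>2) * \<sigma> n"]
    have eq: "sample (real n) (\<theta> n) (flow (2 / real n) (lam / (real n)\<^sup>2) (2 * \<gamma> n) (\<sigma> n) f) x
      = ?e n * sample (real n) (\<theta> n) (gauss (- (2 / real n) * \<sigma> n) (2 * (lam / (real n)\<^sup>2) * \<sigma> n) f) x" for x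
      by (simp add: sample_def flow_def mult.assoc)
    show "(LINT x|sites. (sample (real n) (\<theta> n) (flow (2 / real n) (lam / (real n)\<^sup>2) (2 * \<gamma> n) (\<sigma> n) f) x)\<^sup>2) / real n
        \<le> (?e n * (C * sqrt (3 * peak_mass)))\<^sup>2"
      using mult_left_mono[OF gl, of "(?e n)\<^sup>2"] unfolding eq power_mult_distrib[of "?e n"] by simp
  qed
qed

text \<open>Spreading replaces damping: the sup norm decays like the inverse root of the variance
  while the sum norm stays bounded, hence the square norm vanishes.\<close>

lemma field_corr_exchange_decay:
  assumes \<sigma>: "\<And>n. 0 \<le> \<sigma> n" "\<And>n. n \<ge> 1 \<Longrightarrow> \<sigma> n \<le> \<tau> n" "\<And>n. n \<ge> 1 \<Longrightarrow> 0 < \<sigma> n"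
    and s3: "(\<lambda>n. \<sigma> n / real n ^ 3) \<longlonglongrightarrow> 0" and lam_pos: "0 < lam"
    and inf: "filterlim (\<lambda>n. 2 * (lam / (real n)\<^sup>2) * \<sigma> n) at_top sequentially"
  shows "field_corr \<longlonglongrightarrow> 0"
proof -
  obtain C where C: "0 \<le> C" "\<And>z. \<bar>(deriv ^^ 0) f z\<bar> \<le> C * peak z" using schwartz_peak[OF f] by blast
  then have C': "\<And>z. \<bar>f z\<bar> \<le> C * peak z" by simp
  let ?v = "\<lambda>n. 2 * (lam / (real n)\<^sup>2) * \<sigma> n" and ?I = "LINT y|lborel. \<bar>f y\<bar>"
  let ?B = "\<lambda>n. ?I / sqrt (?v n) * (3 * C * peak_mass)"
  have v0: "0 \<le> ?v n" for n using \<sigma>(1)[of n] lam_pos by simp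
  have B0: "0 \<le> ?B n" for n
    using C peak_mass_nonneg v0[of n] by (intro mult_nonneg_nonneg divide_nonneg_nonneg Bochner_Integration.integral_nonneg) auto
  show ?thesis
  proof (rule field_corr_decay[OF \<sigma>(1,2) s3, where A = "\<lambda>n. sqrt (?B n)"])
    have "filterlim (\<lambda>n. sqrt (?v n)) at_top sequentially"
      by (rule filterlim_compose[OF sqrt_at_top inf])
    then have "(\<lambda>n. ?I / sqrt (?v n)) \<longlonglongrightarrow> 0"
      by (rule tendsto_divide_0[OF tendsto_const filterlim_at_top_imp_at_infinity])
    from tendsto_real_sqrt[OF tendsto_mult_left_zero[OF this]] show "(\<lambda>n. sqrt (?B n)) \<longlonglongrightarrow> 0" by simp
    show "0 \<le> sqrt (?B n)" for n using B0 by simp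
    fix n :: nat assume n: "1 \<le> n"
    then have n1: "1 \<le> real n" by simp
    interpret lattice_correlation \<beta> "\<gamma> n" lam "u n" by (rule L[OF n])
    let ?\<phi> = "sample (real n) (\<theta> n) (gauss (- (2 / real n) * \<sigma> n) (?v n) f)"
    let ?e = "exp (- (2 * \<gamma> n) * \<sigma> n)"
    have e: "0 \<le> ?e" "?e \<le> 1" using \<gamma> \<sigma>(1)[of n] by auto
    have vp: "0 < ?v n" using \<sigma>(3)[OF n] lam_pos n by simp
    have "(LINT x|sites. (?\<phi> x)\<^sup>2) / real n \<le> ?B n"
    proof (rule riemann_sum_square_bound)
      show "integrable sites ?\<phi>" by (rule gauss_sample_l2(1)[OF n1 schwartz_measurable[OF f] C'])
      show "\<bar>?\<phi> x\<bar> \<le> ?I / sqrt (?v n)" for x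
        unfolding sample_def by (rule gauss_sup_bound[OF vp schwartz_integrable[OF f]])
      show "(LINT x|sites. \<bar>?\<phi> x\<bar>) / real n \<le> 3 * C * peak_mass"
        unfolding sample_def by (rule gauss_riemann_sum_bound(2)[OF n1 schwartz_measurable[OF f] C(1) C'])
    qed (use n in simp)
    moreover have "(LINT x|sites. (sample (real n) (\<theta> n) (flow (2 / real n) (lam / (real n)\<^sup>2) (2 * \<gamma> n) (\<sigma> n) f) x)\<^sup>2) / real n
        = ?e\<^sup>2 * ((LINT x|sites. (?\<phi> x)\<^sup>2) / real n)"
      by (simp add: sample_def flow_def power_mult_distrib)
    moreover have "\<dots> \<le> 1 * ((LINT x|sites. (?\<phi> x)\<^sup>2) / real n)"
      using e by (intro mult_right_mono power_le_one) (auto intro!: divide_nonneg_nonneg Bochner_Integration.integral_nonneg)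
    ultimately show "(LINT x|sites. (sample (real n) (\<theta> n) (flow (2 / real n) (lam / (real n)\<^sup>2) (2 * \<gamma> n) (\<sigma> n) f) x)\<^sup>2) / real n
        \<le> (sqrt (?B n))\<^sup>2"
      unfolding real_sqrt_pow2[OF B0[of n]] by linarith
  qed
qed

end

section \<open>Square-integrable functions and the Gibbs measure\<close>

definition L2 :: "'a measure \<Rightarrow> ('a \<Rightarrow> real) \<Rightarrow> bool" where
  "L2 M F \<longleftrightarrow> F \<in> borel_measurable M \<and> integrable M (\<lambda>x. (F x)\<^sup>2)"

definition L2norm :: "'a measure \<Rightarrow> ('a \<Rightarrow> real) \<Rightarrow> real" where
  "L2norm M F = sqrt (LINT x|M. (F x)\<^sup>2)"

lemma L2_measurable: "L2 M F \<Longrightarrow> F \<in> borel_measurable M"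
  by (simp add: L2_def)

lemma L2_square: "L2 M F \<Longrightarrow> integrable M (\<lambda>x. (F x)\<^sup>2)"
  by (simp add: L2_def)

lemma L2norm_nonneg: "0 \<le> L2norm M F"
  by (simp add: L2norm_def)

lemma L2_mult_integrable:
  assumes "L2 M F" "L2 M G"
  shows "integrable M (\<lambda>x. F x * G x)"
proof (rule Bochner_Integration.integrable_bound)
  show "integrable M (\<lambda>x. (F x)\<^sup>2 + (G x)\<^sup>2)"
    using assms by (auto simp: L2_def)
  show "(\<lambda>x. F x * G x) \<in> borel_measurable M"
    using assms by (auto simp: L2_def)
  show "AE x in M. norm (F x * G x) \<le> norm ((F x)\<^sup>2 + (G x)\<^sup>2)"
  proof (rule AE_I2)
    fix x
    have "0 \<le> (\<bar>F x\<bar> - \<bar>G x\<bar>)\<^sup>2" by simp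
    then have "2 * (\<bar>F x\<bar> * \<bar>G x\<bar>) \<le> (F x)\<^sup>2 + (G x)\<^sup>2"
      by (simp add: power2_diff)
    moreover have "0 \<le> \<bar>F x\<bar> * \<bar>G x\<bar>" by simp
    ultimately have "\<bar>F x\<bar> * \<bar>G x\<bar> \<le> (F x)\<^sup>2 + (G x)\<^sup>2" by linarith
    then show "norm (F x * G x) \<le> norm ((F x)\<^sup>2 + (G x)\<^sup>2)"
      by (simp add: abs_mult)
  qed
qed

lemma L2_Cauchy_Schwarz:
  assumes "L2 M F" "L2 M G"
  shows "\<bar>LINT x|M. F x * G x\<bar> \<le> L2norm M F * L2norm M G"
proof -
  note [measurable] = assms[THEN L2_measurable]
  have i: "integrable M (\<lambda>x. \<bar>F x\<bar> * \<bar>G x\<bar>)"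
    using integrable_abs[OF L2_mult_integrable[OF assms]] by (simp add: abs_mult)
  have "(\<integral>\<^sup>+x. ennreal \<bar>F x\<bar> * ennreal \<bar>G x\<bar> \<partial>M)\<^sup>2
      \<le> (\<integral>\<^sup>+x. ennreal \<bar>F x\<bar> ^ 2 \<partial>M) * (\<integral>\<^sup>+x. ennreal \<bar>G x\<bar> ^ 2 \<partial>M)"
    by (rule Cauchy_Schwarz_nn_integral) auto
  also have "(\<integral>\<^sup>+x. ennreal \<bar>F x\<bar> * ennreal \<bar>G x\<bar> \<partial>M) = ennreal (LINT x|M. \<bar>F x\<bar> * \<bar>G x\<bar>)"
    using i by (subst nn_integral_eq_integral[symmetric]) (auto simp: ennreal_mult)
  also have "(\<integral>\<^sup>+x. ennreal \<bar>F x\<bar> ^ 2 \<partial>M) = ennreal (LINT x|M. (F x)\<^sup>2)"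
    using L2_square[OF assms(1)] by (subst nn_integral_eq_integral[symmetric]) (auto simp: ennreal_power)
  also have "(\<integral>\<^sup>+x. ennreal \<bar>G x\<bar> ^ 2 \<partial>M) = ennreal (LINT x|M. (G x)\<^sup>2)"
    using L2_square[OF assms(2)] by (subst nn_integral_eq_integral[symmetric]) (auto simp: ennreal_power)
  finally have "(LINT x|M. \<bar>F x\<bar> * \<bar>G x\<bar>)\<^sup>2 \<le> (LINT x|M. (F x)\<^sup>2) * (LINT x|M. (G x)\<^sup>2)"
    by (simp add: ennreal_power flip: ennreal_mult)
  then have "(LINT x|M. \<bar>F x\<bar> * \<bar>G x\<bar>) \<le> L2norm M F * L2norm M G"
    unfolding L2norm_def real_sqrt_mult[symmetric] by (rule real_le_rsqrt)
  moreover have "\<bar>LINT x|M. F x * G x\<bar> \<le> (LINT x|M. \<bar>F x\<bar> * \<bar>G x\<bar>)"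
    using integral_abs_bound[of M "\<lambda>x. F x * G x"] by (simp add: abs_mult)
  ultimately show ?thesis by linarith
qed

lemma L2_cmult [intro]: "L2 M F \<Longrightarrow> L2 M (\<lambda>x. k * F x)"
  by (auto simp: L2_def power_mult_distrib)

lemma L2_add [intro]:
  assumes "L2 M F" "L2 M G" shows "L2 M (\<lambda>x. F x + G x)"
  using assms L2_mult_integrable[OF assms] unfolding L2_def
  by (auto simp: power2_sum intro!: Bochner_Integration.integrable_add)
     (metis (no_types, lifting) Bochner_Integration.integrable_cong integrable_mult_right mult.assoc)

lemma L2_diff [intro]:
  assumes "L2 M F" "L2 M G" shows "L2 M (\<lambda>x. F x - G x)"
  using L2_add[OF assms(1) L2_cmult[OF assms(2), of "-1"]] by simp

lemma L2_bound:
  assumes "L2 M F" "G \<in> borel_measurable M" "\<And>x. \<bar>G x\<bar> \<le> \<bar>F x\<bar>"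
  shows "L2 M G"
  unfolding L2_def
proof
  show "integrable M (\<lambda>x. (G x)\<^sup>2)"
    using assms by (intro Bochner_Integration.integrable_bound[OF L2_square[OF assms(1)]])
      (auto simp: abs_le_square_iff)
qed fact

lemma L2_const: "finite_measure M \<Longrightarrow> L2 M (\<lambda>_. k)"
  by (simp add: L2_def finite_measure.finite_emeasure_space finite_measure.integrable_const)

lemma L2_integrable:
  assumes "finite_measure M" "L2 M F" shows "integrable M F"
  using L2_mult_integrable[OF assms(2) L2_const[OF assms(1), of 1]] by simp

section \<open>The Gibbs measure as a product of centred normal laws\<close>

abbreviation site_law :: "real \<Rightarrow> real measure" where
  "site_law \<beta> \<equiv> density lborel (\<lambda>r. ennreal (normal_density 0 (1 / sqrt \<beta>) r))"

lemma gibbs_eq: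
  assumes "\<beta> > 0"
  shows "gibbs \<beta> = PiM UNIV (\<lambda>_. site_law \<beta>)"
proof -
  have "sqrt (\<beta> / (2 * pi)) * exp (- \<beta> * r\<^sup>2 / 2) = normal_density 0 (1 / sqrt \<beta>) r" for r
    using assms by (simp add: normal_density_def power_divide real_sqrt_divide real_sqrt_mult field_simps)
  then show ?thesis by (simp add: gibbs_def)
qed

lemma sets_gibbs [measurable_cong]: "sets (gibbs \<beta>) = sets config_space"
  unfolding gibbs_def by (intro sets_PiM_cong) auto

lemma product_prob_space_site:
  assumes "\<beta> > 0" shows "product_prob_space (\<lambda>_::int. site_law \<beta>)"
proof -
  have "prob_space (site_law \<beta>)" by (rule prob_space_normal_density) (use assms in simp)
  then show ?thesis
    by (simp add: product_prob_space_def product_prob_space_axioms_def product_sigma_finite_def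
        prob_space_imp_sigma_finite)
qed

lemma prob_space_gibbs: "\<beta> > 0 \<Longrightarrow> prob_space (gibbs \<beta>)"
  unfolding gibbs_eq by (intro prob_space_PiM prob_space_normal_density) simp

lemma site_law_moments:
  assumes "\<beta> > 0"
  shows "integrable (site_law \<beta>) (\<lambda>r. r)" "(LINT r|site_law \<beta>. r) = 0"
    "integrable (site_law \<beta>) (\<lambda>r. r\<^sup>2)" "(LINT r|site_law \<beta>. r\<^sup>2) = 1 / \<beta>"
proof -
  have s: "0 < 1 / sqrt \<beta>" using assms by simp
  show "integrable (site_law \<beta>) (\<lambda>r. r)"
    using integrable_normal_moment_nz_1[OF s, of 0]
    by (simp add: integrable_density)
  show "(LINT r|site_law \<beta>. r) = 0"
    using integral_normal_moment_nz_1[OF s, of 0] by (simp add: integral_density)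
  show "integrable (site_law \<beta>) (\<lambda>r. r\<^sup>2)"
    using integrable_normal_moment[OF s, of 0 2] by (simp add: integrable_density)
  show "(LINT r|site_law \<beta>. r\<^sup>2) = 1 / \<beta>"
    using integral_normal_moment_even[OF s, of 0 1] assms
    by (simp add: integral_density power_divide)
qed

lemma measurable_coord [measurable]: "(\<lambda>\<sigma>. \<sigma> x) \<in> borel_measurable config_space"
  by (rule measurable_component_singleton) simp

lemma gibbs_second_moment:
  assumes "\<beta> > 0"
  shows "integrable (gibbs \<beta>) (\<lambda>\<sigma>. (\<sigma> x)\<^sup>2)" "(LINT \<sigma>|gibbs \<beta>. (\<sigma> x)\<^sup>2) = 1 / \<beta>"
proof -
  interpret product_prob_space "\<lambda>_::int. site_law \<beta>" UNIV by (rule product_prob_space_site[OF assms])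
  have d: "distr (gibbs \<beta>) (site_law \<beta>) (\<lambda>\<sigma>. \<sigma> x) = site_law \<beta>"
    unfolding gibbs_eq[OF assms] by (rule PiM_component) simp
  have m: "(\<lambda>\<sigma>. \<sigma> x) \<in> gibbs \<beta> \<rightarrow>\<^sub>M site_law \<beta>"
    unfolding gibbs_eq[OF assms] by measurable
  show "integrable (gibbs \<beta>) (\<lambda>\<sigma>. (\<sigma> x)\<^sup>2)"
    using integrable_distr[OF m, of "\<lambda>r. r\<^sup>2"] site_law_moments(3)[OF assms] unfolding d by simp
  show "(LINT \<sigma>|gibbs \<beta>. (\<sigma> x)\<^sup>2) = 1 / \<beta>"
    using integral_distr[OF m, of "\<lambda>r. r\<^sup>2"] site_law_moments(4)[OF assms] unfolding d by simp
qed

lemma L2_coord: "\<beta> > 0 \<Longrightarrow> L2 (gibbs \<beta>) (\<lambda>\<sigma>. \<sigma> x)"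
  by (simp add: L2_def gibbs_second_moment)

lemma gibbs_covariance:
  assumes "\<beta> > 0"
  shows "(LINT \<sigma>|gibbs \<beta>. \<sigma> x * \<sigma> y) = of_bool (x = y) / \<beta>"
proof (cases "x = y")
  case True
  then show ?thesis using gibbs_second_moment(2)[OF assms, of x] by (simp add: power2_eq_square)
next
  case False
  interpret product_prob_space "\<lambda>_::int. site_law \<beta>" UNIV by (rule product_prob_space_site[OF assms])
  let ?J = "{x, y}"
  have d: "distr (gibbs \<beta>) (PiM ?J (\<lambda>_. site_law \<beta>)) (\<lambda>\<sigma>. restrict \<sigma> ?J) = PiM ?J (\<lambda>_. site_law \<beta>)"
    unfolding gibbs_eq[OF assms] by (rule distr_PiM_restrict_finite) auto
  have m: "(\<lambda>\<sigma>. restrict \<sigma> ?J) \<in> gibbs \<beta> \<rightarrow>\<^sub>M PiM ?J (\<lambda>_. site_law \<beta>)"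
    unfolding gibbs_eq[OF assms] by (rule measurable_restrict_subset) simp
  have "(LINT \<sigma>|PiM ?J (\<lambda>_. site_law \<beta>). (\<Prod>i\<in>?J. \<sigma> i)) = (\<Prod>i\<in>?J. LINT r|site_law \<beta>. r)"
    by (rule product_integral_prod) (auto intro: site_law_moments assms)
  then have "(LINT \<sigma>|PiM ?J (\<lambda>_. site_law \<beta>). \<sigma> x * \<sigma> y) = 0"
    using False assms by (simp add: site_law_moments)
  moreover have mxy: "(\<lambda>\<sigma>. \<sigma> x * \<sigma> y) \<in> borel_measurable (PiM ?J (\<lambda>_. site_law \<beta>))"
    by (intro borel_measurable_times measurable_compose[OF measurable_component_singleton])
       (auto simp: measurable_def)
  ultimately have "(LINT \<sigma>|gibbs \<beta>. restrict \<sigma> ?J x * restrict \<sigma> ?J y) = 0"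
    using mxy by (subst (asm) d[symmetric], subst (asm) integral_distr[OF m]) auto
  then show ?thesis using False by simp
qed

section \<open>Markov property and time correlations\<close>

locale gibbs_process =
  fixes \<beta> \<gamma> lam :: real and M :: "'w measure" and X :: "real \<Rightarrow> 'w \<Rightarrow> config"
    and K :: "real \<Rightarrow> config \<Rightarrow> config measure"
  assumes \<beta>_pos: "\<beta> > 0" and stationary: "stationary_process \<beta> \<gamma> lam M X K"
begin

lemma markov: "markov_process M X K"
  using stationary unfolding stationary_process_def by blast

lemma gibbs_invariant: "t \<ge> 0 \<Longrightarrow> gibbs \<beta> \<bind> K t = gibbs \<beta>"
  and X_distr_0: "distr M config_space (X 0) = gibbs \<beta>"
  and generator: "\<lbrakk>smooth_fun f; local_fun f; bounded (range f); integrable (gibbs \<beta>) (\<lambda>\<sigma>. (gen_L \<gamma> lam f \<sigma>)\<^sup>2)\<rbrakk>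
    \<Longrightarrow> L2_generator (gibbs \<beta>) K f (gen_L \<gamma> lam f)"
  using stationary unfolding stationary_process_def by blast+

sublocale prob_space M
  using markov unfolding markov_process_def by blast

lemma X_measurable: "t \<ge> 0 \<Longrightarrow> X t \<in> M \<rightarrow>\<^sub>M config_space"
  using markov unfolding markov_process_def by blast

lemma K_measurable: "t \<ge> 0 \<Longrightarrow> K t \<in> config_space \<rightarrow>\<^sub>M prob_algebra config_space"
  using markov unfolding markov_process_def markov_semigroup_def by blast

lemma K_measurable_sub: "t \<ge> 0 \<Longrightarrow> K t \<in> config_space \<rightarrow>\<^sub>M subprob_algebra config_space"
  by (rule measurable_prob_algebraD[OF K_measurable])

lemma prob_space_K: "t \<ge> 0 \<Longrightarrow> prob_space (K t \<sigma>)"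
  and sets_K: "t \<ge> 0 \<Longrightarrow> sets (K t \<sigma>) = sets config_space"
  using measurable_space[OF K_measurable, of t \<sigma>] by (auto simp: space_prob_algebra space_PiM)

lemma space_natural_filtration: "space (natural_filtration M X s) = space M"
  unfolding natural_filtration_def by (simp add: space_measure_of_conv)

lemma natural_filtration_subalgebra:
  "finite_measure_subalgebra M (natural_filtration M X s)"
proof
  have "(\<Union>r\<in>{0..s}. {X r -` B \<inter> space M | B. B \<in> sets config_space}) \<subseteq> sets M"
    using measurable_sets[OF X_measurable] by auto
  moreover from this have "(\<Union>r\<in>{0..s}. {X r -` B \<inter> space M | B. B \<in> sets config_space}) \<subseteq> Pow (space M)"
    using sets.sets_into_space by blast
  ultimately show "subalgebra M (natural_filtration M X s)"
    unfolding subalgebra_def space_natural_filtration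
    unfolding natural_filtration_def by (simp add: sets_measure_of sets.sigma_sets_subset)
qed

lemma X_adapted:
  assumes "0 \<le> r" "r \<le> s"
  shows "X r \<in> natural_filtration M X s \<rightarrow>\<^sub>M config_space"
proof (rule measurableI)
  fix B assume B: "B \<in> sets config_space"
  have p: "(\<Union>r\<in>{0..s}. {X r -` B \<inter> space M | B. B \<in> sets config_space}) \<subseteq> Pow (space M)"
    by auto
  show "X r -` B \<inter> space (natural_filtration M X s) \<in> sets (natural_filtration M X s)"
    unfolding space_natural_filtration unfolding natural_filtration_def sets_measure_of[OF p]
    using assms B by (intro sigma_sets.Basic UN_I[of r]) auto
qed (simp add: space_PiM)

lemma markov_indicator:
  assumes "0 \<le> s" "0 \<le> t" "B \<in> sets config_space"
    "Y \<in> borel_measurable (natural_filtration M X s)" "integrable M Y"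
  shows "(LINT w|M. Y w * indicat_real B (X (s + t) w)) = (LINT w|M. Y w * measure (K t (X s w)) B)"
proof -
  interpret F: finite_measure_subalgebra M "natural_filtration M X s"
    by (rule natural_filtration_subalgebra)
  have [measurable]: "X (s + t) \<in> M \<rightarrow>\<^sub>M config_space" "X s \<in> M \<rightarrow>\<^sub>M config_space"
    using assms by (auto intro: X_measurable)
  have [measurable]: "K t \<in> config_space \<rightarrow>\<^sub>M subprob_algebra config_space"
    by (rule K_measurable_sub) fact
  note [measurable] = assms(3)
  have Ym [measurable]: "Y \<in> borel_measurable M" using assms(5) by auto
  have ind: "(\<lambda>w. indicat_real B (X (s + t) w)) \<in> borel_measurable M" by measurable
  have int: "integrable M (\<lambda>w. Y w * indicat_real B (X (s + t) w))"
    by (rule Bochner_Integration.integrable_bound[OF assms(5)]) (use ind in \<open>auto split: split_indicator\<close>)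
  have "(LINT w|M. Y w * indicat_real B (X (s + t) w))
     = (LINT w|M. Y w * real_cond_exp M (natural_filtration M X s) (\<lambda>w. indicat_real B (X (s + t) w)) w)"
    by (rule F.real_cond_exp_intg(2)[symmetric]) (use int assms(4) ind in auto)
  also have "\<dots> = (LINT w|M. Y w * measure (K t (X s w)) B)"
  proof (rule integral_cong_AE)
    show "(\<lambda>w. Y w * real_cond_exp M (natural_filtration M X s) (\<lambda>w. indicat_real B (X (s + t) w)) w)
        \<in> borel_measurable M"
      by (intro borel_measurable_times Ym borel_measurable_cond_exp2)
    show "(\<lambda>w. Y w * measure (K t (X s w)) B) \<in> borel_measurable M"
      by measurable
    have "AE w in M. real_cond_exp M (natural_filtration M X s) (\<lambda>w. indicat_real B (X (s + t) w)) w
          = measure (K t (X s w)) B"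
      using markov assms(1-3) by (simp add: markov_process_def)
    then show "AE w in M. Y w * real_cond_exp M (natural_filtration M X s) (\<lambda>w. indicat_real B (X (s + t) w)) w
        = Y w * measure (K t (X s w)) B"
      by eventually_elim simp
  qed
  finally show ?thesis .
qed

text \<open>Weighting by a nonnegative variable of the past turns the Markov property for indicators
  into an identity of finite measures, which extends to bounded functions simply by integrating
  them.\<close>

lemma markov_measure:
  assumes "0 \<le> s" "0 \<le> t"
    and Y: "Y \<in> borel_measurable (natural_filtration M X s)" "integrable M Y" "\<And>w. 0 \<le> Y w"
  shows "distr (density M (\<lambda>w. ennreal (Y w))) config_space (X (s + t))
    = distr (density M (\<lambda>w. ennreal (Y w))) config_space (X s) \<bind> K t"
    (is "?L = ?D \<bind> K t")
proof (rule measure_eqI)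
  have [measurable]: "X (s + t) \<in> M \<rightarrow>\<^sub>M config_space" "X s \<in> M \<rightarrow>\<^sub>M config_space"
    using assms by (auto intro: X_measurable)
  have Km [measurable]: "K t \<in> config_space \<rightarrow>\<^sub>M subprob_algebra config_space"
    by (rule K_measurable_sub) fact
  have Ym [measurable]: "Y \<in> borel_measurable M" using assms by auto
  show "sets ?L = sets (?D \<bind> K t)"
    using sets_K[OF \<open>0 \<le> t\<close>] by (subst sets_bind[of _ _ config_space]) (auto simp: space_PiM)
  fix B assume "B \<in> sets ?L"
  then have B [measurable]: "B \<in> sets config_space" by simp
  have "emeasure ?L B = (\<integral>\<^sup>+w. ennreal (Y w) * indicator B (X (s + t) w) \<partial>M)"
    by (simp add: emeasure_distr emeasure_density)
       (auto intro!: nn_integral_cong split: split_indicator)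
  also have "\<dots> = (\<integral>\<^sup>+w. ennreal (Y w * indicat_real B (X (s + t) w)) \<partial>M)"
    by (auto intro!: nn_integral_cong split: split_indicator)
  also have "\<dots> = ennreal (LINT w|M. Y w * indicat_real B (X (s + t) w))"
    by (rule nn_integral_eq_integral, rule Bochner_Integration.integrable_bound[OF Y(2)])
       (auto simp: Y split: split_indicator)
  also have "\<dots> = ennreal (LINT w|M. Y w * measure (K t (X s w)) B)"
    by (subst markov_indicator) (use assms B in auto)
  also have "\<dots> = (\<integral>\<^sup>+w. ennreal (Y w * measure (K t (X s w)) B) \<partial>M)"
    using prob_space.prob_le_1[OF prob_space_K[OF \<open>0 \<le> t\<close>]]
    by (intro nn_integral_eq_integral[symmetric] Bochner_Integration.integrable_bound[OF Y(2)])
       (auto simp: Y abs_mult mult_left_le)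
  also have "\<dots> = (\<integral>\<^sup>+w. ennreal (Y w) * emeasure (K t (X s w)) B \<partial>M)"
    using prob_space_K[OF \<open>0 \<le> t\<close>]
    by (intro nn_integral_cong) (simp add: ennreal_mult Y finite_measure.emeasure_eq_measure prob_space_def)
  also have "\<dots> = emeasure (?D \<bind> K t) B"
    by (subst emeasure_bind[where N = config_space])
       (auto simp: space_PiM nn_integral_distr nn_integral_density)
  finally show "emeasure ?L B = emeasure (?D \<bind> K t) B" .
qed

definition P :: "real \<Rightarrow> (config \<Rightarrow> real) \<Rightarrow> config \<Rightarrow> real" where
  "P t f \<sigma> = (LINT \<sigma>'|K t \<sigma>. f \<sigma>')"

lemma P_measurable:
  assumes "f \<in> borel_measurable config_space" "0 \<le> t"
  shows "P t f \<in> borel_measurable config_space"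
  unfolding P_def
  by (rule measurable_compose[OF K_measurable_sub[OF assms(2)] integral_measurable_subprob_algebra[OF assms(1)]])

lemma P_bound:
  assumes "0 \<le> t" "\<And>\<sigma>. \<bar>f \<sigma>\<bar> \<le> C"
  shows "\<bar>P t f \<sigma>\<bar> \<le> C"
proof -
  interpret K: prob_space "K t \<sigma>" by (rule prob_space_K) fact
  have C: "0 \<le> C" using assms(2)[of \<sigma>] by linarith
  have "\<bar>P t f \<sigma>\<bar> \<le> (LINT \<sigma>'|K t \<sigma>. \<bar>f \<sigma>'\<bar>)" unfolding P_def by (rule integral_abs_bound)
  also have "\<dots> \<le> (LINT \<sigma>'|K t \<sigma>. C)"
    by (rule Bochner_Integration.integral_mono') (use assms C in auto)
  finally show ?thesis by (simp add: K.prob_space)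
qed

lemma markov_bounded_nonneg:
  assumes st: "0 \<le> s" "0 \<le> t"
    and Y: "Y \<in> borel_measurable (natural_filtration M X s)" "integrable M Y" "\<And>w. 0 \<le> Y w"
    and f: "f \<in> borel_measurable config_space" "\<And>\<sigma>. \<bar>f \<sigma>\<bar> \<le> C"
  shows "(LINT w|M. f (X (s + t) w) * Y w) = (LINT w|M. P t f (X s w) * Y w)"
proof -
  define D where "D = distr (density M (\<lambda>w. ennreal (Y w))) config_space (X s)"
  have X1 [measurable]: "X (s + t) \<in> M \<rightarrow>\<^sub>M config_space" and X2 [measurable]: "X s \<in> M \<rightarrow>\<^sub>M config_space"
    using assms by (auto intro: X_measurable)
  have Km [measurable]: "K t \<in> config_space \<rightarrow>\<^sub>M subprob_algebra config_space"
    by (rule K_measurable_sub) fact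
  have Ym [measurable]: "Y \<in> borel_measurable M" using assms by auto
  note [measurable] = f(1) P_measurable[OF f(1) st(2)]
  have sD: "sets D = sets config_space" by (simp add: D_def)
  have spD: "space D \<noteq> {}" by (simp add: D_def space_PiM)
  have KD: "K t \<in> D \<rightarrow>\<^sub>M subprob_algebra config_space"
    using Km by (simp add: measurable_cong_sets[OF sD refl])
  have fin: "finite_measure D"
    unfolding D_def
  proof (rule finite_measure.finite_measure_distr)
    show "finite_measure (density M (\<lambda>w. ennreal (Y w)))"
      using integrableD(2)[OF Y(2)]
      by (intro finite_measureI) (simp add: emeasure_density nn_integral_eq_integral[OF Y(2)] Y)
  qed simp
  have *: "(LINT w|M. g (X r w) * Y w) = (LINT \<sigma>|distr (density M (\<lambda>w. ennreal (Y w))) config_space (X r). g \<sigma>)"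
    if "g \<in> borel_measurable config_space" "X r \<in> M \<rightarrow>\<^sub>M config_space" for g r
    using that by (subst integral_distr) (auto simp: integral_density Y mult.commute)
  have "(LINT w|M. f (X (s + t) w) * Y w) = (LINT \<sigma>|(D \<bind> K t). f \<sigma>)"
    unfolding D_def by (subst *[OF f(1) X1]) (subst markov_measure[OF st Y], rule refl)
  also have "\<dots> = (LINT \<sigma>|D. P t f \<sigma>)"
  proof -
    have "(LINT \<sigma>|(D \<bind> K t). f \<sigma>) = (LINT N|distr D (subprob_algebra config_space) (K t). LINT \<sigma>|N. f \<sigma>)"
      unfolding bind_nonempty''[OF KD spD]
    proof (rule integral_join[where N = config_space and B = C and B' = 1])
      show "finite_measure (distr D (subprob_algebra config_space) (K t))"
        by (rule finite_measure.finite_measure_distr[OF fin KD])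
      show "AE N in distr D (subprob_algebra config_space) (K t). emeasure N (space N) \<le> ennreal 1"
        by (rule AE_I2) (auto simp: space_subprob_algebra subprob_space.emeasure_space_le_1)
    qed (use f in auto)
    also have "\<dots> = (LINT \<sigma>|D. P t f \<sigma>)"
      unfolding P_def by (rule integral_distr[OF KD integral_measurable_subprob_algebra[OF f(1)]])
    finally show ?thesis .
  qed
  also have "\<dots> = (LINT w|M. P t f (X s w) * Y w)"
    unfolding D_def by (subst *) auto
  finally show ?thesis .
qed

lemma markov_bounded:
  assumes st: "0 \<le> s" "0 \<le> t"
    and Y: "Y \<in> borel_measurable (natural_filtration M X s)" "integrable M Y"
    and f: "f \<in> borel_measurable config_space" "\<And>\<sigma>. \<bar>f \<sigma>\<bar> \<le> C"
  shows "(LINT w|M. f (X (s + t) w) * Y w) = (LINT w|M. P t f (X s w) * Y w)"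
proof -
  have X1 [measurable]: "X (s + t) \<in> M \<rightarrow>\<^sub>M config_space" and X2 [measurable]: "X s \<in> M \<rightarrow>\<^sub>M config_space"
    using assms by (auto intro: X_measurable)
  note [measurable] = f(1) P_measurable[OF f(1) st(2)] Y(1)
  \<comment> \<open>A signed \<open>Y\<close> is no density; its positive and negative parts
    are.\<close>
  have split: "(LINT w|M. F w * Y w) = (LINT w|M. F w * max 0 (Y w)) - (LINT w|M. F w * max 0 (- Y w))"
    if F [measurable]: "F \<in> borel_measurable M" "\<And>w. \<bar>F w\<bar> \<le> C" for F
  proof -
    have i: "integrable M (\<lambda>w. F w * Z w)" if "integrable M Z" for Z
      by (rule Bochner_Integration.integrable_bound[OF integrable_mult_right[of C, OF that]])
         (use that F in \<open>auto simp: abs_mult intro!: AE_I2 mult_right_mono intro: order_trans[OF F(2) abs_ge_self]\<close>)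
    have "(LINT w|M. F w * Y w) = (LINT w|M. F w * max 0 (Y w) - F w * max 0 (- Y w))"
      by (rule Bochner_Integration.integral_cong) (auto simp: max_def)
    also have "\<dots> = (LINT w|M. F w * max 0 (Y w)) - (LINT w|M. F w * max 0 (- Y w))"
      by (rule Bochner_Integration.integral_diff; rule i) (use Y(2) in auto)
    finally show ?thesis .
  qed
  have "(LINT w|M. f (X (s + t) w) * max 0 (Y w)) = (LINT w|M. P t f (X s w) * max 0 (Y w))"
    "(LINT w|M. f (X (s + t) w) * max 0 (- Y w)) = (LINT w|M. P t f (X s w) * max 0 (- Y w))"
    using Y(2) by (intro markov_bounded_nonneg[OF st _ _ _ f]; auto)+
  then show ?thesis
    using split[of "\<lambda>w. f (X (s + t) w)"] split[of "\<lambda>w. P t f (X s w)"] f P_bound[OF st(2) f(2)] by simp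
qed

lemma X_distr:
  assumes "0 \<le> t" shows "distr M config_space (X t) = gibbs \<beta>"
proof -
  have d: "density M (\<lambda>w. ennreal 1) = M" by (simp add: density_1)
  have "distr (density M (\<lambda>w. ennreal 1)) config_space (X (0 + t))
      = distr (density M (\<lambda>w. ennreal 1)) config_space (X 0) \<bind> K t"
    by (rule markov_measure) (use assms in auto)
  then have "distr M config_space (X t) = distr M config_space (X 0) \<bind> K t"
    unfolding d by (simp only: add_0)
  also have "\<dots> = gibbs \<beta>"
    unfolding X_distr_0 by (rule gibbs_invariant) fact
  finally show ?thesis .
qed

lemma L2_X:
  assumes "0 \<le> t" "L2 (gibbs \<beta>) F"
  shows "L2 M (\<lambda>w. F (X t w))" "L2norm M (\<lambda>w. F (X t w)) = L2norm (gibbs \<beta>) F"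
proof -
  have m: "F \<in> borel_measurable config_space"
    using L2_measurable[OF assms(2)] by (simp add: measurable_cong_sets[OF sets_gibbs refl])
  then have m2: "(\<lambda>\<sigma>. (F \<sigma>)\<^sup>2) \<in> borel_measurable config_space" by simp
  show "L2 M (\<lambda>w. F (X t w))"
    unfolding L2_def
    using integrable_distr[OF X_measurable[OF assms(1)], of "\<lambda>\<sigma>. (F \<sigma>)\<^sup>2"] L2_square[OF assms(2)]
      measurable_compose[OF X_measurable[OF assms(1)] m]
    by (simp add: X_distr[OF assms(1)])
  show "L2norm M (\<lambda>w. F (X t w)) = L2norm (gibbs \<beta>) F"
    unfolding L2norm_def
    by (subst integral_distr[OF X_measurable[OF assms(1)] m2, symmetric]) (simp add: X_distr[OF assms(1)])
qed

definition corr :: "real \<Rightarrow> (config \<Rightarrow> real) \<Rightarrow> (config \<Rightarrow> real) \<Rightarrow> real" where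
  "corr t F G = (LINT w|M. F (X t w) * G (X 0 w))"

lemma corr_integrable:
  assumes "0 \<le> t" "L2 (gibbs \<beta>) F" "L2 (gibbs \<beta>) G"
  shows "integrable M (\<lambda>w. F (X t w) * G (X 0 w))"
  using assms by (intro L2_mult_integrable L2_X) auto

text \<open>Stationarity turns both norms into norms under the Gibbs measure. The bound is thus
  independent of time, the source of all later uniformity in time.\<close>

lemma corr_bound:
  assumes "0 \<le> t" "L2 (gibbs \<beta>) F" "L2 (gibbs \<beta>) G"
  shows "\<bar>corr t F G\<bar> \<le> L2norm (gibbs \<beta>) F * L2norm (gibbs \<beta>) G"
  using L2_Cauchy_Schwarz[OF L2_X(1)[OF assms(1,2)] L2_X(1)[OF order_refl assms(3)]] assms
  by (simp add: corr_def L2_X(2))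

lemma corr_add:
  assumes "0 \<le> t" "L2 (gibbs \<beta>) F" "L2 (gibbs \<beta>) F'" "L2 (gibbs \<beta>) G"
  shows "corr t (\<lambda>\<sigma>. F \<sigma> + F' \<sigma>) G = corr t F G + corr t F' G"
  using corr_integrable assms by (simp add: corr_def distrib_right)

lemma corr_cmult: "corr t (\<lambda>\<sigma>. k * F \<sigma>) G = k * corr t F G"
  by (simp add: corr_def mult.assoc)

lemma corr_diff:
  assumes "0 \<le> t" "L2 (gibbs \<beta>) F" "L2 (gibbs \<beta>) F'" "L2 (gibbs \<beta>) G"
  shows "corr t (\<lambda>\<sigma>. F \<sigma> - F' \<sigma>) G = corr t F G - corr t F' G"
  using corr_integrable assms by (simp add: corr_def left_diff_distrib)

lemma corr_0:
  assumes "L2 (gibbs \<beta>) F" "L2 (gibbs \<beta>) G"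
  shows "corr 0 F G = (LINT \<sigma>|gibbs \<beta>. F \<sigma> * G \<sigma>)"
proof -
  have "(\<lambda>\<sigma>. F \<sigma> * G \<sigma>) \<in> borel_measurable config_space"
    using assms[THEN L2_measurable] by (simp add: measurable_cong_sets[OF sets_gibbs refl])
  from integral_distr[OF X_measurable[OF order_refl] this] show ?thesis
    by (simp add: corr_def X_distr)
qed

end

section \<open>Evolution of the two-point function\<close>

text \<open>A partial derivative only shifts the phase by a quarter period and rescales the
  amplitude, to 0 at other sites, so the family is closed under differentiation. With amplitude R
  and frequency 1 / R it is the truncation of a coordinate.\<close>

definition sine_fun :: "real \<Rightarrow> real \<Rightarrow> real \<Rightarrow> int \<Rightarrow> config \<Rightarrow> real" where
  "sine_fun A k \<phi> x \<sigma> = A * sin (k * \<sigma> x + \<phi>)"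

lemma sine_fun_has_deriv:
  "((\<lambda>r. sine_fun A k \<phi> x (\<sigma>(y := r))) has_real_derivative
     sine_fun (if y = x then A * k else 0) k (\<phi> + pi / 2) x \<sigma>) (at (\<sigma> y))"
proof (cases "y = x")
  case True
  have "((\<lambda>r. A * sin (k * r + \<phi>)) has_real_derivative A * (cos (k * \<sigma> x + \<phi>) * k)) (at (\<sigma> x))"
    by (auto intro!: derivative_eq_intros)
  moreover have "cos (k * \<sigma> x + \<phi>) = sin (k * \<sigma> x + (\<phi> + pi / 2))"
    by (simp add: sin_add cos_add)
  ultimately show ?thesis using True by (simp add: sine_fun_def mult_ac)
qed (simp add: sine_fun_def)

lemma pderiv_sine_fun:
  "pderiv_at y (sine_fun A k \<phi> x) = sine_fun (if y = x then A * k else 0) k (\<phi> + pi / 2) x"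
  unfolding pderiv_at_def by (rule ext) (rule DERIV_imp_deriv[OF sine_fun_has_deriv])

lemma smooth_sine_fun: "smooth_fun (sine_fun A k \<phi> x)"
proof -
  have ex: "\<exists>A' \<phi>'. fold pderiv_at xs (sine_fun A k \<phi> x) = sine_fun A' k \<phi>' x" for xs
    by (induction xs arbitrary: A \<phi>) (auto simp: pderiv_sine_fun)
  have "continuous_on UNIV (sine_fun A' k \<phi>' x)" for A' \<phi>'
    unfolding sine_fun_def by (intro continuous_intros continuous_on_product_coordinates)
  moreover have "(\<lambda>r. sine_fun A' k \<phi>' x (\<sigma>(y := r))) differentiable at (\<sigma> y)" for A' \<phi>' y \<sigma>
    using sine_fun_has_deriv real_differentiable_def by blast
  ultimately show ?thesis
    unfolding smooth_fun_def using ex by metis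
qed

lemma local_sine_fun: "local_fun (sine_fun A k \<phi> x)"
  unfolding local_fun_def sine_fun_def by (intro exI[of _ "{x}"]) auto

lemma bounded_sine_fun: "\<bar>sine_fun A k \<phi> x \<sigma>\<bar> \<le> \<bar>A\<bar>"
  by (simp add: sine_fun_def abs_mult mult_left_le)

lemma infsum_two:
  fixes g :: "int \<Rightarrow> real"
  assumes "\<And>z. z \<noteq> x \<Longrightarrow> z \<noteq> y \<Longrightarrow> g z = 0" "x \<noteq> y"
  shows "(\<Sum>\<^sub>\<infinity>z\<in>UNIV. g z) = g x + g y"
proof -
  have "(\<Sum>\<^sub>\<infinity>z\<in>UNIV. g z) = (\<Sum>\<^sub>\<infinity>z\<in>{x, y}. g z)"
    by (rule infsum_cong_neutral) (use assms in auto)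
  then show ?thesis using assms by simp
qed

lemma gen_L_sine_fun:
  "gen_L \<gamma> lam (sine_fun R k 0 x) \<sigma> =
     (\<sigma> (x + 1) - \<sigma> (x - 1)) * (R * k * cos (k * \<sigma> x)) - 2 * \<gamma> * sine_fun R k 0 x \<sigma>
     + lam * (sine_fun R k 0 (x + 1) \<sigma> + sine_fun R k 0 (x - 1) \<sigma> - 2 * sine_fun R k 0 x \<sigma>)"
proof -
  \<comment> \<open>Drift and flips have a single contributing site, with \<open>x + 1\<close> as a
    filler whose summand vanishes; exchanges contribute through the bonds starting at
    \<open>x\<close> and at \<open>x - 1\<close>.\<close>
  have A: "gen_A (sine_fun R k 0 x) \<sigma> = (\<sigma> (x + 1) - \<sigma> (x - 1)) * (R * k * cos (k * \<sigma> x))"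
    unfolding gen_A_def pderiv_sine_fun
    by (subst infsum_two[of x "x + 1"]) (auto simp: sine_fun_def sin_add)
  have F: "gen_flip (sine_fun R k 0 x) \<sigma> = - 2 * sine_fun R k 0 x \<sigma>"
    unfolding gen_flip_def
    by (subst infsum_two[of x "x + 1"]) (auto simp: sine_fun_def)
  have E: "gen_exch (sine_fun R k 0 x) \<sigma>
     = sine_fun R k 0 (x + 1) \<sigma> + sine_fun R k 0 (x - 1) \<sigma> - 2 * sine_fun R k 0 x \<sigma>"
    unfolding gen_exch_def
    by (subst infsum_two[of x "x - 1"]) (auto simp: sine_fun_def)
  show ?thesis unfolding gen_L_def A F E by (simp add: algebra_simps)
qed

lemma LIMSEQ_scaled_sin: "(\<lambda>n. real (Suc n) * sin (1 / real (Suc n) * r)) \<longlonglongrightarrow> r"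
proof (cases "r = 0")
  case False
  have z: "(\<lambda>n. r * inverse (real (Suc n))) \<longlonglongrightarrow> r * 0"
    by (intro tendsto_mult tendsto_const LIMSEQ_inverse_real_of_nat)
  have "(\<lambda>h. sin h / h) \<midarrow>0\<rightarrow> (1::real)"
    using DERIV_sin[of "0::real"] by (simp add: DERIV_def)
  moreover have "filterlim (\<lambda>n. r * inverse (real (Suc n))) (at 0) sequentially"
    using z False by (auto simp: filterlim_at intro!: always_eventually)
  ultimately have "(\<lambda>n. sin (r * inverse (real (Suc n))) / (r * inverse (real (Suc n)))) \<longlonglongrightarrow> 1"
    by (rule filterlim_compose)
  then have "(\<lambda>n. r * (sin (r * inverse (real (Suc n))) / (r * inverse (real (Suc n))))) \<longlonglongrightarrow> r * 1"
    by (intro tendsto_mult tendsto_const)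
  moreover have "r * (sin (r * inverse (real (Suc n))) / (r * inverse (real (Suc n))))
      = real (Suc n) * sin (1 / real (Suc n) * r)" for n
    using False by (simp add: field_simps)
  ultimately show ?thesis by simp
qed simp

lemma LIMSEQ_scaled_cos: "(\<lambda>n. cos (1 / real (Suc n) * r)) \<longlonglongrightarrow> 1"
proof -
  have "(\<lambda>n. cos (r * inverse (real (Suc n)))) \<longlonglongrightarrow> cos (r * 0)"
    by (intro tendsto_cos tendsto_mult tendsto_const LIMSEQ_inverse_real_of_nat)
  then show ?thesis by (simp add: divide_simps mult.commute)
qed

lemma L2norm_dominated:
  assumes H: "L2 M H" and F: "\<And>n. F n \<in> borel_measurable M" "G \<in> borel_measurable M"
    and lim: "\<And>x. (\<lambda>n. F n x) \<longlonglongrightarrow> G x" and dom: "\<And>n x. \<bar>F n x\<bar> \<le> H x"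
  shows "(\<lambda>n. L2norm M (\<lambda>x. F n x - G x)) \<longlonglongrightarrow> 0"
proof -
  have domG: "\<bar>G x\<bar> \<le> H x" for x
    by (rule LIMSEQ_le_const2[OF tendsto_rabs[OF lim]]) (use dom in auto)
  have "(\<lambda>n. LINT x|M. (F n x - G x)\<^sup>2) \<longlonglongrightarrow> (LINT x|M. 0)"
  proof (rule integral_dominated_convergence[where w = "\<lambda>x. (2 * H x)\<^sup>2"])
    show "integrable M (\<lambda>x. (2 * H x)\<^sup>2)" using L2_square[OF L2_cmult[OF H]] .
    show "AE x in M. (\<lambda>n. (F n x - G x)\<^sup>2) \<longlonglongrightarrow> 0"
    proof (rule AE_I2)
      fix x have "(\<lambda>n. (F n x - G x)\<^sup>2) \<longlonglongrightarrow> (G x - G x)\<^sup>2"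
        by (intro tendsto_power tendsto_diff lim tendsto_const)
      then show "(\<lambda>n. (F n x - G x)\<^sup>2) \<longlonglongrightarrow> 0" by simp
    qed
    show "AE x in M. norm ((F n x - G x)\<^sup>2) \<le> (2 * H x)\<^sup>2" for n
    proof (rule AE_I2)
      fix x have "\<bar>F n x - G x\<bar> \<le> 2 * H x" using dom[of n x] domG[of x] by linarith
      then have "\<bar>F n x - G x\<bar>\<^sup>2 \<le> (2 * H x)\<^sup>2" by (intro power_mono) auto
      then show "norm ((F n x - G x)\<^sup>2) \<le> (2 * H x)\<^sup>2" by simp
    qed
  qed (use F in auto)
  then have "(\<lambda>n. sqrt (LINT x|M. (F n x - G x)\<^sup>2)) \<longlonglongrightarrow> sqrt 0"
    by (intro tendsto_real_sqrt) simp
  then show ?thesis by (simp add: L2norm_def)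
qed

text \<open>An approximate right derivative that is attained uniformly in time suffices for an
  approximate fundamental theorem of calculus; no differentiability is needed.\<close>

lemma approximate_FTC:
  fixes g D :: "real \<Rightarrow> real"
  assumes D: "continuous_on {0..} D"
    and right: "\<And>\<epsilon>. \<epsilon> > 0 \<Longrightarrow> \<exists>\<delta>>0. \<forall>s t. 0 < s \<longrightarrow> s < \<delta> \<longrightarrow> 0 \<le> t \<longrightarrow> \<bar>g (t + s) - g t - s * D t\<bar> \<le> s * (e + \<epsilon>)"
    and T: "0 \<le> T"
  shows "\<bar>g T - g 0 - integral {0..T} D\<bar> \<le> e * T"
proof (cases "T = 0")
  case False
  then have T: "0 < T" using T by simp
  show ?thesis
  proof (rule field_le_epsilon)
    fix \<epsilon>' :: real assume "\<epsilon>' > 0"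
    \<comment> \<open>Each step of the partition incurs two errors of relative size \<epsilon>, one
      from the approximate derivative and one from the oscillation of \<open>D\<close>; together
      they add up to 2 \<epsilon> T.\<close>
    define \<epsilon> where "\<epsilon> = \<epsilon>' / (2 * T)"
    have \<epsilon>: "\<epsilon> > 0" using \<open>\<epsilon>' > 0\<close> T by (simp add: \<epsilon>_def)
    obtain \<delta> where \<delta>: "\<delta> > 0" "\<And>s t. 0 < s \<Longrightarrow> s < \<delta> \<Longrightarrow> 0 \<le> t \<Longrightarrow> \<bar>g (t + s) - g t - s * D t\<bar> \<le> s * (e + \<epsilon>)"
      using right[OF \<epsilon>] by blast
    have "uniformly_continuous_on {0..T} D"
      by (intro compact_uniformly_continuous continuous_on_subset[OF D]) auto
    then obtain \<delta>' where \<delta>': "\<delta>' > 0"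
      "\<And>s t. s \<in> {0..T} \<Longrightarrow> t \<in> {0..T} \<Longrightarrow> \<bar>s - t\<bar> < \<delta>' \<Longrightarrow> \<bar>D s - D t\<bar> < \<epsilon>"
      using \<epsilon> unfolding uniformly_continuous_on_def dist_real_def by (metis abs_minus_commute)
    obtain N :: nat where N: "T / min \<delta> \<delta>' < real N" using reals_Archimedean2 by blast
    have min: "0 < min \<delta> \<delta>'" using \<delta> \<delta>' by simp
    with T N have "N > 0" by (metis divide_pos_pos gr0I of_nat_0 order_less_asym)
    define h where "h = T / real N"
    have "h < min \<delta> \<delta>'"
      using iffD1[OF pos_divide_less_eq[OF min] N] \<open>N > 0\<close>
      unfolding h_def by (subst pos_divide_less_eq) (simp_all add: mult.commute)
    moreover have "0 < h" using T \<open>N > 0\<close> by (simp add: h_def)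
    ultimately have h: "0 < h" "h < \<delta>" "h < \<delta>'" by auto
    have hN: "real N * h = T" using \<open>N > 0\<close> by (simp add: h_def)
    have int: "D integrable_on {a..b}" if "0 \<le> a" for a b
      by (intro integrable_continuous_interval continuous_on_subset[OF D]) (use that in auto)
    have "\<bar>g (real k * h) - g 0 - integral {0..real k * h} D\<bar> \<le> real k * (h * (e + 2 * \<epsilon>))" if "k \<le> N" for k
      using that
    proof (induction k)
      case (Suc k)
      define t where "t = real k * h"
      have t: "0 \<le> t" "t + h \<le> T" "real (Suc k) * h = t + h"
        using h Suc.prems mult_right_mono[of "real (Suc k)" "real N" h]
        unfolding t_def hN[symmetric] by (auto simp: algebra_simps)
      have "\<bar>integral {t..t+h} D - h * D t\<bar> = \<bar>integral {t..t+h} (\<lambda>s. D s - D t)\<bar>"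
        using int[OF t(1), of "t + h"] h by (subst integral_diff) auto
      also have "\<dots> \<le> \<epsilon> * (t + h - t)"
      proof -
        have "norm (integral (cbox t (t+h)) (\<lambda>s. D s - D t)) \<le> \<epsilon> * measure lborel (cbox t (t+h))"
        proof (rule integrable_bound)
          show "(\<lambda>s. D s - D t) integrable_on cbox t (t+h)"
            using int[OF t(1), of "t + h"] by (auto intro: integrable_diff)
          show "norm (D s - D t) \<le> \<epsilon>" if "s \<in> cbox t (t+h)" for s
            using \<delta>'(2)[of s t] that t h by (auto simp: less_imp_le)
        qed (use \<epsilon> in simp)
        then show ?thesis using h by simp
      qed
      finally have 1: "\<bar>integral {t..t+h} D - h * D t\<bar> \<le> h * \<epsilon>" by (simp add: mult.commute)
      have 2: "integral {0..t+h} D = integral {0..t} D + integral {t..t+h} D"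
        by (rule Henstock_Kurzweil_Integration.integral_combine[symmetric]) (use t h int in auto)
      have 3: "\<bar>g (t + h) - g t - h * D t\<bar> \<le> h * (e + \<epsilon>)" by (rule \<delta>(2)) (use h t in auto)
      have 4: "\<bar>g t - g 0 - integral {0..t} D\<bar> \<le> real k * (h * (e + 2 * \<epsilon>))"
        using Suc by (simp add: t_def)
      have tri: "\<bar>a' - g0 - (I + J)\<bar> \<le> K + (y + x)"
        if "\<bar>J - d\<bar> \<le> x" "\<bar>a' - a - d\<bar> \<le> y" "\<bar>a - g0 - I\<bar> \<le> K" for a a' g0 I J d x y K :: real
        using that by linarith
      have 5: "real (Suc k) * (h * (e + 2 * \<epsilon>)) = real k * (h * (e + 2 * \<epsilon>)) + (h * (e + \<epsilon>) + h * \<epsilon>)"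
        by (simp add: algebra_simps)
      show ?case unfolding t(3) 2 5 by (rule tri[OF 1 3 4])
    qed simp
    from this[OF order_refl] have "\<bar>g T - g 0 - integral {0..T} D\<bar> \<le> real N * h * (e + 2 * \<epsilon>)"
      unfolding hN by (simp only: mult.assoc[symmetric] hN)
    also have "\<dots> = e * T + \<epsilon>'" unfolding hN using T by (simp add: \<epsilon>_def field_simps)
    finally show "\<bar>g T - g 0 - integral {0..T} D\<bar> \<le> e * T + \<epsilon>'" .
  qed
qed simp

context gibbs_process
begin

lemma sine_fun_measurable [measurable]: "sine_fun A k \<phi> x \<in> borel_measurable config_space"
  unfolding sine_fun_def by measurable

lemma finite_measure_gibbs: "finite_measure (gibbs \<beta>)"
  using prob_space_gibbs[OF \<beta>_pos] by (simp add: prob_space_def)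

lemma measurable_gibbs: "f \<in> borel_measurable config_space \<Longrightarrow> f \<in> borel_measurable (gibbs \<beta>)"
  by (simp add: measurable_cong_sets[OF sets_gibbs refl])

lemma L2_bounded:
  assumes "f \<in> borel_measurable config_space" "\<And>\<sigma>. \<bar>f \<sigma>\<bar> \<le> C"
  shows "L2 (gibbs \<beta>) f"
  using assms(2)
  by (intro L2_bound[OF L2_const[OF finite_measure_gibbs, of C] measurable_gibbs[OF assms(1)]])
     (meson abs_ge_self order_trans)

lemma L2_coord': "L2 (gibbs \<beta>) (\<lambda>\<sigma>. \<sigma> x)"
  by (rule L2_coord[OF \<beta>_pos])

lemma L2_sine_fun: "L2 (gibbs \<beta>) (sine_fun A k \<phi> x)"
  by (rule L2_bounded[OF sine_fun_measurable bounded_sine_fun])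

lemma L2_gen_sine_fun: "L2 (gibbs \<beta>) (gen_L \<gamma> lam (sine_fun R k 0 x))"
proof -
  have "L2 (gibbs \<beta>) (\<lambda>\<sigma>. (\<sigma> (x + 1) - \<sigma> (x - 1)) * (R * k * cos (k * \<sigma> x)))"
  proof (rule L2_bound[OF L2_cmult[of _ _ "R * k"]])
    show "L2 (gibbs \<beta>) (\<lambda>\<sigma>. \<sigma> (x + 1) - \<sigma> (x - 1))" by (intro L2_diff L2_coord')
    show "(\<lambda>\<sigma>. (\<sigma> (x + 1) - \<sigma> (x - 1)) * (R * k * cos (k * \<sigma> x))) \<in> borel_measurable (gibbs \<beta>)"
      by (rule measurable_gibbs) measurable
    show "\<bar>(\<sigma> (x + 1) - \<sigma> (x - 1)) * (R * k * cos (k * \<sigma> x))\<bar> \<le> \<bar>R * k * (\<sigma> (x + 1) - \<sigma> (x - 1))\<bar>" for \<sigma>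
      using mult_left_le[OF abs_cos_le_one, of "\<bar>R * k * (\<sigma> (x + 1) - \<sigma> (x - 1))\<bar>" "k * \<sigma> x"]
      by (simp add: abs_mult mult_ac)
  qed
  then show ?thesis
    unfolding gen_L_sine_fun[abs_def] by (intro L2_add L2_diff L2_cmult L2_sine_fun)
qed

text \<open>The generator describes the quotient at time 0 only. The Markov property replaces
  \<open>f\<close> at time \<open>t + s\<close> by \<open>P s f\<close> at time \<open>t\<close>,
  and stationarity bounds the error there by its norm under the Gibbs measure, so one
  \<open>\<delta>\<close> serves all \<open>t\<close>.\<close>

lemma corr_right_derivative:
  assumes f: "smooth_fun f" "local_fun f" "f \<in> borel_measurable config_space" "\<And>\<sigma>. \<bar>f \<sigma>\<bar> \<le> C"
    and L: "L2 (gibbs \<beta>) (gen_L \<gamma> lam f)" and G: "L2 (gibbs \<beta>) G" and \<epsilon>: "\<epsilon> > 0"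
  shows "\<exists>\<delta>>0. \<forall>s t. 0 < s \<longrightarrow> s < \<delta> \<longrightarrow> 0 \<le> t \<longrightarrow>
    \<bar>corr (t + s) f G - corr t f G - s * corr t (gen_L \<gamma> lam f) G\<bar> \<le> s * \<epsilon>"
proof -
  let ?g = "gen_L \<gamma> lam f"
  define q where "q s \<sigma> = (P s f \<sigma> - f \<sigma>) / s - ?g \<sigma>" for s \<sigma>
  \<comment> \<open>Adding 1 avoids a division by zero when \<open>G\<close> has norm 0.\<close>
  define \<epsilon>' where "\<epsilon>' = \<epsilon> / (1 + L2norm (gibbs \<beta>) G)"
  have G0: "0 \<le> L2norm (gibbs \<beta>) G" by (rule L2norm_nonneg)
  have \<epsilon>': "\<epsilon>' > 0" "\<epsilon>' * L2norm (gibbs \<beta>) G \<le> \<epsilon>"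
    using \<epsilon> G0 by (auto simp: \<epsilon>'_def field_simps)
  have Gm: "G \<in> borel_measurable config_space"
    using L2_measurable[OF G] by (simp add: measurable_cong_sets[OF sets_gibbs refl])
  have "bounded (range f)" using f(4) by (auto simp: bounded_iff)
  from generator[OF f(1,2) this L2_square[OF L]]
  have "((\<lambda>s. \<integral>\<^sup>+\<sigma>. ennreal ((q s \<sigma>)\<^sup>2) \<partial>gibbs \<beta>) \<longlongrightarrow> 0) (at_right 0)"
    by (simp add: L2_generator_def q_def P_def)
  then have "eventually (\<lambda>s. (\<integral>\<^sup>+\<sigma>. ennreal ((q s \<sigma>)\<^sup>2) \<partial>gibbs \<beta>) < ennreal (\<epsilon>'\<^sup>2)) (at_right 0)"
    by (rule order_tendstoD) (use \<epsilon>' in \<open>simp add: ennreal_less_iff\<close>)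
  then obtain \<delta> where \<delta>: "\<delta> > 0"
    "\<And>s. 0 < s \<Longrightarrow> s < \<delta> \<Longrightarrow> (\<integral>\<^sup>+\<sigma>. ennreal ((q s \<sigma>)\<^sup>2) \<partial>gibbs \<beta>) < ennreal (\<epsilon>'\<^sup>2)"
    unfolding eventually_at_right_field by auto
  have "\<bar>corr (t + s) f G - corr t f G - s * corr t ?g G\<bar> \<le> s * \<epsilon>" if s: "0 < s" "s < \<delta>" and t: "0 \<le> t" for s t
  proof -
    have Lf: "L2 (gibbs \<beta>) f" by (rule L2_bounded[OF f(3,4)])
    have LP: "L2 (gibbs \<beta>) (P s f)"
      using s by (intro L2_bounded[where C = C] P_measurable P_bound f) auto
    have Lq: "L2 (gibbs \<beta>) (q s)"
    proof -
      have "q s = (\<lambda>\<sigma>. (1 / s) * (P s f \<sigma> - f \<sigma>) - ?g \<sigma>)" by (simp add: q_def fun_eq_iff)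
      then show ?thesis using L2_diff[OF L2_cmult[OF L2_diff[OF LP Lf], of "1 / s"] L] by simp
    qed
    have "L2norm (gibbs \<beta>) (q s) \<le> \<epsilon>'"
      unfolding L2norm_def
    proof (rule real_le_lsqrt)
      have "ennreal (LINT \<sigma>|gibbs \<beta>. (q s \<sigma>)\<^sup>2) < ennreal (\<epsilon>'\<^sup>2)"
        using \<delta>(2)[OF s] by (subst nn_integral_eq_integral[symmetric]) (auto intro: L2_square[OF Lq])
      then show "(LINT \<sigma>|gibbs \<beta>. (q s \<sigma>)\<^sup>2) \<le> \<epsilon>'\<^sup>2"
        using \<epsilon>' by (simp add: ennreal_less_iff)
    qed (use \<epsilon>' in auto)
    have "corr (t + s) f G = corr t (P s f) G"
      unfolding corr_def
    proof (rule markov_bounded[OF t _ _ _ f(3,4)])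
      show "0 \<le> s" using s by simp
      show "(\<lambda>w. G (X 0 w)) \<in> borel_measurable (natural_filtration M X t)"
        by (rule measurable_compose[OF X_adapted Gm]) (use t in auto)
      show "integrable M (\<lambda>w. G (X 0 w))"
        by (rule L2_integrable[OF _ L2_X(1)[OF order_refl G]]) unfold_locales
    qed
    moreover have "P s f = (\<lambda>\<sigma>. f \<sigma> + (s * ?g \<sigma> + s * q s \<sigma>))"
      using s by (simp add: q_def fun_eq_iff field_simps)
    ultimately have "corr (t + s) f G - corr t f G - s * corr t ?g G = s * corr t (q s) G"
      using t Lf L Lq G by (simp add: corr_add corr_cmult L2_add L2_cmult)
    also have "\<bar>\<dots>\<bar> \<le> s * \<epsilon>"
    proof -
      have "\<bar>corr t (q s) G\<bar> \<le> L2norm (gibbs \<beta>) (q s) * L2norm (gibbs \<beta>) G" by (rule corr_bound[OF t Lq G])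
      also have "\<dots> \<le> \<epsilon>' * L2norm (gibbs \<beta>) G" by (rule mult_right_mono) fact+
      finally show ?thesis using s \<epsilon>' by (simp add: abs_mult)
    qed
    finally show ?thesis .
  qed
  with \<delta>(1) show ?thesis by blast
qed

definition trunc :: "nat \<Rightarrow> int \<Rightarrow> config \<Rightarrow> real" where
  "trunc m x = sine_fun (real (Suc m)) (1 / real (Suc m)) 0 x"

lemma L2_trunc: "L2 (gibbs \<beta>) (trunc m x)" unfolding trunc_def by (rule L2_sine_fun)

lemma L2_gen_trunc: "L2 (gibbs \<beta>) (gen_L \<gamma> lam (trunc m x))" unfolding trunc_def by (rule L2_gen_sine_fun)

lemma trunc_le: "\<bar>trunc m x \<sigma>\<bar> \<le> \<bar>\<sigma> x\<bar>"
proof -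
  have "\<bar>trunc m x \<sigma>\<bar> = real (Suc m) * \<bar>sin (\<sigma> x / real (Suc m))\<bar>"
    by (simp add: trunc_def sine_fun_def abs_mult del: of_nat_Suc)
  also have "\<dots> \<le> real (Suc m) * \<bar>\<sigma> x / real (Suc m)\<bar>"
    by (intro mult_left_mono abs_sin_x_le_abs_x) simp
  finally show ?thesis by (simp add: abs_divide del: of_nat_Suc)
qed

lemma trunc_tendsto: "(\<lambda>m. trunc m x \<sigma>) \<longlonglongrightarrow> \<sigma> x"
  using LIMSEQ_scaled_sin[of "\<sigma> x"] by (simp add: trunc_def sine_fun_def)

lemma trunc_L2_tendsto: "(\<lambda>m. L2norm (gibbs \<beta>) (\<lambda>\<sigma>. trunc m x \<sigma> - \<sigma> x)) \<longlonglongrightarrow> 0"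
proof (rule L2norm_dominated)
  show "L2 (gibbs \<beta>) (\<lambda>\<sigma>. \<bar>\<sigma> x\<bar>)"
    by (rule L2_bound[OF L2_coord'[of x]]) (auto intro: measurable_gibbs)
qed (auto intro: trunc_le trunc_tendsto L2_measurable[OF L2_trunc] L2_measurable[OF L2_coord'])

lemma gen_trunc:
  "gen_L \<gamma> lam (trunc m x) \<sigma> = (\<sigma> (x + 1) - \<sigma> (x - 1)) * cos (1 / real (Suc m) * \<sigma> x)
     - 2 * \<gamma> * trunc m x \<sigma> + lam * (trunc m (x + 1) \<sigma> + trunc m (x - 1) \<sigma> - 2 * trunc m x \<sigma>)"
  unfolding trunc_def gen_L_sine_fun by simp

lemma L2_lattice_op: "L2 (gibbs \<beta>) (\<lambda>\<sigma>. lattice_op \<gamma> lam \<sigma> x)"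
  unfolding lattice_op_def by (intro L2_add L2_diff L2_cmult L2_coord')

text \<open>The slope of the truncation is a cosine, at most 1 in absolute value and tending to 1,
  so the images under the generator converge pointwise and are dominated by one square-integrable
  function.\<close>

lemma gen_trunc_L2_tendsto:
  "(\<lambda>m. L2norm (gibbs \<beta>) (\<lambda>\<sigma>. gen_L \<gamma> lam (trunc m x) \<sigma> - lattice_op \<gamma> lam \<sigma> x)) \<longlonglongrightarrow> 0"
proof (rule L2norm_dominated)
  let ?H = "\<lambda>\<sigma>::config. (\<bar>\<sigma> (x + 1)\<bar> + \<bar>\<sigma> (x - 1)\<bar>) + 2 * \<bar>\<gamma>\<bar> * \<bar>\<sigma> x\<bar>
      + \<bar>lam\<bar> * (\<bar>\<sigma> (x + 1)\<bar> + \<bar>\<sigma> (x - 1)\<bar> + 2 * \<bar>\<sigma> x\<bar>)"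
  have "L2 (gibbs \<beta>) (\<lambda>\<sigma>. \<bar>\<sigma> x\<bar>)" for x
    by (rule L2_bound[OF L2_coord'[of x]]) (auto intro: measurable_gibbs)
  then show "L2 (gibbs \<beta>) ?H" by (intro L2_add L2_cmult) auto
  show "gen_L \<gamma> lam (trunc m x) \<in> borel_measurable (gibbs \<beta>)" for m
    by (rule L2_measurable[OF L2_gen_trunc])
  show "(\<lambda>\<sigma>. lattice_op \<gamma> lam \<sigma> x) \<in> borel_measurable (gibbs \<beta>)"
    by (rule L2_measurable[OF L2_lattice_op])
  show "(\<lambda>m. gen_L \<gamma> lam (trunc m x) \<sigma>) \<longlonglongrightarrow> lattice_op \<gamma> lam \<sigma> x" for \<sigma>
  proof -
    have "(\<lambda>m. gen_L \<gamma> lam (trunc m x) \<sigma>) \<longlonglongrightarrow> (\<sigma> (x + 1) - \<sigma> (x - 1)) * 1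
     - 2 * \<gamma> * \<sigma> x + lam * (\<sigma> (x + 1) + \<sigma> (x - 1) - 2 * \<sigma> x)"
      unfolding gen_trunc by (intro tendsto_intros LIMSEQ_scaled_cos trunc_tendsto)
    then show ?thesis by (simp add: lattice_op_def)
  qed
  show "\<bar>gen_L \<gamma> lam (trunc m x) \<sigma>\<bar> \<le> ?H \<sigma>" for m \<sigma>
  proof -
    have tri: "\<bar>A - B + C\<bar> \<le> a + b + c" if "\<bar>A\<bar> \<le> a" "\<bar>B\<bar> \<le> b" "\<bar>C\<bar> \<le> c" for A B C a b c :: real
      using that by linarith
    have "\<bar>(\<sigma> (x + 1) - \<sigma> (x - 1)) * cos (1 / real (Suc m) * \<sigma> x)\<bar> \<le> \<bar>\<sigma> (x + 1) - \<sigma> (x - 1)\<bar>"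
      unfolding abs_mult by (rule mult_left_le) auto
    then have "\<bar>(\<sigma> (x + 1) - \<sigma> (x - 1)) * cos (1 / real (Suc m) * \<sigma> x)\<bar> \<le> \<bar>\<sigma> (x + 1)\<bar> + \<bar>\<sigma> (x - 1)\<bar>"
      using abs_triangle_ineq4 order_trans by blast
    moreover have "\<bar>2 * \<gamma> * trunc m x \<sigma>\<bar> \<le> 2 * \<bar>\<gamma>\<bar> * \<bar>\<sigma> x\<bar>"
      using trunc_le[of m x \<sigma>] by (simp add: abs_mult mult_left_mono)
    moreover have "\<bar>lam * (trunc m (x + 1) \<sigma> + trunc m (x - 1) \<sigma> - 2 * trunc m x \<sigma>)\<bar>
       \<le> \<bar>lam\<bar> * (\<bar>\<sigma> (x + 1)\<bar> + \<bar>\<sigma> (x - 1)\<bar> + 2 * \<bar>\<sigma> x\<bar>)"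
      unfolding abs_mult[of lam]
      using trunc_le[of m x \<sigma>] trunc_le[of m "x + 1" \<sigma>] trunc_le[of m "x - 1" \<sigma>]
      by (intro mult_left_mono) linarith+
    ultimately show ?thesis unfolding gen_trunc by (rule tri)
  qed
qed

text \<open>The coordinate is unbounded, so its correlation is reached from the truncated ones:
  their approximate right derivatives give an integral equation with an error vanishing in the
  limit, and its continuous integrand makes the limit differentiable.\<close>

lemma corr_coord_ode:
  assumes G: "L2 (gibbs \<beta>) G" and t: "0 \<le> t"
  shows "((\<lambda>t. corr t (\<lambda>\<sigma>. \<sigma> x) G) has_real_derivative
      lattice_op \<gamma> lam (\<lambda>z. corr t (\<lambda>\<sigma>. \<sigma> z) G) x) (at t within {0..})"
proof -
  let ?N = "L2norm (gibbs \<beta>) G"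
  define u where "u t z = corr t (\<lambda>\<sigma>. \<sigma> z) G" for t z
  define um where "um m t z = corr t (trunc m z) G" for m t z
  have um_near: "\<bar>um m t z - u t z\<bar> \<le> L2norm (gibbs \<beta>) (\<lambda>\<sigma>. trunc m z \<sigma> - \<sigma> z) * ?N" if "0 \<le> t" for m t z
    using corr_bound[OF that L2_diff[OF L2_trunc L2_coord'] G, of m z z] that
    by (simp add: corr_diff L2_trunc L2_coord' G um_def u_def)
  have right: "\<exists>\<delta>>0. \<forall>s t. 0 < s \<longrightarrow> s < \<delta> \<longrightarrow> 0 \<le> t \<longrightarrow>
    \<bar>um m (t + s) z - um m t z - s * corr t (gen_L \<gamma> lam (trunc m z)) G\<bar> \<le> s * \<epsilon>" if "\<epsilon> > 0" for m z \<epsilon>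
    unfolding um_def
    by (rule corr_right_derivative[where C = "real (Suc m)"])
       (use that G in \<open>auto simp: trunc_def intro: smooth_sine_fun local_sine_fun
          order_trans[OF bounded_sine_fun] L2_gen_sine_fun[of "real (Suc m)" "1 / real (Suc m)", simplified]\<close>)
  \<comment> \<open>Since \<open>\<delta>\<close> does not depend on the starting time, the bound on
    right quotients is a Lipschitz bound between any two nearby times.\<close>
  have um_cont: "continuous_on {0..} (\<lambda>t. um m t z)" for m z
  proof -
    let ?C = "L2norm (gibbs \<beta>) (gen_L \<gamma> lam (trunc m z)) * ?N"
    obtain \<delta> where \<delta>: "\<delta> > 0" "\<And>s t. 0 < s \<Longrightarrow> s < \<delta> \<Longrightarrow> 0 \<le> t \<Longrightarrow>
      \<bar>um m (t + s) z - um m t z - s * corr t (gen_L \<gamma> lam (trunc m z)) G\<bar> \<le> s * 1"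
      using right[of 1 m z] by auto
    have C: "0 \<le> ?C" by (simp add: L2norm_nonneg)
    have lip: "\<bar>um m (t + s) z - um m t z\<bar> \<le> s * (1 + ?C)" if "0 \<le> t" "0 < s" "s < \<delta>" for s t
    proof -
      have "\<bar>corr t (gen_L \<gamma> lam (trunc m z)) G\<bar> \<le> ?C" by (rule corr_bound[OF that(1) L2_gen_trunc G])
      then have "\<bar>s * corr t (gen_L \<gamma> lam (trunc m z)) G\<bar> \<le> s * ?C"
        using that by (simp add: abs_mult)
      with \<delta>(2)[of s t] that show ?thesis by (simp add: distrib_left)
    qed
    show ?thesis
    proof (rule uniformly_continuous_imp_continuous, unfold uniformly_continuous_on_def dist_real_def, intro allI impI)
      fix \<epsilon> :: real assume "\<epsilon> > 0"
      have "\<bar>um m t' z - um m t z\<bar> < \<epsilon>"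
        if "0 \<le> t" "0 \<le> t'" "\<bar>t' - t\<bar> < min \<delta> (\<epsilon> / (1 + ?C))" for t t'
      proof -
        have "\<bar>um m t' z - um m t z\<bar> \<le> \<bar>t' - t\<bar> * (1 + ?C)"
          using lip[of t "t' - t"] lip[of t' "t - t'"] that by (cases t t' rule: linorder_cases) auto
        also have "\<dots> < \<epsilon>" using that C by (simp add: field_simps)
        finally show ?thesis .
      qed
      then show "\<exists>d>0. \<forall>t\<in>{0..}. \<forall>t'\<in>{0..}. \<bar>t' - t\<bar> < d \<longrightarrow> \<bar>um m t' z - um m t z\<bar> < \<epsilon>"
        using \<open>\<epsilon> > 0\<close> \<delta> C by (intro exI[of _ "min \<delta> (\<epsilon> / (1 + ?C))"]) auto
    qed
  qed
  \<comment> \<open>The truncation error is bounded independently of \<open>t\<close>, so the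
    convergence is uniform and continuity survives.\<close>
  have u_cont: "continuous_on {0..} (\<lambda>t. u t z)" for z
  proof (rule uniform_limit_theorem)
    show "\<forall>\<^sub>F m in sequentially. continuous_on {0..} (\<lambda>t. um m t z)" using um_cont by simp
    show "uniform_limit {0..} (\<lambda>m t. um m t z) (\<lambda>t. u t z) sequentially"
    proof (rule uniform_limitI)
      fix \<epsilon> :: real assume "\<epsilon> > 0"
      have "(\<lambda>m. L2norm (gibbs \<beta>) (\<lambda>\<sigma>. trunc m z \<sigma> - \<sigma> z) * ?N) \<longlonglongrightarrow> 0"
        using tendsto_mult[OF trunc_L2_tendsto tendsto_const] by simp
      then have "\<forall>\<^sub>F m in sequentially. L2norm (gibbs \<beta>) (\<lambda>\<sigma>. trunc m z \<sigma> - \<sigma> z) * ?N < \<epsilon>"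
        by (rule order_tendstoD) fact
      then show "\<forall>\<^sub>F m in sequentially. \<forall>t\<in>{0..}. dist (um m t z) (u t z) < \<epsilon>"
        by eventually_elim (use um_near in \<open>auto simp: dist_real_def intro: le_less_trans\<close>)
    qed
  qed simp
  let ?D = "\<lambda>t. lattice_op \<gamma> lam (u t) x"
  have D_cont: "continuous_on {0..} ?D"
    unfolding lattice_op_def by (intro continuous_intros u_cont)
  have corr_op: "corr t (\<lambda>\<sigma>. lattice_op \<gamma> lam \<sigma> x) G = ?D t" if "0 \<le> t" for t
    unfolding lattice_op_def u_def using that G
    by (simp add: corr_add corr_diff corr_cmult L2_add L2_diff L2_cmult L2_coord')
  have u_eq: "u T x - u 0 x = integral {0..T} ?D" if T: "0 \<le> T" for T
  proof -
    let ?e = "\<lambda>m. L2norm (gibbs \<beta>) (\<lambda>\<sigma>. gen_L \<gamma> lam (trunc m x) \<sigma> - lattice_op \<gamma> lam \<sigma> x) * ?N"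
    let ?d = "\<lambda>m. L2norm (gibbs \<beta>) (\<lambda>\<sigma>. trunc m x \<sigma> - \<sigma> x) * ?N"
    have near: "\<bar>um m T x - um m 0 x - integral {0..T} ?D\<bar> \<le> ?e m * T" for m
    proof (rule approximate_FTC[OF D_cont _ T])
      fix \<epsilon> :: real assume "\<epsilon> > 0"
      then obtain \<delta> where \<delta>: "\<delta> > 0" "\<And>s t. 0 < s \<Longrightarrow> s < \<delta> \<Longrightarrow> 0 \<le> t \<Longrightarrow>
        \<bar>um m (t + s) x - um m t x - s * corr t (gen_L \<gamma> lam (trunc m x)) G\<bar> \<le> s * \<epsilon>"
        using right[of \<epsilon> m x] by blast
      have "\<bar>um m (t + s) x - um m t x - s * ?D t\<bar> \<le> s * (?e m + \<epsilon>)" if s: "0 < s" "s < \<delta>" and t: "0 \<le> t" for s t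
      proof -
        have "\<bar>corr t (gen_L \<gamma> lam (trunc m x)) G - ?D t\<bar> \<le> ?e m"
          using corr_bound[OF t L2_diff[OF L2_gen_trunc L2_lattice_op] G, of m x x] t
          by (simp add: corr_diff L2_gen_trunc L2_lattice_op G corr_op)
        then have "\<bar>s * corr t (gen_L \<gamma> lam (trunc m x)) G - s * ?D t\<bar> \<le> s * ?e m"
          using s by (simp add: abs_mult flip: right_diff_distrib)
        with \<delta>(2)[OF s t] show ?thesis by (simp add: distrib_left)
      qed
      with \<delta>(1) show "\<exists>\<delta>>0. \<forall>s t. 0 < s \<longrightarrow> s < \<delta> \<longrightarrow> 0 \<le> t \<longrightarrow>
          \<bar>um m (t + s) x - um m t x - s * ?D t\<bar> \<le> s * (?e m + \<epsilon>)" by blast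
    qed
    have *: "\<bar>u T x - u 0 x - integral {0..T} ?D\<bar> \<le> 2 * ?d m + ?e m * T" for m
      using near[of m] um_near[OF T, of m x] um_near[OF order_refl, of m x] by linarith
    have "(\<lambda>m. 2 * ?d m + ?e m * T) \<longlonglongrightarrow> 2 * (0 * ?N) + (0 * ?N) * T"
      by (intro tendsto_intros trunc_L2_tendsto gen_trunc_L2_tendsto)
    then have "\<bar>u T x - u 0 x - integral {0..T} ?D\<bar> \<le> 2 * (0 * ?N) + (0 * ?N) * T"
      by (rule LIMSEQ_le_const) (use * in auto)
    then show ?thesis by simp
  qed
  have u_eq': "u 0 x + integral {0..T} ?D = u T x" if "0 \<le> T" for T
    using u_eq[OF that] by linarith
  \<comment> \<open>A compact interval reaching beyond \<open>t\<close> agrees with the half-line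
    near \<open>t\<close>, also in the one-sided case \<open>t = 0\<close>.\<close>
  have "((\<lambda>T. integral {0..T} ?D) has_real_derivative ?D t) (at t within {0..t + 1})"
    by (rule integral_has_real_derivative[OF continuous_on_subset[OF D_cont]]) (use t in auto)
  then have "((\<lambda>T. u 0 x + integral {0..T} ?D) has_real_derivative ?D t) (at t within {0..t + 1})"
    by (auto intro!: derivative_eq_intros)
  then have "((\<lambda>T. u T x) has_real_derivative ?D t) (at t within {0..t + 1})"
    by (rule has_field_derivative_transform_within[OF _ zero_less_one]) (use t u_eq' in auto)
  moreover have "at t within {0..} = at t within {0..t + 1}"
    by (rule at_within_nhd[of _ "{..<t + 1}"]) auto
  moreover have "u = (\<lambda>t z. corr t (\<lambda>\<sigma>. \<sigma> z) G)" by (simp add: u_def fun_eq_iff)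
  ultimately show ?thesis by simp
qed

end

section \<open>The scaling regimes\<close>

context gibbs_process
begin

lemma L2_linear: "finite A \<Longrightarrow> L2 (gibbs \<beta>) (\<lambda>\<sigma>. \<Sum>x\<in>A. \<phi> x * \<sigma> x)"
proof (induction A rule: finite_induct)
  case empty
  show ?case using L2_const[OF finite_measure_gibbs, of 0] by simp
next
  case (insert x A)
  have "L2 (gibbs \<beta>) (\<lambda>\<sigma>. \<phi> x * \<sigma> x + (\<Sum>x\<in>A. \<phi> x * \<sigma> x))"
    by (rule L2_add[OF L2_cmult[OF L2_coord'] insert.IH])
  then show ?case using insert.hyps by simp
qed

lemma L2norm_linear:
  assumes "finite A"
  shows "L2norm (gibbs \<beta>) (\<lambda>\<sigma>. \<Sum>x\<in>A. \<phi> x * \<sigma> x) = sqrt (\<Sum>x\<in>A. (\<phi> x)\<^sup>2) / sqrt \<beta>"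
proof -
  have i: "integrable (gibbs \<beta>) (\<lambda>\<sigma>. \<sigma> x * \<sigma> y)" for x y
    by (rule L2_mult_integrable[OF L2_coord' L2_coord'])
  have "(LINT \<sigma>|gibbs \<beta>. (\<Sum>x\<in>A. \<phi> x * \<sigma> x)\<^sup>2)
      = (LINT \<sigma>|gibbs \<beta>. (\<Sum>x\<in>A. \<Sum>y\<in>A. \<phi> x * \<phi> y * (\<sigma> x * \<sigma> y)))"
    by (simp add: power2_eq_square sum_product mult_ac)
  also have "\<dots> = (\<Sum>x\<in>A. \<Sum>y\<in>A. \<phi> x * \<phi> y * (of_bool (x = y) / \<beta>))"
    using i by (simp add: gibbs_covariance[OF \<beta>_pos])
  also have "\<dots> = (\<Sum>x\<in>A. (\<phi> x)\<^sup>2 / \<beta>)"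
  proof (rule sum.cong[OF refl])
    fix x assume "x \<in> A"
    have "(\<Sum>y\<in>A. \<phi> x * \<phi> y * (of_bool (x = y) / \<beta>)) = (\<Sum>y\<in>A. if x = y then (\<phi> x)\<^sup>2 / \<beta> else 0)"
      by (rule sum.cong) (auto simp: power2_eq_square)
    with \<open>x \<in> A\<close> show "(\<Sum>y\<in>A. \<phi> x * \<phi> y * (of_bool (x = y) / \<beta>)) = (\<phi> x)\<^sup>2 / \<beta>"
      using assms by simp
  qed
  finally show ?thesis by (simp add: L2norm_def real_sqrt_divide flip: sum_divide_distrib)
qed

text \<open>The bilinear bound is Cauchy-Schwarz for two finite linear combinations of coordinates;
  by orthogonality each has its coefficient norm divided by sqrt \<beta> as norm.\<close>

lemma two_point_lattice_correlation:
  assumes "0 \<le> \<gamma>" "0 \<le> lam"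
  shows "lattice_correlation \<beta> \<gamma> lam (\<lambda>t x y. LINT w|M. X t w x * X 0 w y)"
proof
  have u: "(LINT w|M. X t w x * X 0 w y) = corr t (\<lambda>\<sigma>. \<sigma> x) (\<lambda>\<sigma>. \<sigma> y)" for t x y
    by (simp add: corr_def)
  show "(LINT w|M. X 0 w x * X 0 w y) = of_bool (x = y) / \<beta>" for x y
    unfolding u corr_0[OF L2_coord' L2_coord'] by (rule gibbs_covariance[OF \<beta>_pos])
  show "((\<lambda>t. LINT w|M. X t w x * X 0 w y) has_real_derivative
      lattice_op \<gamma> lam (\<lambda>z. LINT w|M. X t w z * X 0 w y) x) (at t within {0..})" if "0 \<le> t" for t x y
    unfolding u by (rule corr_coord_ode[OF L2_coord' that])
  show "\<bar>\<Sum>x\<in>A. \<Sum>y\<in>B. \<phi> x * g y * (LINT w|M. X t w x * X 0 w y)\<bar>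
      \<le> sqrt (\<Sum>x\<in>A. (\<phi> x)\<^sup>2) * sqrt (\<Sum>y\<in>B. (g y)\<^sup>2) / \<beta>"
    if t: "0 \<le> t" and fin: "finite A" "finite B" for t A B \<phi> g
  proof -
    have i: "integrable M (\<lambda>w. X t w x * X 0 w y)" for x y
      using corr_integrable[OF t L2_coord' L2_coord'] .
    have "corr t (\<lambda>\<sigma>. \<Sum>x\<in>A. \<phi> x * \<sigma> x) (\<lambda>\<sigma>. \<Sum>y\<in>B. g y * \<sigma> y)
        = (LINT w|M. (\<Sum>x\<in>A. \<Sum>y\<in>B. \<phi> x * g y * (X t w x * X 0 w y)))"
      by (simp add: corr_def sum_product mult_ac)
    also have "\<dots> = (\<Sum>x\<in>A. \<Sum>y\<in>B. \<phi> x * g y * (LINT w|M. X t w x * X 0 w y))"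
      using i by simp
    finally show ?thesis
      using corr_bound[OF t L2_linear[OF fin(1)] L2_linear[OF fin(2)], of \<phi> g] \<beta>_pos
      by (simp add: L2norm_linear fin)
  qed
qed (use assms \<beta>_pos in auto)

end

context lattice_correlation
begin

lemma Q_infsum:
  assumes "integrable sites \<phi>" "integrable sites g" "0 \<le> t"
  shows "(\<Sum>\<^sub>\<infinity>(x, y)\<in>UNIV. \<phi> x * g y * u t x y) = Q t \<phi> g"
proof -
  have "integrable site_pairs (\<lambda>p. \<phi> (fst p) * g (snd p) * u t (fst p) (snd p))"
    using Q_integrable[OF assms, of 0] by simp
  then show ?thesis
    using infsetsum_infsum[of "\<lambda>p. \<phi> (fst p) * g (snd p) * u t (fst p) (snd p)" UNIV]
    by (simp add: Infinite_Set_Sum.abs_summable_on_def infsetsum_def Q_def case_prod_beta')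
qed

end

section \<open>Powers of the scaling parameter\<close>

lemma powr_divide_power: "real n powr p / real n ^ k = real n powr (p - real k)"
  by (cases "n = 0") (simp_all add: powr_diff powr_realpow)

lemma scaled_powr_divide:
  "K * real n powr p / real n = K * real n powr (p - 1)"
  "K * real n powr p / (real n)\<^sup>2 = K * real n powr (p - 2)"
  "K * real n powr p / real n ^ 3 = K * real n powr (p - 3)"
  using powr_divide_power[of n p 1] powr_divide_power[of n p 2] powr_divide_power[of n p 3]
  by (simp_all flip: times_divide_eq_right)

text \<open>Negative and zero exponents in one formula; its indicator becomes the indicator of a
  critical scale in the limits.\<close>

lemma scaled_powr_tendsto:
  assumes "p \<le> 0" shows "(\<lambda>n. K * real n powr p) \<longlonglongrightarrow> of_bool (p = 0) * K"
proof (cases "p = 0")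
  case True
  have "\<forall>\<^sub>F n in sequentially. K * real n powr p = K"
    using eventually_gt_at_top[of "0::nat"] by eventually_elim (simp add: True)
  then show ?thesis using True by (simp add: tendsto_eventually)
next
  case False
  then have "(\<lambda>n. real n powr p) \<longlonglongrightarrow> 0"
    using assms by (intro tendsto_neg_powr filterlim_real_sequentially) auto
  from tendsto_mult_right_zero[OF this] show ?thesis using False by simp
qed

lemma scaled_powr_at_top:
  assumes "0 < p" "0 < K" shows "filterlim (\<lambda>n. K * real n powr p) at_top sequentially"
proof -
  have "filterlim (\<lambda>n. real n powr p) at_top sequentially"
  proof (rule filterlim_cong[THEN iffD1, OF refl refl])
    show "\<forall>\<^sub>F n in sequentially. exp (p * ln (real n)) = real n powr p"
      using eventually_gt_at_top[of "0::nat"] by eventually_elim (simp add: powr_def)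
    show "filterlim (\<lambda>n. exp (p * ln (real n))) at_top sequentially"
      by (rule filterlim_compose[OF exp_at_top filterlim_tendsto_pos_mult_at_top[OF tendsto_const assms(1)
            filterlim_compose[OF ln_at_top filterlim_real_sequentially]]])
  qed
  then show ?thesis by (rule filterlim_tendsto_pos_mult_at_top[OF tendsto_const assms(2)])
qed

lemma exponential_ode_unique:
  fixes e :: "real \<Rightarrow> real"
  assumes "\<And>s. 0 \<le> s \<Longrightarrow> (e has_real_derivative k * e s) (at s within {0..})" "0 \<le> t"
  shows "e t = exp (k * t) * e 0"
proof -
  have "((\<lambda>s. e s * exp (- k * s)) has_real_derivative 0) (at s within {0..})" if "s \<in> {0..}" for s
  proof -
    have "((\<lambda>s. exp (- k * s)) has_real_derivative - k * exp (- k * s)) (at s within {0..})"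
      by (auto intro!: derivative_eq_intros)
    from DERIV_mult[OF assms(1) this] that show ?thesis by (simp add: algebra_simps)
  qed
  then have "\<exists>C. \<forall>s\<in>{0..}. e s * exp (- k * s) = C"
    by (intro has_field_derivative_zero_constant) auto
  then obtain C where C: "\<And>s. s \<in> {0..} \<Longrightarrow> e s * exp (- k * s) = C" by blast
  have "e t * exp (- k * t) = e 0 * exp (- k * 0)" using C[of t] C[of 0] assms(2) by simp
  then show ?thesis by (simp add: exp_minus field_simps)
qed

lemma dist_pairing_fundamental_solution:
  assumes f: "schwartz f" and h: "schwartz h" and lam: "0 \<le> lam" and t: "0 \<le> t"
    and G: "G = drift_diffusion \<alpha> lam \<kappa>"
  shows "dist_pairing (fundamental_solution G t) f h
    = exp (- (\<kappa> * t)) * (LINT y|lborel. gauss (- (\<alpha> * t)) (2 * lam * t) f y * h y)"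
  unfolding dist_pairing_def
    fundamental_solution_eq_flow[OF lam G schwartz_correlation[OF f h] t] flow_def gauss_correlation[OF f h]
  by simp

locale scaled_process =
  fixes \<beta> lam c a b t :: real and f h :: "real \<Rightarrow> real"
    and M :: "nat \<Rightarrow> 'w measure" and X :: "nat \<Rightarrow> real \<Rightarrow> 'w \<Rightarrow> config"
    and K :: "nat \<Rightarrow> real \<Rightarrow> config \<Rightarrow> config measure"
  assumes pos: "\<beta> > 0" "lam > 0" "c > 0" "t > 0"
    and f: "schwartz f" and h: "schwartz h"
    and process: "n \<ge> 1 \<Longrightarrow> stationary_process \<beta> (c * real n powr (- b)) lam (M n) (X n) (K n)"
begin

definition u :: "nat \<Rightarrow> real \<Rightarrow> int \<Rightarrow> int \<Rightarrow> real" where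
  "u n s x y = (LINT w|M n. X n s w x * X n 0 w y)"

definition flip :: "nat \<Rightarrow> real" where "flip n = c * real n powr (- b)"

lemma lattice_correlation_u: "n \<ge> 1 \<Longrightarrow> lattice_correlation \<beta> (flip n) lam (u n)"
proof -
  assume n: "n \<ge> 1"
  interpret gibbs_process \<beta> "c * real n powr (- b)" lam "M n" "X n" "K n"
    by unfold_locales (use pos process[OF n] in auto)
  have "u n = (\<lambda>t x y. LINT w|M n. X n t w x * X n 0 w y)" by (simp add: u_def fun_eq_iff)
  then show ?thesis using two_point_lattice_correlation pos by (simp add: flip_def)
qed

lemma Q_scaled_infsum:
  assumes n: "n \<ge> 1" and s: "0 \<le> s"
  shows "1 / real n * (\<Sum>\<^sub>\<infinity>(x, y)\<in>UNIV. f (of_int x / real n + d) * h (of_int y / real n) * u n s x y)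
    = lattice_correlation.Q (u n) s (sample (real n) d f) (sample (real n) 0 h) / real n"
proof -
  interpret lattice_correlation \<beta> "flip n" lam "u n" by (rule lattice_correlation_u[OF n])
  have n1: "1 \<le> real n" using n by simp
  show ?thesis
    using Q_infsum[OF schwartz_sample_integrable[OF f n1, of d] schwartz_sample_integrable[OF h n1, of 0] s]
    by (simp add: sample_def)
qed

lemma eta_eq:
  assumes "n \<ge> 1" "0 \<le> s"
  shows "eta M X a f h n s = lattice_correlation.Q (u n) (s * real n powr a) (sample (real n) 0 f) (sample (real n) 0 h) / real n"
  using Q_scaled_infsum[OF assms(1), of "s * real n powr a" 0] assms by (simp add: eta_def u_def)

lemma eta_tilde_eq:
  assumes "n \<ge> 1" "0 \<le> s"
  shows "eta_tilde M X a f h n s = lattice_correlation.Q (u n) (s * real n powr a)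
    (sample (real n) (2 / real n * (s * real n powr a)) f) (sample (real n) 0 h) / real n"
  using Q_scaled_infsum[OF assms(1), of "s * real n powr a" "2 / real n * (s * real n powr a)"] assms
  by (simp add: eta_tilde_def u_def add_divide_distrib mult_ac)

lemma eventually_eq_tendsto:
  assumes "\<And>n. n \<ge> 1 \<Longrightarrow> F n = G n" "G \<longlonglongrightarrow> l" shows "F \<longlonglongrightarrow> (l::real)"
  by (rule Lim_transform_eventually[OF assms(2) eventually_sequentiallyI[of 1]]) (use assms(1) in simp)

lemma scaled_time_nonneg: "0 \<le> t * real n powr p"
  using pos by simp

lemma flip_powr: "flip n * (t * real n powr p) = (c * t) * real n powr (p - b)"
proof -
  have "real n powr (p - b) = real n powr p * real n powr (- b)" by (simp flip: powr_add)
  then show ?thesis by (simp add: flip_def)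
qed

text \<open>At lattice time t n^a the damping, the variance and the discretisation error scale as
  n^(a-b), n^(a-2) and n^(a-3). The indicators single out the exponents that are exactly
  zero.\<close>

lemma field_corr_tendsto_powr:
  assumes "a < 3" "a \<le> b" "a \<le> 2" and shift: "(\<lambda>n. \<theta> n - 2 * (t * real n powr a) / real n) \<longlonglongrightarrow> \<theta>'"
  shows "(\<lambda>n. field_corr u f h (\<lambda>n. t * real n powr a) \<theta> n)
    \<longlonglongrightarrow> 1 / \<beta> * (exp (- (of_bool (a = b) * (2 * c * t)))
          * (LINT y|lborel. gauss \<theta>' (of_bool (a = 2) * (2 * lam * t)) f y * h y))"
proof (rule field_corr_tendsto[OF lattice_correlation_u f h scaled_time_nonneg])
  show "(\<lambda>n. t * real n powr a / real n ^ 3) \<longlonglongrightarrow> 0"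
    unfolding scaled_powr_divide using scaled_powr_tendsto[of "a - 3" t] assms by simp
  have e1: "2 * flip n * (t * real n powr a) = (2 * c * t) * real n powr (a - b)" for n
    by (simp only: mult.assoc flip_powr)
  show "(\<lambda>n. 2 * flip n * (t * real n powr a)) \<longlonglongrightarrow> of_bool (a = b) * (2 * c * t)"
    unfolding e1 using scaled_powr_tendsto[of "a - b" "2 * c * t"] assms by simp
  have e2: "2 * lam * (t * real n powr a) / (real n)\<^sup>2 = (2 * lam * t) * real n powr (a - 2)" for n
    unfolding mult.assoc[symmetric] scaled_powr_divide ..
  show "(\<lambda>n. 2 * lam * (t * real n powr a) / (real n)\<^sup>2) \<longlonglongrightarrow> of_bool (a = 2) * (2 * lam * t)"
    unfolding e2 using scaled_powr_tendsto[of "a - 2" "2 * lam * t"] assms by simp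
qed (use shift in auto)

text \<open>In the fixed frame the displacement scales as n^(a-1) and converges for a \<le> 1; the
  variance is then negligible, so the average degenerates to a translation.\<close>

lemma eta_tendsto:
  assumes "a \<le> b" "a \<le> 1"
  shows "(\<lambda>n. eta M X a f h n t) \<longlonglongrightarrow> 1 / \<beta> * (exp (- (of_bool (a = b) * (2 * c * t)))
    * (LINT y|lborel. gauss (- (of_bool (a = 1) * (2 * t))) 0 f y * h y))"
proof (rule eventually_eq_tendsto)
  show "eta M X a f h n t = field_corr u f h (\<lambda>n. t * real n powr a) (\<lambda>_. 0) n" if "n \<ge> 1" for n
    using eta_eq[OF that, of t] pos by (simp add: field_corr_def[OF lattice_correlation_u f h scaled_time_nonneg])
  have e1: "0 - 2 * (t * real n powr a) / real n = - (2 * t) * real n powr (a - 1)" for n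
    unfolding mult.assoc[symmetric] scaled_powr_divide by simp
  have "(\<lambda>n. 0 - 2 * (t * real n powr a) / real n) \<longlonglongrightarrow> - (of_bool (a = 1) * (2 * t))"
    unfolding e1 using scaled_powr_tendsto[of "a - 1" "- (2 * t)"] assms by simp
  from field_corr_tendsto_powr[OF _ assms(1) _ this] assms
  show "field_corr u f h (\<lambda>n. t * real n powr a) (\<lambda>_. 0) \<longlonglongrightarrow> 1 / \<beta> * (exp (- (of_bool (a = b) * (2 * c * t)))
    * (LINT y|lborel. gauss (- (of_bool (a = 1) * (2 * t))) 0 f y * h y))"
    by simp
qed

text \<open>The frame cancels the displacement exactly for each \<open>n\<close>, which lets the
  time scale extend up to the diffusive one.\<close>

lemma eta_tilde_tendsto:
  assumes "a \<le> b" "a \<le> 2"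
  shows "(\<lambda>n. eta_tilde M X a f h n t) \<longlonglongrightarrow> 1 / \<beta> * (exp (- (of_bool (a = b) * (2 * c * t)))
    * (LINT y|lborel. gauss 0 (of_bool (a = 2) * (2 * lam * t)) f y * h y))"
proof (rule eventually_eq_tendsto)
  let ?\<theta> = "\<lambda>n. 2 / real n * (t * real n powr a)"
  show "eta_tilde M X a f h n t = field_corr u f h (\<lambda>n. t * real n powr a) ?\<theta> n" if "n \<ge> 1" for n
    using eta_tilde_eq[OF that, of t] pos by (simp add: field_corr_def[OF lattice_correlation_u f h scaled_time_nonneg])
  have "(\<lambda>n. ?\<theta> n - 2 * (t * real n powr a) / real n) \<longlonglongrightarrow> 0" by simp
  from field_corr_tendsto_powr[OF _ assms(1) _ this] assms
  show "field_corr u f h (\<lambda>n. t * real n powr a) ?\<theta> \<longlonglongrightarrow> 1 / \<beta> * (exp (- (of_bool (a = b) * (2 * c * t)))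
    * (LINT y|lborel. gauss 0 (of_bool (a = 2) * (2 * lam * t)) f y * h y))"
    by simp
qed

lemma eta_decay_flip:
  assumes "b < a" "b < 2"
  shows "(\<lambda>n. eta M X a f h n t) \<longlonglongrightarrow> 0"
proof (rule eventually_eq_tendsto)
  show "eta M X a f h n t = field_corr u f h (\<lambda>n. t * real n powr a) (\<lambda>_. 0) n" if "n \<ge> 1" for n
    using eta_eq[OF that, of t] pos by (simp add: field_corr_def[OF lattice_correlation_u f h scaled_time_nonneg])
  \<comment> \<open>Strictly above \<open>b\<close>, so the damping diverges; at most
    \<open>a\<close>, so the time is available; below 2 and hence below 3, so the error
    vanishes.\<close>
  define a' where "a' = (b + min a 2) / 2"
  have a': "b < a'" "a' \<le> a" "a' < 3" using assms by (auto simp: a'_def)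
  show "field_corr u f h (\<lambda>n. t * real n powr a) (\<lambda>_. 0) \<longlonglongrightarrow> 0"
  proof (rule field_corr_flip_decay[OF lattice_correlation_u f h scaled_time_nonneg scaled_time_nonneg])
    show "t * real n powr a' \<le> t * real n powr a" if "n \<ge> 1" for n
      using pos a' that by (intro mult_left_mono powr_mono) auto
    show "(\<lambda>n. t * real n powr a' / real n ^ 3) \<longlonglongrightarrow> 0"
      unfolding scaled_powr_divide using scaled_powr_tendsto[of "a' - 3" t] a' by simp
    show "filterlim (\<lambda>n. flip n * (t * real n powr a')) at_top sequentially"
      unfolding flip_powr using scaled_powr_at_top[of "a' - b" "c * t"] a' pos by simp
  qed auto
qed

lemma eta_decay_exchange:
  assumes "2 < a"
  shows "(\<lambda>n. eta M X a f h n t) \<longlonglongrightarrow> 0"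
proof (rule eventually_eq_tendsto)
  show "eta M X a f h n t = field_corr u f h (\<lambda>n. t * real n powr a) (\<lambda>_. 0) n" if "n \<ge> 1" for n
    using eta_eq[OF that, of t] pos by (simp add: field_corr_def[OF lattice_correlation_u f h scaled_time_nonneg])
  \<comment> \<open>Strictly between 2, above which the variance diverges, and 3, below which the
    error vanishes, and at most \<open>a\<close>.\<close>
  define a' where "a' = (2 + min a 3) / 2"
  have a': "2 < a'" "a' \<le> a" "a' < 3" using assms by (auto simp: a'_def)
  show "field_corr u f h (\<lambda>n. t * real n powr a) (\<lambda>_. 0) \<longlonglongrightarrow> 0"
  proof (rule field_corr_exchange_decay[OF lattice_correlation_u f h scaled_time_nonneg scaled_time_nonneg])
    show "t * real n powr a' \<le> t * real n powr a" if "n \<ge> 1" for n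
      using pos a' that by (intro mult_left_mono powr_mono) auto
    show "0 < t * real n powr a'" if "n \<ge> 1" for n using pos that by simp
    show "(\<lambda>n. t * real n powr a' / real n ^ 3) \<longlonglongrightarrow> 0"
      unfolding scaled_powr_divide using scaled_powr_tendsto[of "a' - 3" t] a' by simp
    have e1: "2 * (lam / (real n)\<^sup>2) * (t * real n powr a') = (2 * lam * t) * real n powr (a' - 2)" for n
      unfolding scaled_powr_divide(2)[symmetric] by simp
    show "filterlim (\<lambda>n. 2 * (lam / (real n)\<^sup>2) * (t * real n powr a')) at_top sequentially"
      unfolding e1 using scaled_powr_at_top[of "a' - 2" "2 * lam * t"] a' pos by simp
  qed (use pos in auto)
qed

text \<open>The chain rule multiplies the lattice-time derivative by n^a. Drift defect, flips and
  exchanges contribute n^(-p), n^(-b) and n^(-2), so all three products vanish; \<open>p\<close> is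
  the order to which the frame cancels the drift.\<close>

lemma time_deriv_vanishesI:
  assumes e: "\<And>n s. n \<ge> 1 \<Longrightarrow> 0 \<le> s \<Longrightarrow> e n s = lattice_correlation.Q (u n) (s * real n powr a)
      (sample (real n) (\<epsilon> n * (s * real n powr a)) f) (sample (real n) 0 h) / real n"
    and E: "\<And>n z. n \<ge> 1 \<Longrightarrow> \<bar>f (z - 1 / real n) - f (z + 1 / real n) + \<epsilon> n * deriv f z\<bar> \<le> E * real n powr (- p) * peak z"
    and ap: "a < p" "a < b" "a < 2" "0 \<le> E"
  shows "time_deriv_vanishes e t"
proof -
  obtain C where C: "diff_bound f C" by (rule schwartz_diff_bound[OF f])
  obtain D where D: "sample_l2_bound h D" by (rule schwartz_sample_l2_bound[OF h])
  let ?B = "\<lambda>n. (E * real n powr (- p) + 2 * flip n * C + lam * C / (real n)\<^sup>2) * sqrt (3 * peak_mass) * D / \<beta>"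
  have ex: "\<exists>R. (e n has_real_derivative R) (at t) \<and> \<bar>R\<bar> \<le> ?B n * real n powr a" if n: "n \<ge> 1" for n
  proof -
    interpret lattice_correlation \<beta> "flip n" lam "u n" by (rule lattice_correlation_u[OF n])
    have n1: "1 \<le> real n" using n by simp
    have \<tau>: "0 < t * real n powr a" using pos n by simp
    have E0: "0 \<le> E * real n powr (- p)" using ap by simp
    obtain R where R: "((\<lambda>s. Q s (sample (real n) (\<epsilon> n * s) f) (sample (real n) 0 h) / real n) has_real_derivative R)
        (at (t * real n powr a))" "\<bar>R\<bar> \<le> ?B n"
      using time_derivative_bound[OF n1 f h C D \<tau> E0 E[OF n]] by blast
    have "((\<lambda>s. s * real n powr a) has_real_derivative real n powr a) (at t)"
      by (auto intro!: derivative_eq_intros)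
    from DERIV_chain2[OF R(1) this]
    have "((\<lambda>s. Q (s * real n powr a) (sample (real n) (\<epsilon> n * (s * real n powr a)) f) (sample (real n) 0 h) / real n)
        has_real_derivative R * real n powr a) (at t)" .
    then have "(e n has_real_derivative R * real n powr a) (at t)"
      by (rule has_field_derivative_transform_within_open[of _ _ _ "{0<..}"]) (use pos e[OF n] in auto)
    moreover have "\<bar>R * real n powr a\<bar> \<le> ?B n * real n powr a"
      using mult_right_mono[OF R(2), of "real n powr a"] by (simp add: abs_mult)
    ultimately show ?thesis by blast
  qed
  have "(\<lambda>n. deriv (e n) t) \<longlonglongrightarrow> 0"
  proof (rule Lim_null_comparison)
    show "\<forall>\<^sub>F n in sequentially. norm (deriv (e n) t) \<le> ?B n * real n powr a"
    proof (rule eventually_sequentiallyI[of 1])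
      fix n :: nat assume "1 \<le> n"
      from ex[OF this] show "norm (deriv (e n) t) \<le> ?B n * real n powr a"
        using DERIV_imp_deriv by fastforce
    qed
    have "(\<lambda>n. ?B n * real n powr a) = (\<lambda>n. (E * real n powr (a - p) + 2 * c * C * real n powr (a - b)
        + lam * C * real n powr (a - 2)) * (sqrt (3 * peak_mass) * D / \<beta>))"
    proof
      fix n
      have pw: "real n powr (- p) * real n powr a = real n powr (a - p)"
        "real n powr a / (real n)\<^sup>2 = real n powr (a - 2)"
        using powr_divide_power[of n a 2] by (simp_all flip: powr_add)
      have fl: "flip n * real n powr a = c * real n powr (a - b)"
        using flip_powr[of n a] pos by simp
      have "?B n * real n powr a = (E * (real n powr (- p) * real n powr a) + 2 * C * (flip n * real n powr a)
        + lam * C * (real n powr a / (real n)\<^sup>2)) * (sqrt (3 * peak_mass) * D / \<beta>)"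
        by (simp add: algebra_simps add_divide_distrib)
      then show "?B n * real n powr a = (E * real n powr (a - p) + 2 * c * C * real n powr (a - b)
        + lam * C * real n powr (a - 2)) * (sqrt (3 * peak_mass) * D / \<beta>)"
        unfolding pw fl by (simp only: mult.assoc mult.commute mult.left_commute)
    qed
    moreover have "(\<lambda>n. (E * real n powr (a - p) + 2 * c * C * real n powr (a - b)
        + lam * C * real n powr (a - 2)) * (sqrt (3 * peak_mass) * D / \<beta>)) \<longlonglongrightarrow> (0 + 0 + 0) * (sqrt (3 * peak_mass) * D / \<beta>)"
      using ap scaled_powr_tendsto[of "a - p" E] scaled_powr_tendsto[of "a - b" "2 * c * C"] scaled_powr_tendsto[of "a - 2" "lam * C"]
      by (intro tendsto_mult tendsto_add tendsto_const) auto
    ultimately show "(\<lambda>n. ?B n * real n powr a) \<longlonglongrightarrow> 0" by simp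
  qed
  moreover have "\<forall>n\<ge>1. e n differentiable at t" using ex real_differentiable_def by blast
  ultimately show ?thesis by (simp add: time_deriv_vanishes_def)
qed

lemma eta_time_deriv:
  assumes "a < 1" "a < b" shows "time_deriv_vanishes (eta M X a f h) t"
proof -
  obtain C where C: "diff_bound f C" by (rule schwartz_diff_bound[OF f])
  have C0: "0 \<le> C" using C by (simp add: diff_bound_def)
  show ?thesis
  proof (rule time_deriv_vanishesI[where \<epsilon> = "\<lambda>_. 0" and E = C and p = 1])
    fix n :: nat and z assume n: "n \<ge> 1"
    then have "0 \<le> 1 / real n" "1 / real n \<le> 1" by auto
    then have "\<bar>f (z - 1 / real n) - f (z + 1 / real n)\<bar> \<le> C * (1 / real n) * peak z"
      using C unfolding diff_bound_def by blast
    then show "\<bar>f (z - 1 / real n) - f (z + 1 / real n) + 0 * deriv f z\<bar> \<le> C * real n powr (- 1) * peak z"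
      using n by (simp add: powr_minus_divide)
  qed (use assms eta_eq C0 in auto)
qed

text \<open>In the moving frame the drift defect is of third order, so flips and exchanges set the
  limit on \<open>a\<close>.\<close>

lemma eta_tilde_time_deriv:
  assumes "a < 2" "a < b" shows "time_deriv_vanishes (eta_tilde M X a f h) t"
proof -
  obtain C where C: "diff_bound f C" by (rule schwartz_diff_bound[OF f])
  have C0: "0 \<le> C" using C by (simp add: diff_bound_def)
  show ?thesis
  proof (rule time_deriv_vanishesI[where \<epsilon> = "\<lambda>n. 2 / real n" and E = C and p = 3])
    fix n :: nat and z assume n: "n \<ge> 1"
    then have "0 \<le> 1 / real n" "1 / real n \<le> 1" by auto
    then have "\<bar>f (z - 1 / real n) - f (z + 1 / real n) + 2 * (1 / real n) * deriv f z\<bar> \<le> C * (1 / real n) ^ 3 * peak z"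
      using C unfolding diff_bound_def by blast
    moreover have "real n powr (- 3) = (1 / real n) ^ 3"
      using powr_divide_power[of n 0 3] n by (simp add: power_one_over)
    ultimately show "\<bar>f (z - 1 / real n) - f (z + 1 / real n) + 2 / real n * deriv f z\<bar> \<le> C * real n powr (- 3) * peak z"
      by simp
  qed (use assms eta_tilde_eq C0 in auto)
qed

text \<open>Any solution of the linear equation is the exponential, by uniqueness; b < 2 keeps the
  variance negligible, so damping is the only effect left.\<close>

lemma eta_tilde_critical:
  assumes "a = b" "b < 2" "e 0 = eta0 \<beta> f h"
    and "\<And>s. 0 \<le> s \<Longrightarrow> (e has_real_derivative - 2 * c * e s) (at s within {0..})"
  shows "(\<lambda>n. eta_tilde M X a f h n t) \<longlonglongrightarrow> e t"
proof -
  have "e t = exp (- 2 * c * t) * e 0"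
    using exponential_ode_unique[of e "- 2 * c" t] assms(4) pos by simp
  then show ?thesis
    using eta_tilde_tendsto assms by (simp add: gauss_id eta0_def)
qed

end

theorem theorem3p3:
  fixes \<beta> lam c a b t :: real
    and f h :: "real \<Rightarrow> real"
    and M :: "nat \<Rightarrow> 'w measure"
    and X :: "nat \<Rightarrow> real \<Rightarrow> 'w \<Rightarrow> config"
    and K :: "nat \<Rightarrow> real \<Rightarrow> config \<Rightarrow> config measure"
  assumes "\<beta> > 0" "lam > 0" "c > 0" "b > 0" "a > 0" "t > 0"
    and "schwartz f" "schwartz h"
    and "\<And>n. n \<ge> 1 \<Longrightarrow> stationary_process \<beta> (c * real n powr (- b)) lam (M n) (X n) (K n)"
  shows
    "(b \<le> 1 \<longrightarrow>
       (a < b \<longrightarrow>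
          time_deriv_vanishes (eta M X a f h) t \<and>
          (\<lambda>n. eta M X a f h n t) \<longlonglongrightarrow> eta0 \<beta> f h) \<and>
       (a = b \<longrightarrow>
          (\<lambda>n. eta M X a f h n t) \<longlonglongrightarrow>
            1 / \<beta> * dist_pairing
              (fundamental_solution
                (\<lambda>T \<phi>. of_bool (b = 1) * 2 * dist_nabla T \<phi> - 2 * c * T \<phi>) t) f h) \<and>
       (a > b \<longrightarrow> (\<lambda>n. eta M X a f h n t) \<longlonglongrightarrow> 0)) \<and>
     (1 < b \<and> b < 2 \<longrightarrow>
       (a < b \<and> 0 < a \<and> a < 1 \<longrightarrow>
          time_deriv_vanishes (eta M X a f h) t \<and>
          (\<lambda>n. eta M X a f h n t) \<longlonglongrightarrow> eta0 \<beta> f h) \<and>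
       (a < b \<and> 1 < a \<and> a < 2 \<longrightarrow>
          time_deriv_vanishes (eta_tilde M X a f h) t \<and>
          (\<lambda>n. eta_tilde M X a f h n t) \<longlonglongrightarrow> eta0 \<beta> f h) \<and>
       (a = 1 \<longrightarrow>
          (\<lambda>n. eta M X a f h n t) \<longlonglongrightarrow>
            1 / \<beta> * dist_pairing
              (fundamental_solution (\<lambda>T \<phi>. 2 * dist_nabla T \<phi>) t) f h) \<and>
       (a = b \<longrightarrow>
          (\<forall>e. e 0 = eta0 \<beta> f h \<longrightarrow>
             (\<forall>s\<ge>0. (e has_real_derivative - 2 * c * e s) (at s within {0..})) \<longrightarrow>
             (\<lambda>n. eta_tilde M X a f h n t) \<longlonglongrightarrow> e t)) \<and>
       (a > b \<longrightarrow> (\<lambda>n. eta M X a f h n t) \<longlonglongrightarrow> 0)) \<and>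
     (b \<ge> 2 \<longrightarrow>
       (0 < a \<and> a < 1 \<longrightarrow>
          time_deriv_vanishes (eta M X a f h) t \<and>
          (\<lambda>n. eta M X a f h n t) \<longlonglongrightarrow> eta0 \<beta> f h) \<and>
       (1 < a \<and> a < 2 \<longrightarrow>
          time_deriv_vanishes (eta_tilde M X a f h) t \<and>
          (\<lambda>n. eta_tilde M X a f h n t) \<longlonglongrightarrow> eta0 \<beta> f h) \<and>
       (a = 1 \<longrightarrow>
          (\<lambda>n. eta M X a f h n t) \<longlonglongrightarrow>
            1 / \<beta> * dist_pairing
              (fundamental_solution (\<lambda>T \<phi>. 2 * dist_nabla T \<phi>) t) f h) \<and>
       (a = 2 \<longrightarrow>
          (\<lambda>n. eta_tilde M X a f h n t) \<longlonglongrightarrow>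
            1 / \<beta> * dist_pairing
              (fundamental_solution
                (\<lambda>T \<phi>. lam * dist_laplace T \<phi> - of_bool (b = 2) * 2 * c * T \<phi>) t) f h) \<and>
       (a > 2 \<longrightarrow> (\<lambda>n. eta M X a f h n t) \<longlonglongrightarrow> 0))"
proof -
  interpret scaled_process \<beta> lam c a b t f h M X K
    by unfold_locales (use assms in auto)
  \<comment> \<open>Each generator of the statement is an instance of
    \<open>drift_diffusion\<close>; zero diffusivity is allowed, so pure transport needs no separate
    theory.\<close>
  have G1: "(\<lambda>T \<phi>. of_bool (b = 1) * 2 * dist_nabla T \<phi> - 2 * c * T \<phi>) = drift_diffusion (of_bool (b = 1) * 2) 0 (2 * c)"
    and G2: "(\<lambda>T \<phi>. 2 * dist_nabla T \<phi>) = drift_diffusion 2 0 0"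
    and G3: "(\<lambda>T \<phi>. lam * dist_laplace T \<phi> - of_bool (b = 2) * 2 * c * T \<phi>)
      = drift_diffusion 0 lam (of_bool (b = 2) * (2 * c))"
    by (auto simp: drift_diffusion_def fun_eq_iff)
  note P = dist_pairing_fundamental_solution[OF f h _ less_imp_le[OF pos(4)]]
  have free: "(\<lambda>n. eta M X a f h n t) \<longlonglongrightarrow> eta0 \<beta> f h" if "a < b" "a < 1"
    using eta_tendsto that by (simp add: gauss_id eta0_def)
  have free_tilde: "(\<lambda>n. eta_tilde M X a f h n t) \<longlonglongrightarrow> eta0 \<beta> f h" if "a < b" "a < 2"
    using eta_tilde_tendsto that by (simp add: gauss_id eta0_def)
  have flip_critical: "(\<lambda>n. eta M X a f h n t) \<longlonglongrightarrow> 1 / \<beta> * dist_pairing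
      (fundamental_solution (\<lambda>T \<phi>. of_bool (b = 1) * 2 * dist_nabla T \<phi> - 2 * c * T \<phi>) t) f h"
    if "a = b" "b \<le> 1"
    unfolding P[OF order_refl G1] using eta_tendsto that by (simp add: mult_ac)
  have transport: "(\<lambda>n. eta M X a f h n t) \<longlonglongrightarrow> 1 / \<beta> * dist_pairing
      (fundamental_solution (\<lambda>T \<phi>. 2 * dist_nabla T \<phi>) t) f h" if "a = 1" "1 < b"
    unfolding P[OF order_refl G2] using eta_tendsto that by simp
  have diffusion: "(\<lambda>n. eta_tilde M X a f h n t) \<longlonglongrightarrow> 1 / \<beta> * dist_pairing
      (fundamental_solution (\<lambda>T \<phi>. lam * dist_laplace T \<phi> - of_bool (b = 2) * 2 * c * T \<phi>) t) f h"
    if "a = 2" "2 \<le> b"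
    unfolding P[OF less_imp_le[OF pos(2)] G3] using eta_tilde_tendsto that by (cases "b = 2") simp_all
  \<comment> \<open>Of the vanishing limits, those with b < 2 come from the flips, and the one with
    b \<ge> 2 and a > 2 from the exchanges.\<close>
  show ?thesis
    using free free_tilde flip_critical transport diffusion eta_time_deriv eta_tilde_time_deriv
      eta_decay_flip eta_decay_exchange eta_tilde_critical
    by (intro conjI impI allI) auto
qed

end
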